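(* In the setting described in the context, let $$\Upsilon_1:=\bigoplus_{1\le k\le4n+1,\ k\ne2n+1}\mathcal O_{\mathbb P^{2n+1}}\big(2\alpha(2n+1)+k(\beta-\alpha)\big).$$ Starting from the exact sequence $0\to N(f)(-1)\to D_1\otimes\mathcal O_{\mathbb P(V)}\to F(W)(1)\to0$ on $\mathbb P(V)$, $V=S^{2n+1}U$, one has an exact sequence on $\mathbb P^{2n+1}$ $$0\to\mathcal N(-\gamma)\to\Upsilon_1\to\mathcal F(\gamma)\to0,$$ where $\mathcal N$ is the weighted $0$-correlation bundle and $\mathcal F$ the weighted Tango bundle on $\mathbb P^{2n+1}$ (the twisted generalized inverse images of $N(f)$ and $F(W)$).
   Context: Everything is over $\mathbb C$. Let $n\ge1$, $\alpha,\gamma\in\mathbb N$, $\beta\in\mathbb Z$ with $\gamma>0$, $\alpha\ge\beta$, $\alpha+\beta\ge0$, $\gamma>(2n+1)|\beta|$. Let $U=\mathbb C^2$ with basis $x,y$, $V=S^{2n+1}U$ with basis $e_j=x^{2n+1-j}y^j$ ($0\le j\le 2n+1$). $\mathbb C^*$ acts on $U$ by $\mathrm{diag}(t^\alpha,t^\beta)$, and on $V,\bigwedge^2V$ accordingly. For $1\le k\le 4n+1$ let $E_k\subset\bigwedge^2V$ be spanned by $e_p\wedge e_q$, $p<q$, $p+q=k$. Let $W\subset\bigwedge^2V$ be a $\mathbb C^*$-invariant subspace of dimension $\binom{2n+2}{2}-4n-1$ containing no nonzero decomposable element; invariance means $W=\bigoplus_kW_k$, $W_k=W\cap E_k$ (each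 $W_k$ is a hyperplane of $E_k$). Let $f\in(\bigwedge^2V)^*$ be the linear form, unique up to nonzero scalar, vanishing on $W$ and on all $E_k$, $k\ne2n+1$; it is nondegenerate. Write $f_{ij}=f(e_i\wedge e_j)$. Choose $d_k\in E_k\setminus W_k$ for $k\ne2n+1$ and put $D_1=\bigoplus_{1\le k\le 4n+1,\,k\ne2n+1}\mathbb C d_k$. On $\mathbb P(V)$: $Q$ is the quotient bundle ($0\to\mathcal O(-1)\xrightarrow{g}V\otimes\mathcal O\to Q\to0$), $N(f)=\ker(Q\to\mathcal O(1))$ with the map induced by ${}^Tg\circ f$, and $F(W)$ is defined by $0\to Q(-1)\to(\bigwedge^2V/W)\otimes\mathcal O\to F(W)(1)\to0$ with first map $\bar u\otimes v\mapsto v\wedge u$ mod $W$ at the line $\mathbb Cv$. Let $g_0,\dots,g_{2n+1}$ be homogeneous forms in $2n+2$ variables without common zero on $\mathbb P^{2n+1}$, $\deg g_i=\gamma+(2n+1)\alpha+i(\beta-\alpha)$. The map $\omega=(g_0,\dots,g_{2n+1}):\mathbb C^{2n+2}\setminus0\to V\setminus0$ is equivariant for scalar multiplication on the source and the action $\sigma(t)=t^\gamma\cdot S^{2n+1}\mathrm{diag}(t^\alpha,t^\beta)$ on the target. The generalized inverse image of a $\mathbb C^*$-linearized bundle on $\mathbb P(V)$ is the bundle on $\mathbb P^{2n+1}$ obtained by pulling it back to $V\setminus0$, then by $\omega$, and descending along $\mathbb C^{2n+2}\setminus0\to\mathbb P^{2n+1}$. Explicitly, the bundles in the statement are as follows.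 Let $S^{2n+1}\mathcal U=\bigoplus_j\mathcal O_{\mathbb P^{2n+1}}((2n+1)\alpha+j(\beta-\alpha))$, where $\mathcal U=\mathcal O(\alpha)\oplus\mathcal O(\beta)$. - $\mathcal Q=\mathrm{coker}\big((g_i):\mathcal O(-\gamma)\to S^{2n+1}\mathcal U\big)$; - $\mathcal N=\ker\big(\mathcal Q\to\mathcal O(\gamma+(2n+1)(\alpha+\beta))\big)$, the map induced by $(s_j)\mapsto\sum f_{ij}g_is_j$; - $\mathcal F(\gamma)=\mathrm{coker}\big(\mathcal Q(-\gamma)\to\bigoplus_{k=1}^{4n+1}(E_k/W_k)\otimes\mathcal O(2(2n+1)\alpha+k(\beta-\alpha))\big)$, the map induced by $(s_j)\mapsto\sum g_is_j\,e_i\wedge e_j$ mod $W$. *)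

theory Defs
  imports
    "HOL-Algebra.Module"
    "HOL-Analysis.Abstract_Topology"
    "HOL-Library.Function_Algebras"
begin

section \<open>Projective space and its line bundles\<close>

text \<open>
  Projective space of dimension \<open>m\<close> has homogeneous coordinates \<open>x 0, \<dots>, x m\<close>.  Coordinate vectors
  are functions on \<open>nat\<close> that vanish beyond \<open>m\<close>, and a point is a punctured line, so that for a set
  \<open>U\<close> of points \<open>\<Union>U\<close> is the punctured cone over \<open>U\<close>.
\<close>

type_synonym cvec = "nat \<Rightarrow> complex"
type_synonym pset = "cvec set set"

definition vecs :: "nat \<Rightarrow> cvec set" where
  "vecs m = {x. \<forall>i>m. x i = 0}"

definition proj :: "nat \<Rightarrow> pset" where
  "proj m = {{(\<lambda>i. c * x i) |c. c \<noteq> 0} |x. x \<in> vecs m \<and> x \<noteq> 0}"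

text \<open>
  Forms are represented by their polynomial functions (the ground field is infinite).  The degree
  is an integer; in negative degree only the zero form exists.
\<close>

definition forms :: "nat \<Rightarrow> int \<Rightarrow> (cvec \<Rightarrow> complex) set" where
  "forms m d = {(\<lambda>x. \<Sum>\<mu>\<in>M. c \<mu> * (\<Prod>i\<le>m. x i ^ \<mu> i)) |(M :: (nat \<Rightarrow> nat) set) c.
     finite M \<and> (\<forall>\<mu>\<in>M. int (\<Sum>i\<le>m. \<mu> i) = d)}"

definition zariski :: "nat \<Rightarrow> cvec set topology" where
  "zariski m = topology_generated_by {{L \<in> proj m. \<forall>x\<in>L. h x \<noteq> 0} |h d. h \<in> forms m d}"

definition chart :: "nat \<Rightarrow> nat \<Rightarrow> pset" where
  "chart m i = {L \<in> proj m. \<forall>x\<in>L. x i \<noteq> 0}"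

text \<open>
  Sections of \<open>O(d)\<close> over \<open>U\<close>: functions on the cone over \<open>U\<close> that are locally fractions of forms
  of degree \<open>d\<close>, extended by zero.
\<close>

definition osect :: "nat \<Rightarrow> int \<Rightarrow> pset \<Rightarrow> (cvec \<Rightarrow> complex) set" where
  "osect m d U = {s. (\<forall>x. x \<notin> \<Union>U \<longrightarrow> s x = 0) \<and>
     (\<forall>L\<in>U. \<exists>T a b p q. openin (zariski m) T \<and> L \<in> T \<and> T \<subseteq> U \<and>
        p \<in> forms m a \<and> q \<in> forms m b \<and> a - b = d \<and>
        (\<forall>x\<in>\<Union>T. q x \<noteq> 0 \<and> s x = p x / q x))}"

definition ores :: "pset \<Rightarrow> (cvec \<Rightarrow> complex) \<Rightarrow> cvec \<Rightarrow> complex" where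
  "ores T s = (\<lambda>x. if x \<in> \<Union>T then s x else 0)"


section \<open>Sheaves of modules\<close>

text \<open>
  A sheaf of modules over the structure sheaf \<open>osect m 0\<close> is given by its modules of sections
  (the multiplicative fields of the module record are irrelevant) and its restriction maps;
  \<open>res A U T\<close> restricts from \<open>U\<close> to \<open>T\<close>.  A morphism is a family of maps indexed by the open sets.
\<close>

record 's mod_sheaf =
  sect :: "pset \<Rightarrow> (cvec \<Rightarrow> complex, 's) module"
  res :: "pset \<Rightarrow> pset \<Rightarrow> 's \<Rightarrow> 's"

definition sheaf_hom ::
  "nat \<Rightarrow> 's mod_sheaf \<Rightarrow> 't mod_sheaf \<Rightarrow> (pset \<Rightarrow> 's \<Rightarrow> 't) \<Rightarrow> bool" where
  "sheaf_hom m A B \<phi> \<longleftrightarrow> (\<forall>U. openin (zariski m) U \<longrightarrow>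
     \<phi> U \<in> carrier (sect A U) \<rightarrow> carrier (sect B U) \<and>
     (\<forall>s\<in>carrier (sect A U). \<forall>t\<in>carrier (sect A U).
        \<phi> U (s \<oplus>\<^bsub>sect A U\<^esub> t) = \<phi> U s \<oplus>\<^bsub>sect B U\<^esub> \<phi> U t) \<and>
     (\<forall>r\<in>osect m 0 U. \<forall>s\<in>carrier (sect A U).
        \<phi> U (r \<odot>\<^bsub>sect A U\<^esub> s) = r \<odot>\<^bsub>sect B U\<^esub> \<phi> U s) \<and>
     (\<forall>T. openin (zariski m) T \<longrightarrow> T \<subseteq> U \<longrightarrow>
        (\<forall>s\<in>carrier (sect A U). res B U T (\<phi> U s) = \<phi> T (res A U T s))))"

text \<open>Sections of the image sheaf: sections that are images locally.\<close>

definition im_sect ::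
  "nat \<Rightarrow> 's mod_sheaf \<Rightarrow> 't mod_sheaf \<Rightarrow> (pset \<Rightarrow> 's \<Rightarrow> 't) \<Rightarrow> pset \<Rightarrow> 't set" where
  "im_sect m A B \<phi> U = {t \<in> carrier (sect B U).
     \<forall>L\<in>U. \<exists>T. openin (zariski m) T \<and> L \<in> T \<and> T \<subseteq> U \<and>
       res B U T t \<in> \<phi> T ` carrier (sect A T)}"

definition ker_sect ::
  "'s mod_sheaf \<Rightarrow> 't mod_sheaf \<Rightarrow> (pset \<Rightarrow> 's \<Rightarrow> 't) \<Rightarrow> pset \<Rightarrow> 's set" where
  "ker_sect A B \<phi> U = {s \<in> carrier (sect A U). \<phi> U s = \<zero>\<^bsub>sect B U\<^esub>}"

definition short_exact ::
  "nat \<Rightarrow> 's mod_sheaf \<Rightarrow> 't mod_sheaf \<Rightarrow> 'u mod_sheaf \<Rightarrow>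
   (pset \<Rightarrow> 's \<Rightarrow> 't) \<Rightarrow> (pset \<Rightarrow> 't \<Rightarrow> 'u) \<Rightarrow> bool" where
  "short_exact m A B C \<phi> \<psi> \<longleftrightarrow>
     sheaf_hom m A B \<phi> \<and> sheaf_hom m B C \<psi> \<and>
     (\<forall>U. openin (zariski m) U \<longrightarrow>
        ker_sect A B \<phi> U = {\<zero>\<^bsub>sect A U\<^esub>} \<and>
        ker_sect B C \<psi> U = im_sect m A B \<phi> U \<and>
        im_sect m B C \<psi> U = carrier (sect C U))"

definition line_sheaf :: "nat \<Rightarrow> int \<Rightarrow> (cvec \<Rightarrow> complex) mod_sheaf" where
  "line_sheaf m d = \<lparr>
     sect = (\<lambda>U. \<lparr>carrier = osect m d U, mult = undefined, one = undefined,
        zero = (\<lambda>x. 0), add = (\<lambda>s t x. s x + t x), smult = (\<lambda>r s x. r x * s x)\<rparr>),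
     res = (\<lambda>U T. ores T)\<rparr>"

definition dsum :: "'i set \<Rightarrow> ('i \<Rightarrow> 's mod_sheaf) \<Rightarrow> ('i \<Rightarrow> 's) mod_sheaf" where
  "dsum I F = \<lparr>
     sect = (\<lambda>U. \<lparr>carrier = (\<Pi>\<^sub>E i\<in>I. carrier (sect (F i) U)), mult = undefined, one = undefined,
        zero = (\<lambda>i\<in>I. \<zero>\<^bsub>sect (F i) U\<^esub>),
        add = (\<lambda>s t. \<lambda>i\<in>I. s i \<oplus>\<^bsub>sect (F i) U\<^esub> t i),
        smult = (\<lambda>r s. \<lambda>i\<in>I. r \<odot>\<^bsub>sect (F i) U\<^esub> s i)\<rparr>),
     res = (\<lambda>U T s. \<lambda>i\<in>I. res (F i) U T (s i))\<rparr>"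

definition ker_sheaf ::
  "'s mod_sheaf \<Rightarrow> 't mod_sheaf \<Rightarrow> (pset \<Rightarrow> 's \<Rightarrow> 't) \<Rightarrow> 's mod_sheaf" where
  "ker_sheaf A B \<phi> = A\<lparr>sect := (\<lambda>U. (sect A U)\<lparr>carrier := ker_sect A B \<phi> U\<rparr>)\<rparr>"

text \<open>
  The cokernel is the sheafification of \<open>U \<mapsto> B(U) / \<phi>(A(U))\<close>: \<open>coker_germ m A B \<phi> L U b\<close> is the germ
  at \<open>L\<close> of the class of \<open>b \<in> B(U)\<close>, as a set of representatives \<open>(V, c)\<close> with \<open>c \<in> B(V)\<close>, and a
  section is a function from points to germs which locally comes from a section of \<open>B\<close>.  In
  \<open>add\<close> and \<open>smult\<close> the union is over representatives, all of which give the same germ.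
\<close>

definition coker_germ ::
  "nat \<Rightarrow> 's mod_sheaf \<Rightarrow> 't mod_sheaf \<Rightarrow> (pset \<Rightarrow> 's \<Rightarrow> 't) \<Rightarrow>
   cvec set \<Rightarrow> pset \<Rightarrow> 't \<Rightarrow> (pset \<times> 't) set" where
  "coker_germ m A B \<phi> L U b = {(V, c). openin (zariski m) V \<and> L \<in> V \<and> c \<in> carrier (sect B V) \<and>
     (\<exists>T. openin (zariski m) T \<and> L \<in> T \<and> T \<subseteq> U \<inter> V \<and>
        (\<exists>a\<in>carrier (sect A T). res B V T c = res B U T b \<oplus>\<^bsub>sect B T\<^esub> \<phi> T a))}"

definition coker_sheaf ::
  "nat \<Rightarrow> 's mod_sheaf \<Rightarrow> 't mod_sheaf \<Rightarrow> (pset \<Rightarrow> 's \<Rightarrow> 't) \<Rightarrow>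
   (cvec set \<Rightarrow> (pset \<times> 't) set) mod_sheaf" where
  "coker_sheaf m A B \<phi> = \<lparr>
     sect = (\<lambda>U. \<lparr>
       carrier = {s \<in> extensional U. \<forall>L\<in>U. \<exists>T b. openin (zariski m) T \<and> L \<in> T \<and> T \<subseteq> U \<and>
          b \<in> carrier (sect B T) \<and> (\<forall>M\<in>T. s M = coker_germ m A B \<phi> M T b)},
       mult = undefined, one = undefined,
       zero = (\<lambda>L\<in>U. coker_germ m A B \<phi> L U \<zero>\<^bsub>sect B U\<^esub>),
       add = (\<lambda>s t. \<lambda>L\<in>U. \<Union>(V, b)\<in>s L. \<Union>(V', b')\<in>t L.
          coker_germ m A B \<phi> L (V \<inter> V')
            (res B V (V \<inter> V') b \<oplus>\<^bsub>sect B (V \<inter> V')\<^esub> res B V' (V \<inter> V') b')),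
       smult = (\<lambda>r s. \<lambda>L\<in>U. \<Union>(V, b)\<in>s L.
          coker_germ m A B \<phi> L (U \<inter> V)
            (ores (U \<inter> V) r \<odot>\<^bsub>sect B (U \<inter> V)\<^esub> res B V (U \<inter> V) b))\<rparr>),
     res = (\<lambda>U T s. restrict s T)\<rparr>"

definition coker_proj ::
  "nat \<Rightarrow> 's mod_sheaf \<Rightarrow> 't mod_sheaf \<Rightarrow> (pset \<Rightarrow> 's \<Rightarrow> 't) \<Rightarrow>
   pset \<Rightarrow> 't \<Rightarrow> cvec set \<Rightarrow> (pset \<times> 't) set" where
  "coker_proj m A B \<phi> U b = (\<lambda>L\<in>U. coker_germ m A B \<phi> L U b)"

text \<open>The map \<open>coker \<phi> \<rightarrow> C\<close> induced by a morphism \<open>\<psi> : B \<rightarrow> C\<close> with \<open>\<psi> \<circ> \<phi> = 0\<close>.\<close>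

definition coker_lift ::
  "nat \<Rightarrow> 's mod_sheaf \<Rightarrow> 't mod_sheaf \<Rightarrow> (pset \<Rightarrow> 's \<Rightarrow> 't) \<Rightarrow>
   'u mod_sheaf \<Rightarrow> (pset \<Rightarrow> 't \<Rightarrow> 'u) \<Rightarrow> pset \<Rightarrow> (cvec set \<Rightarrow> (pset \<times> 't) set) \<Rightarrow> 'u" where
  "coker_lift m A B \<phi> C \<psi> U s = (THE c. c \<in> carrier (sect C U) \<and>
     (\<forall>T b. openin (zariski m) T \<and> T \<subseteq> U \<and> b \<in> carrier (sect B T) \<and>
        (\<forall>L\<in>T. s L = coker_germ m A B \<phi> L T b) \<longrightarrow> res C U T c = \<psi> T b))"

text \<open>
  The twist \<open>F(e) = F \<otimes> O(e)\<close>, glued from the restrictions of \<open>F\<close> to the standard charts, on which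
  \<open>O(e)\<close> is trivialised by \<open>x i\<close> to the power \<open>e\<close>: the family \<open>(s i)\<close> stands for the section that equals
  \<open>s i \<otimes> x i powi e\<close> on the chart \<open>x i \<noteq> 0\<close>.
\<close>

definition twist :: "nat \<Rightarrow> int \<Rightarrow> 's mod_sheaf \<Rightarrow> (nat \<Rightarrow> 's) mod_sheaf" where
  "twist m e F = \<lparr>
     sect = (\<lambda>U. \<lparr>
       carrier = {s \<in> (\<Pi>\<^sub>E i\<in>{..m}. carrier (sect F (U \<inter> chart m i))).
         \<forall>i\<le>m. \<forall>j\<le>m. let T = U \<inter> chart m i \<inter> chart m j in
           res F (U \<inter> chart m j) T (s j) =
             ores T (\<lambda>x. (x i / x j) powi e) \<odot>\<^bsub>sect F T\<^esub> res F (U \<inter> chart m i) T (s i)},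
       mult = undefined, one = undefined,
       zero = (\<lambda>i\<in>{..m}. \<zero>\<^bsub>sect F (U \<inter> chart m i)\<^esub>),
       add = (\<lambda>s t. \<lambda>i\<in>{..m}. s i \<oplus>\<^bsub>sect F (U \<inter> chart m i)\<^esub> t i),
       smult = (\<lambda>r s. \<lambda>i\<in>{..m}. ores (U \<inter> chart m i) r \<odot>\<^bsub>sect F (U \<inter> chart m i)\<^esub> s i)\<rparr>),
     res = (\<lambda>U T s. \<lambda>i\<in>{..m}. res F (U \<inter> chart m i) (T \<inter> chart m i) (s i))\<rparr>"


section \<open>The exterior square\<close>

interpretation cfun: vector_space "\<lambda>(c :: complex) (v :: 'i \<Rightarrow> complex) i. c * v i"
  by unfold_locales (auto simp: fun_eq_iff algebra_simps)

text \<open>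
  \<open>V\<close> is \<open>vecs (2*n+1)\<close>, with basis \<open>unit_vec j\<close> for \<open>j \<le> 2*n+1\<close>.  Elements of its exterior square
  are given by their coordinates at \<open>e\<^sub>p \<and> e\<^sub>q\<close> for \<open>p < q\<close>.
\<close>

type_synonym bivec = "nat \<times> nat \<Rightarrow> complex"

definition unit_vec :: "nat \<Rightarrow> cvec" where
  "unit_vec j = (\<lambda>i. if i = j then 1 else 0)"

definition wedge :: "cvec \<Rightarrow> cvec \<Rightarrow> bivec" where
  "wedge u v = (\<lambda>(p, q). if p < q then u p * v q - u q * v p else 0)"

definition basis_wedge :: "nat \<Rightarrow> nat \<Rightarrow> bivec" where
  "basis_wedge i j = wedge (unit_vec i) (unit_vec j)"

definition ext2 :: "nat \<Rightarrow> bivec set" where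
  "ext2 n = cfun.span {basis_wedge p q |p q. p < q \<and> q \<le> 2*n+1}"

definition ext2_weight :: "nat \<Rightarrow> nat \<Rightarrow> bivec set" where
  "ext2_weight n k = cfun.span {basis_wedge p q |p q. p < q \<and> q \<le> 2*n+1 \<and> p + q = k}"

definition linear_form_on :: "bivec set \<Rightarrow> (bivec \<Rightarrow> complex) \<Rightarrow> bool" where
  "linear_form_on S f \<longleftrightarrow> (\<forall>u\<in>S. \<forall>v\<in>S. f (u + v) = f u + f v) \<and>
     (\<forall>c. \<forall>u\<in>S. f (\<lambda>i. c * u i) = c * f u)"

definition coset :: "bivec set \<Rightarrow> bivec \<Rightarrow> bivec set" where
  "coset W v = (\<lambda>w. v + w) ` W"

text \<open>
  The sheaf \<open>(E/W) \<otimes> O(d)\<close> for vector spaces \<open>W \<subseteq> E\<close>.  A section is a function from the cone over \<open>U\<close>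
  to the cosets of \<open>W\<close>, with value \<open>{}\<close> outside the cone.
\<close>

definition quot_sheaf :: "nat \<Rightarrow> int \<Rightarrow> bivec set \<Rightarrow> bivec set \<Rightarrow> (cvec \<Rightarrow> bivec set) mod_sheaf" where
  "quot_sheaf m d E W = \<lparr>
     sect = (\<lambda>U. \<lparr>
       carrier = {(\<lambda>x. if x \<in> \<Union>U then coset W (\<lambda>i. \<Sum>l<r. h l x * b l i) else {}) |(r :: nat) h b.
         \<forall>l<r. h l \<in> osect m d U \<and> b l \<in> E},
       mult = undefined, one = undefined,
       zero = (\<lambda>x. if x \<in> \<Union>U then W else {}),
       add = (\<lambda>s t x. {u + v |u v. u \<in> s x \<and> v \<in> t x}),
       smult = (\<lambda>r s x. {(\<lambda>i. r x * u i) + w |u w. u \<in> s x \<and> w \<in> W})\<rparr>),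
     res = (\<lambda>U T s x. if x \<in> \<Union>T then s x else {})\<rparr>"


section \<open>The bundles\<close>

text \<open>
  All sheaves live on projective space of dimension \<open>2*n+1\<close>; \<open>\<alpha>\<close>, \<open>\<beta>\<close>, \<open>\<gamma>\<close> are the weights and \<open>g\<close>
  is the equivariant map.  For weights \<open>0\<close>, \<open>0\<close>, \<open>1\<close> and \<open>g = (\<lambda>i x. x i)\<close> the definitions become
  those of \<open>Q\<close>, \<open>N(f)\<close>, \<open>F(W)(1)\<close> and \<open>D\<^sub>1 \<otimes> O\<close> on \<open>P(V)\<close>.
\<close>

definition sym_sheaf :: "nat \<Rightarrow> int \<Rightarrow> int \<Rightarrow> (nat \<Rightarrow> cvec \<Rightarrow> complex) mod_sheaf" where
  "sym_sheaf n \<alpha> \<beta> =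
     dsum {..2*n+1} (\<lambda>j. line_sheaf (2*n+1) ((2 * int n + 1) * \<alpha> + int j * (\<beta> - \<alpha>)))"

definition mult_g :: "nat \<Rightarrow> (nat \<Rightarrow> cvec \<Rightarrow> complex) \<Rightarrow>
    pset \<Rightarrow> (cvec \<Rightarrow> complex) \<Rightarrow> nat \<Rightarrow> cvec \<Rightarrow> complex" where
  "mult_g n g U h = (\<lambda>i\<in>{..2*n+1}. \<lambda>x. g i x * h x)"

definition quotient_bundle :: "nat \<Rightarrow> int \<Rightarrow> int \<Rightarrow> int \<Rightarrow> (nat \<Rightarrow> cvec \<Rightarrow> complex) \<Rightarrow>
    (cvec set \<Rightarrow> (pset \<times> (nat \<Rightarrow> cvec \<Rightarrow> complex)) set) mod_sheaf" where
  "quotient_bundle n \<alpha> \<beta> \<gamma> g =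
     coker_sheaf (2*n+1) (line_sheaf (2*n+1) (- \<gamma>)) (sym_sheaf n \<alpha> \<beta>) (mult_g n g)"

definition corr_map :: "nat \<Rightarrow> int \<Rightarrow> int \<Rightarrow> int \<Rightarrow> (nat \<Rightarrow> cvec \<Rightarrow> complex) \<Rightarrow> (bivec \<Rightarrow> complex) \<Rightarrow>
    pset \<Rightarrow> (cvec set \<Rightarrow> (pset \<times> (nat \<Rightarrow> cvec \<Rightarrow> complex)) set) \<Rightarrow> cvec \<Rightarrow> complex" where
  "corr_map n \<alpha> \<beta> \<gamma> g f =
     coker_lift (2*n+1) (line_sheaf (2*n+1) (- \<gamma>)) (sym_sheaf n \<alpha> \<beta>) (mult_g n g)
       (line_sheaf (2*n+1) (\<gamma> + (2 * int n + 1) * (\<alpha> + \<beta>)))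
       (\<lambda>U s x. \<Sum>i\<le>2*n+1. \<Sum>j\<le>2*n+1. f (basis_wedge i j) * g i x * s j x)"

definition corr_bundle :: "nat \<Rightarrow> int \<Rightarrow> int \<Rightarrow> int \<Rightarrow> (nat \<Rightarrow> cvec \<Rightarrow> complex) \<Rightarrow> (bivec \<Rightarrow> complex) \<Rightarrow>
    (cvec set \<Rightarrow> (pset \<times> (nat \<Rightarrow> cvec \<Rightarrow> complex)) set) mod_sheaf" where
  "corr_bundle n \<alpha> \<beta> \<gamma> g f =
     ker_sheaf (quotient_bundle n \<alpha> \<beta> \<gamma> g)
       (line_sheaf (2*n+1) (\<gamma> + (2 * int n + 1) * (\<alpha> + \<beta>)))
       (corr_map n \<alpha> \<beta> \<gamma> g f)"

text \<open>The twist by \<open>O(e)\<close> of the direct sum of the sheaves \<open>(E\<^sub>k/W\<^sub>k) \<otimes> O(2(2n+1)\<alpha> + k(\<beta>-\<alpha>))\<close>.\<close>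

definition ext2_quot_sheaf ::
    "nat \<Rightarrow> int \<Rightarrow> int \<Rightarrow> bivec set \<Rightarrow> int \<Rightarrow> (nat \<Rightarrow> cvec \<Rightarrow> bivec set) mod_sheaf" where
  "ext2_quot_sheaf n \<alpha> \<beta> W e =
     dsum {1..4*n+1} (\<lambda>k. quot_sheaf (2*n+1) (2 * (2 * int n + 1) * \<alpha> + int k * (\<beta> - \<alpha>) + e)
       (ext2_weight n k) (W \<inter> ext2_weight n k))"

definition wedge_map :: "nat \<Rightarrow> int \<Rightarrow> int \<Rightarrow> int \<Rightarrow> (nat \<Rightarrow> cvec \<Rightarrow> complex) \<Rightarrow> bivec set \<Rightarrow>
    pset \<Rightarrow> (cvec set \<Rightarrow> (pset \<times> (nat \<Rightarrow> cvec \<Rightarrow> complex)) set) \<Rightarrow> nat \<Rightarrow> cvec \<Rightarrow> bivec set" where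
  "wedge_map n \<alpha> \<beta> \<gamma> g W =
     coker_lift (2*n+1) (line_sheaf (2*n+1) (- \<gamma>)) (sym_sheaf n \<alpha> \<beta>) (mult_g n g)
       (ext2_quot_sheaf n \<alpha> \<beta> W \<gamma>)
       (\<lambda>U s. \<lambda>k\<in>{1..4*n+1}. \<lambda>x. if x \<in> \<Union>U
          then coset (W \<inter> ext2_weight n k)
            (\<lambda>pq. \<Sum>(i, j)\<in>{(i, j). i \<le> 2*n+1 \<and> j \<le> 2*n+1 \<and> i + j = k}.
               g i x * s j x * basis_wedge i j pq)
          else {})"

text \<open>
  The twist of \<open>wedge_map\<close> by \<open>O(-\<gamma>)\<close>, composed with the isomorphisms
  \<open>((E\<^sub>k/W\<^sub>k) \<otimes> O(a + \<gamma>))(-\<gamma>) \<cong> (E\<^sub>k/W\<^sub>k) \<otimes> O(a)\<close>; the result does not depend on the chart \<open>i\<close>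
  containing the given point.
\<close>

definition wedge_map_tw :: "nat \<Rightarrow> int \<Rightarrow> int \<Rightarrow> int \<Rightarrow> (nat \<Rightarrow> cvec \<Rightarrow> complex) \<Rightarrow> bivec set \<Rightarrow>
    pset \<Rightarrow> (nat \<Rightarrow> cvec set \<Rightarrow> (pset \<times> (nat \<Rightarrow> cvec \<Rightarrow> complex)) set) \<Rightarrow>
    nat \<Rightarrow> cvec \<Rightarrow> bivec set" where
  "wedge_map_tw n \<alpha> \<beta> \<gamma> g W U s = (\<lambda>k\<in>{1..4*n+1}. \<lambda>x. if x \<in> \<Union>U
     then (let i = (LEAST i. x i \<noteq> 0) in
       (\<lambda>u pq. x i powi (- \<gamma>) * u pq) `
         wedge_map n \<alpha> \<beta> \<gamma> g W (U \<inter> chart (2*n+1) i) (s i) k x)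
     else {})"

text \<open>The twisted bundle \<open>F(\<gamma>)\<close>.\<close>

definition tango_bundle_tw :: "nat \<Rightarrow> int \<Rightarrow> int \<Rightarrow> int \<Rightarrow> (nat \<Rightarrow> cvec \<Rightarrow> complex) \<Rightarrow> bivec set \<Rightarrow>
    (cvec set \<Rightarrow> (pset \<times> (nat \<Rightarrow> cvec \<Rightarrow> bivec set)) set) mod_sheaf" where
  "tango_bundle_tw n \<alpha> \<beta> \<gamma> g W =
     coker_sheaf (2*n+1) (twist (2*n+1) (- \<gamma>) (quotient_bundle n \<alpha> \<beta> \<gamma> g))
       (ext2_quot_sheaf n \<alpha> \<beta> W 0) (wedge_map_tw n \<alpha> \<beta> \<gamma> g W)"

definition tango_proj :: "nat \<Rightarrow> int \<Rightarrow> int \<Rightarrow> int \<Rightarrow> (nat \<Rightarrow> cvec \<Rightarrow> complex) \<Rightarrow> bivec set \<Rightarrow>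
    pset \<Rightarrow> (nat \<Rightarrow> cvec \<Rightarrow> bivec set) \<Rightarrow> cvec set \<Rightarrow> (pset \<times> (nat \<Rightarrow> cvec \<Rightarrow> bivec set)) set" where
  "tango_proj n \<alpha> \<beta> \<gamma> g W =
     coker_proj (2*n+1) (twist (2*n+1) (- \<gamma>) (quotient_bundle n \<alpha> \<beta> \<gamma> g))
       (ext2_quot_sheaf n \<alpha> \<beta> W 0) (wedge_map_tw n \<alpha> \<beta> \<gamma> g W)"

definition Upsilon1 :: "nat \<Rightarrow> int \<Rightarrow> int \<Rightarrow> (nat \<Rightarrow> cvec \<Rightarrow> complex) mod_sheaf" where
  "Upsilon1 n \<alpha> \<beta> = dsum ({1..4*n+1} - {2*n+1})
     (\<lambda>k. line_sheaf (2*n+1) (2 * \<alpha> * (2 * int n + 1) + int k * (\<beta> - \<alpha>)))"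

text \<open>The map \<open>(h\<^sub>k) \<mapsto> \<Sum> h\<^sub>k d\<^sub>k\<close> mod \<open>W\<close>, given by the choice of the \<open>d\<^sub>k\<close>.\<close>

definition Upsilon1_incl :: "nat \<Rightarrow> bivec set \<Rightarrow> (nat \<Rightarrow> bivec) \<Rightarrow>
    pset \<Rightarrow> (nat \<Rightarrow> cvec \<Rightarrow> complex) \<Rightarrow> nat \<Rightarrow> cvec \<Rightarrow> bivec set" where
  "Upsilon1_incl n W d U h = (\<lambda>k\<in>{1..4*n+1}. \<lambda>x. if x \<in> \<Union>U
     then coset (W \<inter> ext2_weight n k) (if k = 2*n+1 then 0 else (\<lambda>pq. h k x * d k pq))
     else {})"

text \<open>
  Exactness of \<open>0 \<rightarrow> N(-\<gamma>) \<rightarrow> \<Upsilon>\<^sub>1 \<rightarrow> F(\<gamma>) \<rightarrow> 0\<close> with its natural maps: the second one is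
  \<open>Upsilon1_incl\<close> followed by the projection onto the cokernel, and the first one, followed by
  \<open>Upsilon1_incl\<close>, is the restriction of \<open>wedge_map_tw\<close> to \<open>N(-\<gamma>) \<subseteq> Q(-\<gamma>)\<close>.
\<close>

definition corr_tango_exact :: "nat \<Rightarrow> int \<Rightarrow> int \<Rightarrow> int \<Rightarrow> (nat \<Rightarrow> cvec \<Rightarrow> complex) \<Rightarrow>
    bivec set \<Rightarrow> (bivec \<Rightarrow> complex) \<Rightarrow> (nat \<Rightarrow> bivec) \<Rightarrow> bool" where
  "corr_tango_exact n \<alpha> \<beta> \<gamma> g W f d \<longleftrightarrow> (\<exists>\<phi>.
     short_exact (2*n+1)
       (twist (2*n+1) (- \<gamma>) (corr_bundle n \<alpha> \<beta> \<gamma> g f))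
       (Upsilon1 n \<alpha> \<beta>)
       (tango_bundle_tw n \<alpha> \<beta> \<gamma> g W)
       \<phi> (\<lambda>U h. tango_proj n \<alpha> \<beta> \<gamma> g W U (Upsilon1_incl n W d U h)) \<and>
     (\<forall>U s. openin (zariski (2*n+1)) U \<longrightarrow>
        s \<in> carrier (sect (twist (2*n+1) (- \<gamma>) (corr_bundle n \<alpha> \<beta> \<gamma> g f)) U) \<longrightarrow>
        Upsilon1_incl n W d U (\<phi> U s) = wedge_map_tw n \<alpha> \<beta> \<gamma> g W U s))"

end

theory Submission
  imports Defs
begin

text \<open>
  Every weight space contains a decomposable bivector, so the dimension of \<open>W\<close> forces each \<open>W\<^sub>k\<close> to be
  a hyperplane.  Choosing coordinates \<open>E\<^sub>k/W\<^sub>k \<cong> \<complex>\<close>, the form \<open>f\<close> in the middle weight \<open>2n+1\<close>, turns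
  the wedge map of the quotient bundle into a map \<open>w\<close> to a direct sum of line bundles whose middle
  component is the correlation map.  It is injective, as \<open>g(x) \<and> u \<in> W\<close> forces \<open>g(x) \<and> u = 0\<close>, and its
  middle component is locally surjective, as \<open>f\<close> is nondegenerate and the \<open>g\<^sub>i\<close> have no common zero.
  Thus \<open>\<Upsilon>\<^sub>1\<close> (the sections with zero middle component) and the image of \<open>w\<close> together span the target of
  \<open>w\<close> locally and meet in the image of the correlation bundle, while the cokernel of \<open>w\<close> is the Tango
  bundle; exactness follows.
\<close>

section \<open>Forms and regular sections\<close>

text \<open>A section of a cokernel is a function to germs, and a map out of a cokernel is a
  definite description; neither is fit for direct computation. So a single induced map,
  \<open>\<Lambda>\<close>, is analysed in terms of complex valued functions, and
  \<open>corr_map\<close> and \<open>wedge_map\<close> are recovered from it by composing with a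
  projection and with a trivialisation by cosets. The injectivity of \<open>\<Lambda>\<close> also
  supplies the module laws of the quotient bundle, which the gluing conditions of its twist call
  for. The vectors outside \<open>W\<close> behind the dimension count are the given
  \<open>d k\<close> and, in weight 2n+1, a vector on which \<open>f\<close> is 1; this
  normalisation makes the middle coordinate equal to \<open>f\<close>. Exactness is a local form of
  the second isomorphism theorem Y/(X \<inter> Y) = (X + Y)/X, with X the image of the twisted map
  and Y the sum of line bundles; injectivity identifies X \<inter> Y with the twisted correlation
  bundle. The weights and \<open>g\<close> stay parameters, so that the sequence on P(V) and the
  weighted one come from the same argument.\<close>

abbreviation zopen :: "nat \<Rightarrow> pset \<Rightarrow> bool" where
  "zopen m U \<equiv> openin (zariski m) U"

abbreviation secs :: "'s mod_sheaf \<Rightarrow> pset \<Rightarrow> 's set" where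
  "secs F U \<equiv> carrier (sect F U)"

lemma proj_point:
  assumes "L \<in> proj m" "x \<in> L"
  shows "x \<in> vecs m" "x \<noteq> 0" "L = {(\<lambda>i. c * x i) |c. c \<noteq> 0}"
proof -
  from assms(1) obtain y where y: "L = {(\<lambda>i. c * y i) |c. c \<noteq> 0}" "y \<in> vecs m" "y \<noteq> 0"
    by (auto simp: proj_def)
  from assms(2) y(1) obtain a where a: "x = (\<lambda>i. a * y i)" "a \<noteq> 0" by auto
  show "x \<in> vecs m" using a y by (auto simp: vecs_def)
  show "x \<noteq> 0" using a y by (auto simp: fun_eq_iff)
  show "L = {(\<lambda>i. c * x i) |c. c \<noteq> 0}"
  proof (rule Set.set_eqI)
    fix z
    have "(\<exists>c. z = (\<lambda>i. c * y i) \<and> c \<noteq> 0) \<longleftrightarrow> (\<exists>c. z = (\<lambda>i. c * x i) \<and> c \<noteq> 0)"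
    proof
      assume "\<exists>c. z = (\<lambda>i. c * y i) \<and> c \<noteq> 0"
      then obtain c where "z = (\<lambda>i. c * y i)" "c \<noteq> 0" by blast
      then have "z = (\<lambda>i. (c / a) * x i)" "c / a \<noteq> 0" using a by (auto simp: fun_eq_iff)
      then show "\<exists>c. z = (\<lambda>i. c * x i) \<and> c \<noteq> 0" by blast
    next
      assume "\<exists>c. z = (\<lambda>i. c * x i) \<and> c \<noteq> 0"
      then obtain c where "z = (\<lambda>i. c * x i)" "c \<noteq> 0" by blast
      then have "z = (\<lambda>i. (c * a) * y i)" "c * a \<noteq> 0" using a by (auto simp: fun_eq_iff)
      then show "\<exists>c. z = (\<lambda>i. c * y i) \<and> c \<noteq> 0" by blast
    qed
    then show "z \<in> L \<longleftrightarrow> z \<in> {(\<lambda>i. c * x i) |c. c \<noteq> 0}" using y(1) by auto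
  qed
qed

lemma proj_nonempty: "L \<in> proj m \<Longrightarrow> \<exists>x. x \<in> L"
  unfolding proj_def by (auto intro!: exI[of _ "1::complex"])

lemma proj_eqI: "L \<in> proj m \<Longrightarrow> M \<in> proj m \<Longrightarrow> x \<in> L \<Longrightarrow> x \<in> M \<Longrightarrow> L = M"
  using proj_point(3)[of L m x] proj_point(3)[of M m x] by simp

section \<open>The algebra of homogeneous forms\<close>

lemma form_zero: "(\<lambda>x. 0) \<in> forms m d"
  unfolding forms_def by (auto intro!: exI[of _ "{}"])

lemma form_add:
  assumes "p \<in> forms m d" "q \<in> forms m d"
  shows "(\<lambda>x. p x + q x) \<in> forms m d"
proof -
  from assms(1) obtain M c where p: "p = (\<lambda>x. \<Sum>\<mu>\<in>M. c \<mu> * (\<Prod>i\<le>m. x i ^ \<mu> i))"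
    "finite M" "\<forall>\<mu>\<in>M. int (\<Sum>i\<le>m. \<mu> i) = d" unfolding forms_def by auto
  from assms(2) obtain M' c' where q: "q = (\<lambda>x. \<Sum>\<mu>\<in>M'. c' \<mu> * (\<Prod>i\<le>m. x i ^ \<mu> i))"
    "finite M'" "\<forall>\<mu>\<in>M'. int (\<Sum>i\<le>m. \<mu> i) = d" unfolding forms_def by auto
  \<comment> \<open>The two sets of exponents may overlap, so both families of coefficients are
    extended by zero to the union before they are added.\<close>
  let ?c = "\<lambda>\<mu>. (if \<mu> \<in> M then c \<mu> else 0) + (if \<mu> \<in> M' then c' \<mu> else 0)"
  have "p x + q x = (\<Sum>\<mu>\<in>M\<union>M'. ?c \<mu> * (\<Prod>i\<le>m. x i ^ \<mu> i))" for x
  proof -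
    have "(\<Sum>\<mu>\<in>M\<union>M'. ?c \<mu> * (\<Prod>i\<le>m. x i ^ \<mu> i)) =
      (\<Sum>\<mu>\<in>M\<union>M'. if \<mu> \<in> M then c \<mu> * (\<Prod>i\<le>m. x i ^ \<mu> i) else 0) +
      (\<Sum>\<mu>\<in>M\<union>M'. if \<mu> \<in> M' then c' \<mu> * (\<Prod>i\<le>m. x i ^ \<mu> i) else 0)"
      unfolding sum.distrib[symmetric] by (rule sum.cong) (auto simp: algebra_simps)
    also have "\<dots> = p x + q x" using p(2) q(2)
      by (simp add: p(1) q(1) sum.If_cases Int_absorb1 Int_absorb2
          Un_Int_eq Int_commute)
    finally show ?thesis by simp
  qed
  then show ?thesis unfolding forms_def using p(2,3) q(2,3)
    by (intro CollectI exI[of _ "M \<union> M'"] exI[of _ ?c]) auto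
qed

lemma form_sum: "finite I \<Longrightarrow> (\<And>i. i \<in> I \<Longrightarrow> p i \<in> forms m d) \<Longrightarrow> (\<lambda>x. \<Sum>i\<in>I. p i x) \<in> forms m d"
  by (induction I rule: finite_induct) (auto simp: form_zero intro: form_add)

lemma form_monomial: "int (\<Sum>i\<le>m. \<mu> i) = d \<Longrightarrow> (\<lambda>x. c * (\<Prod>i\<le>m. x i ^ \<mu> i)) \<in> forms m d"
  unfolding forms_def by (intro CollectI exI[of _ "{\<mu>}"] exI[of _ "\<lambda>_. c"]) auto

lemma form_const: "(\<lambda>x. c) \<in> forms m 0"
  using form_monomial[of "\<lambda>_. 0" m 0 c] by simp

lemma form_mult:
  assumes "p \<in> forms m d" "q \<in> forms m e"
  shows "(\<lambda>x. p x * q x) \<in> forms m (d + e)"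
proof -
  from assms(1) obtain M c where p: "p = (\<lambda>x. \<Sum>\<mu>\<in>M. c \<mu> * (\<Prod>i\<le>m. x i ^ \<mu> i))"
    "finite M" "\<forall>\<mu>\<in>M. int (\<Sum>i\<le>m. \<mu> i) = d" unfolding forms_def by auto
  from assms(2) obtain M' c' where q: "q = (\<lambda>x. \<Sum>\<mu>\<in>M'. c' \<mu> * (\<Prod>i\<le>m. x i ^ \<mu> i))"
    "finite M'" "\<forall>\<mu>\<in>M'. int (\<Sum>i\<le>m. \<mu> i) = e" unfolding forms_def by auto
  have "(\<lambda>x. \<Sum>\<mu>\<in>M. \<Sum>\<nu>\<in>M'. (c \<mu> * c' \<nu>) * (\<Prod>i\<le>m. x i ^ (\<mu> i + \<nu> i))) \<in> forms m (d + e)"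
    by (intro form_sum p q form_monomial) (use p(3) q(3) in \<open>auto simp: sum.distrib\<close>)
  also have "(\<lambda>x. \<Sum>\<mu>\<in>M. \<Sum>\<nu>\<in>M'. (c \<mu> * c' \<nu>) * (\<Prod>i\<le>m. x i ^ (\<mu> i + \<nu> i))) = (\<lambda>x. p x * q x)"
    by (simp add: p(1) q(1) sum_product power_add prod.distrib mult.assoc mult.left_commute)
  finally show ?thesis .
qed

lemma form_coord:
  assumes "i \<le> m"
  shows "(\<lambda>x. x i) \<in> forms m 1"
proof -
  have "(\<Prod>j\<le>m. x j ^ (if j = i then 1 else 0)) = x i" for x :: cvec
  proof -
    have "(\<Prod>j\<le>m. x j ^ (if j = i then 1 else 0)) = (\<Prod>j\<le>m. if j = i then x j else 1)"
      by (rule prod.cong) auto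
    also have "\<dots> = x i" using assms by simp
    finally show ?thesis .
  qed
  then show ?thesis
    using form_monomial[of "\<lambda>j. if j = i then 1 else 0" m 1 1] assms by simp
qed

lemma form_power:
  assumes "p \<in> forms m d"
  shows "(\<lambda>x. p x ^ k) \<in> forms m (int k * d)"
proof (induction k)
  case 0 show ?case using form_const[of 1 m] by simp
next
  case (Suc k)
  from form_mult[OF assms Suc] show ?case by (simp add: algebra_simps)
qed

text \<open>Homogeneity: scaling the argument by \<open>c\<close> multiplies the value by
  \<open>c ^ nat d\<close>. For negative \<open>d\<close> the set of exponents is empty, so the
  truncation by \<open>nat\<close> does no harm. It allows nonvanishing at a point to be tested on
  one of its vectors.\<close>

lemma form_nonzero_scale:
  assumes "h \<in> forms m d" "h x \<noteq> 0" "c \<noteq> 0"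
  shows "h (\<lambda>i. c * x i) \<noteq> 0"
proof -
  from assms(1) obtain M a where h: "h = (\<lambda>x. \<Sum>\<mu>\<in>M. a \<mu> * (\<Prod>i\<le>m. x i ^ \<mu> i))"
    "finite M" "\<forall>\<mu>\<in>M. int (\<Sum>i\<le>m. \<mu> i) = d" unfolding forms_def by auto
  have "h (\<lambda>i. c * x i) = (\<Sum>\<mu>\<in>M. a \<mu> * (c ^ (\<Sum>i\<le>m. \<mu> i) * (\<Prod>i\<le>m. x i ^ \<mu> i)))"
    unfolding h by (simp add: power_mult_distrib prod.distrib power_sum)
  also have "\<dots> = (\<Sum>\<mu>\<in>M. a \<mu> * (c ^ nat d * (\<Prod>i\<le>m. x i ^ \<mu> i)))"
  proof (rule sum.cong[OF refl])
    fix \<mu> assume "\<mu> \<in> M"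
    then have "int (\<Sum>i\<le>m. \<mu> i) = d" using h(3) by blast
    then have "nat d = (\<Sum>i\<le>m. \<mu> i)" by (metis nat_int)
    then show "a \<mu> * (c ^ (\<Sum>i\<le>m. \<mu> i) * (\<Prod>i\<le>m. x i ^ \<mu> i)) =
      a \<mu> * (c ^ nat d * (\<Prod>i\<le>m. x i ^ \<mu> i))" by simp
  qed
  also have "\<dots> = c ^ nat d * h x" by (simp add: h sum_distrib_left mult_ac)
  finally show ?thesis using assms by simp
qed

section \<open>Zariski open sets, charts and cones\<close>

definition basic_open :: "nat \<Rightarrow> (cvec \<Rightarrow> complex) \<Rightarrow> pset" where
  "basic_open m h = {L \<in> proj m. \<forall>x\<in>L. h x \<noteq> 0}"

lemma openin_basic_open: "h \<in> forms m d \<Longrightarrow> zopen m (basic_open m h)"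
  unfolding zariski_def basic_open_def by (rule topology_generated_by_Basis) blast

lemma basic_open_iff:
  assumes "h \<in> forms m d" "L \<in> proj m" "x \<in> L"
  shows "L \<in> basic_open m h \<longleftrightarrow> h x \<noteq> 0"
  using assms proj_point(3)[OF assms(2,3)] form_nonzero_scale[OF assms(1)]
  unfolding basic_open_def by auto

lemma topspace_zariski: "topspace (zariski m) = proj m"
proof -
  have "proj m \<in> {{L \<in> proj m. \<forall>x\<in>L. h x \<noteq> 0} |h d. h \<in> forms m d}"
    using form_const[of 1 m] by (intro CollectI exI[of _ "\<lambda>_. 1"] exI[of _ 0]) auto
  then show ?thesis unfolding zariski_def topology_generated_by_topspace by blast
qed

lemma open_subset_proj: "zopen m U \<Longrightarrow> U \<subseteq> proj m"
  using openin_subset[of "zariski m" U] by (simp add: topspace_zariski)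

lemma chart_basic_open: "chart m i = basic_open m (\<lambda>x. x i)"
  by (simp add: chart_def basic_open_def)

lemma openin_chart: "i \<le> m \<Longrightarrow> zopen m (chart m i)"
  unfolding chart_basic_open by (rule openin_basic_open[OF form_coord])

text \<open>Unions do not commute with intersections in general; here they do, because distinct
  points are disjoint punctured lines and a vector lies on at most one of them.\<close>

lemma cone_Int:
  assumes "U \<subseteq> proj m" "T \<subseteq> proj m"
  shows "x \<in> \<Union>(U \<inter> T) \<longleftrightarrow> x \<in> \<Union>U \<and> x \<in> \<Union>T"
proof
  show "x \<in> \<Union>(U \<inter> T) \<Longrightarrow> x \<in> \<Union>U \<and> x \<in> \<Union>T" by blast
  assume "x \<in> \<Union>U \<and> x \<in> \<Union>T"
  then obtain L M where LM: "L \<in> U" "x \<in> L" "M \<in> T" "x \<in> M" by blast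
  then have "L = M" using proj_eqI[of L m M x] assms by blast
  then show "x \<in> \<Union>(U \<inter> T)" using LM by blast
qed

lemma cone_chart:
  assumes "U \<subseteq> proj m"
  shows "x \<in> \<Union>(U \<inter> chart m i) \<longleftrightarrow> x \<in> \<Union>U \<and> x i \<noteq> 0"
proof -
  have "L \<in> chart m i" if "x \<in> L" "L \<in> U" "x i \<noteq> 0" for L
  proof -
    have L: "L \<in> proj m" using assms that(2) by blast
    have "y i \<noteq> 0" if "y \<in> L" for y
      using that \<open>x i \<noteq> 0\<close> proj_point(3)[OF L \<open>x \<in> L\<close>] by auto
    then show ?thesis using L by (simp add: chart_def)
  qed
  then show ?thesis unfolding chart_def by auto
qed

lemma cone_vecs:
  assumes "U \<subseteq> proj m" "x \<in> \<Union>U"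
  shows "x \<in> vecs m" "x \<noteq> 0"
proof -
  from assms obtain L where "x \<in> L" "L \<in> proj m" by blast
  then show "x \<in> vecs m" "x \<noteq> 0" using proj_point(1,2) by blast+
qed

lemma cone_nonzero_coord:
  assumes "U \<subseteq> proj m" "x \<in> \<Union>U"
  shows "\<exists>i\<le>m. x i \<noteq> 0"
proof -
  have "x \<in> vecs m" "x \<noteq> 0" using cone_vecs[OF assms] by auto
  then obtain i where i: "x i \<noteq> 0" by (auto simp: fun_eq_iff)
  with \<open>x \<in> vecs m\<close> have "\<not> m < i" by (auto simp: vecs_def)
  with i show ?thesis by (auto simp: not_less)
qed

lemma proj_in_chart: "L \<in> proj m \<Longrightarrow> \<exists>i\<le>m. L \<in> chart m i"
proof -
  assume L: "L \<in> proj m"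
  obtain x where x: "x \<in> L" using proj_nonempty[OF L] by blast
  obtain i where "i \<le> m" "x i \<noteq> 0" using cone_nonzero_coord[of "{L}" m x] L x by auto
  then show ?thesis using cone_chart[of "{L}" m x i] L x by auto
qed

text \<open>The inner condition of \<open>osect_def\<close> on a fixed set, so that the arithmetic
  of fractions is separated from the choice of neighbourhoods.\<close>

definition fraction :: "nat \<Rightarrow> int \<Rightarrow> pset \<Rightarrow> (cvec \<Rightarrow> complex) \<Rightarrow> bool" where
  "fraction m d T s \<longleftrightarrow> (\<exists>a b p q. p \<in> forms m a \<and> q \<in> forms m b \<and> a - b = d \<and>
        (\<forall>x\<in>\<Union>T. q x \<noteq> 0 \<and> s x = p x / q x))"

lemma fractionI:
  "p \<in> forms m a \<Longrightarrow> q \<in> forms m b \<Longrightarrow> a - b = d \<Longrightarrow>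
    (\<And>x. x \<in> \<Union>T \<Longrightarrow> q x \<noteq> 0 \<and> s x = p x / q x) \<Longrightarrow> fraction m d T s"
  unfolding fraction_def
  by (intro exI[of _ a] exI[of _ b] exI[of _ p] exI[of _ q]) simp

lemma fractionE:
  assumes "fraction m d T s"
  obtains p a q b where "p \<in> forms m a" "q \<in> forms m b" "a - b = d"
    "\<forall>x\<in>\<Union>T. q x \<noteq> 0" "\<forall>x\<in>\<Union>T. s x = p x / q x"
proof -
  from assms obtain a b p q where "p \<in> forms m a" "q \<in> forms m b" "a - b = d"
    "\<forall>x\<in>\<Union>T. q x \<noteq> 0 \<and> s x = p x / q x" unfolding fraction_def by (elim exE conjE)
  then show ?thesis using that by blast
qed

lemma fraction_mono:
  assumes "fraction m d T s" "T' \<subseteq> T" "\<And>x. x \<in> \<Union>T' \<Longrightarrow> s' x = s x"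
  shows "fraction m d T' s'"
proof -
  from assms(1) obtain p a q b where *: "p \<in> forms m a" "q \<in> forms m b" "a - b = d"
    "\<forall>x\<in>\<Union>T. q x \<noteq> 0" "\<forall>x\<in>\<Union>T. s x = p x / q x" by (rule fractionE)
  show ?thesis
  proof (rule fractionI[OF *(1-3)])
    fix x assume x: "x \<in> \<Union>T'"
    then have "x \<in> \<Union>T" using assms(2) by blast
    then have "q x \<noteq> 0" "s x = p x / q x" using *(4,5) by blast+
    then show "q x \<noteq> 0 \<and> s' x = p x / q x" using assms(3)[OF x] by simp
  qed
qed

lemma fraction_add:
  assumes "fraction m d T s" "fraction m d T t"
  shows "fraction m d T (\<lambda>x. s x + t x)"
proof -
  from assms(1) obtain p a q b where s: "p \<in> forms m a" "q \<in> forms m b" "a - b = d"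
    "\<forall>x\<in>\<Union>T. q x \<noteq> 0" "\<forall>x\<in>\<Union>T. s x = p x / q x" by (rule fractionE)
  from assms(2) obtain p' a' q' b' where t: "p' \<in> forms m a'" "q' \<in> forms m b'" "a' - b' = d"
    "\<forall>x\<in>\<Union>T. q' x \<noteq> 0" "\<forall>x\<in>\<Union>T. t x = p' x / q' x" by (rule fractionE)
  have "(\<lambda>x. p x * q' x + p' x * q x) \<in> forms m (a + b')"
    using form_mult[OF s(1) t(2)] form_mult[OF t(1) s(2)] s(3) t(3)
    by (intro form_add) (auto simp: algebra_simps)
  then show ?thesis
  proof (rule fractionI[OF _ form_mult[OF s(2) t(2)]])
    show "a + b' - (b + b') = d" using s(3) by simp
    fix x assume "x \<in> \<Union>T"
    then have "q x \<noteq> 0" "s x = p x / q x" "q' x \<noteq> 0" "t x = p' x / q' x" using s(4,5) t(4,5) by blast+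
    then show "q x * q' x \<noteq> 0 \<and> s x + t x = (p x * q' x + p' x * q x) / (q x * q' x)"
      by (simp add: add_frac_eq)
  qed
qed

lemma fraction_mult:
  assumes "fraction m d T s" "fraction m e T t"
  shows "fraction m (d + e) T (\<lambda>x. s x * t x)"
proof -
  from assms(1) obtain p a q b where s: "p \<in> forms m a" "q \<in> forms m b" "a - b = d"
    "\<forall>x\<in>\<Union>T. q x \<noteq> 0" "\<forall>x\<in>\<Union>T. s x = p x / q x" by (rule fractionE)
  from assms(2) obtain p' a' q' b' where t: "p' \<in> forms m a'" "q' \<in> forms m b'" "a' - b' = e"
    "\<forall>x\<in>\<Union>T. q' x \<noteq> 0" "\<forall>x\<in>\<Union>T. t x = p' x / q' x" by (rule fractionE)
  show ?thesis
    by (rule fractionI[OF form_mult[OF s(1) t(1)] form_mult[OF s(2) t(2)]])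
      (use s(3,4,5) t(3,4,5) in auto)
qed

lemma osect_iff:
  "s \<in> osect m d U \<longleftrightarrow> (\<forall>x. x \<notin> \<Union>U \<longrightarrow> s x = 0) \<and>
     (\<forall>L\<in>U. \<exists>T. zopen m T \<and> L \<in> T \<and> T \<subseteq> U \<and> fraction m d T s)"
  by (simp add: osect_def fraction_def)

lemma osect_outside: "s \<in> osect m d U \<Longrightarrow> x \<notin> \<Union>U \<Longrightarrow> s x = 0"
  by (simp add: osect_iff)

lemma osectI:
  assumes "\<And>x. x \<notin> \<Union>U \<Longrightarrow> s x = 0"
    and "\<And>L. L \<in> U \<Longrightarrow> \<exists>T. zopen m T \<and> L \<in> T \<and> T \<subseteq> U \<and> fraction m d T s"
  shows "s \<in> osect m d U"
  using assms by (simp add: osect_iff)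

lemma osectE:
  assumes "s \<in> osect m d U" "L \<in> U"
  obtains T where "zopen m T" "L \<in> T" "T \<subseteq> U" "fraction m d T s"
  using assms unfolding osect_iff by blast

text \<open>Regularity is a local property. It serves functions that are pieced together from local
  data: the glued section in \<open>sheaf_mod_line\<close> and the chartwise definition behind
  \<open>untwist_sect\<close>.\<close>

lemma osect_local:
  assumes "\<And>x. x \<notin> \<Union>U \<Longrightarrow> s x = 0"
    and "\<And>L. L \<in> U \<Longrightarrow> \<exists>T t. zopen m T \<and> L \<in> T \<and> T \<subseteq> U \<and>
        t \<in> osect m d T \<and> (\<forall>x\<in>\<Union>T. s x = t x)"
  shows "s \<in> osect m d U"
proof (rule osectI[OF assms(1)])
  fix L assume "L \<in> U"
  from assms(2)[OF this] obtain T t where T: "zopen m T" "L \<in> T" "T \<subseteq> U"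
    "t \<in> osect m d T" "\<forall>x\<in>\<Union>T. s x = t x" by (elim exE conjE)
  from T(4,2) obtain T' where T': "zopen m T'" "L \<in> T'" "T' \<subseteq> T" "fraction m d T' t"
    by (rule osectE)
  have "fraction m d T' s"
    by (rule fraction_mono[OF T'(4) order_refl]) (use T(5) T'(3) in auto)
  then show "\<exists>T. zopen m T \<and> L \<in> T \<and> T \<subseteq> U \<and> fraction m d T s"
    using T' T(3) by (intro exI[of _ T']) auto
qed

lemma osect_zero: "zopen m U \<Longrightarrow> (\<lambda>x. 0) \<in> osect m d U"
  by (rule osectI) (auto intro!: exI[of _ U] fractionI[OF form_zero form_const[of 1], of d])

lemma osect_add:
  assumes "s \<in> osect m d U" "t \<in> osect m d U"
  shows "(\<lambda>x. s x + t x) \<in> osect m d U"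
proof (rule osectI)
  show "x \<notin> \<Union>U \<Longrightarrow> s x + t x = 0" for x by (simp add: osect_outside[OF assms(1)] osect_outside[OF assms(2)])
  fix L assume L: "L \<in> U"
  from assms(1) L obtain T where T: "zopen m T" "L \<in> T" "T \<subseteq> U" "fraction m d T s"
    by (rule osectE)
  from assms(2) L obtain T' where T': "zopen m T'" "L \<in> T'" "T' \<subseteq> U" "fraction m d T' t"
    by (rule osectE)
  have "fraction m d (T \<inter> T') (\<lambda>x. s x + t x)"
    by (intro fraction_add fraction_mono[OF T(4)] fraction_mono[OF T'(4)]) auto
  then show "\<exists>T. zopen m T \<and> L \<in> T \<and> T \<subseteq> U \<and> fraction m d T (\<lambda>x. s x + t x)"
    using T T' by (intro exI[of _ "T \<inter> T'"]) auto
qed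

lemma osect_mult:
  assumes "s \<in> osect m d U" "t \<in> osect m e U"
  shows "(\<lambda>x. s x * t x) \<in> osect m (d + e) U"
proof (rule osectI)
  show "x \<notin> \<Union>U \<Longrightarrow> s x * t x = 0" for x by (simp add: osect_outside[OF assms(1)])
  fix L assume L: "L \<in> U"
  from assms(1) L obtain T where T: "zopen m T" "L \<in> T" "T \<subseteq> U" "fraction m d T s"
    by (rule osectE)
  from assms(2) L obtain T' where T': "zopen m T'" "L \<in> T'" "T' \<subseteq> U" "fraction m e T' t"
    by (rule osectE)
  have "fraction m (d + e) (T \<inter> T') (\<lambda>x. s x * t x)"
    by (intro fraction_mult fraction_mono[OF T(4)] fraction_mono[OF T'(4)]) auto
  then show "\<exists>T. zopen m T \<and> L \<in> T \<and> T \<subseteq> U \<and> fraction m (d + e) T (\<lambda>x. s x * t x)"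
    using T T' by (intro exI[of _ "T \<inter> T'"]) auto
qed

lemma osect_sum:
  "zopen m U \<Longrightarrow> finite I \<Longrightarrow> (\<And>i. i \<in> I \<Longrightarrow> s i \<in> osect m d U) \<Longrightarrow>
    (\<lambda>x. \<Sum>i\<in>I. s i x) \<in> osect m d U"
  by (rotate_tac 1, induction I rule: finite_induct) (auto simp: osect_zero intro: osect_add)

lemma osect_ores:
  assumes "zopen m T" "T \<subseteq> U" "s \<in> osect m d U"
  shows "ores T s \<in> osect m d T"
proof (rule osectI)
  show "x \<notin> \<Union>T \<Longrightarrow> ores T s x = 0" for x by (simp add: ores_def)
  fix L assume L: "L \<in> T"
  then have "L \<in> U" using assms(2) by auto
  with assms(3) obtain S where S: "zopen m S" "L \<in> S" "S \<subseteq> U" "fraction m d S s"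
    by (rule osectE)
  have "fraction m d (S \<inter> T) (ores T s)"
    by (rule fraction_mono[OF S(4)]) (auto simp: ores_def)
  then show "\<exists>S. zopen m S \<and> L \<in> S \<and> S \<subseteq> T \<and> fraction m d S (ores T s)"
    using S L assms(1) by (intro exI[of _ "S \<inter> T"]) auto
qed

lemma osect_quotient:
  assumes "zopen m U" "p \<in> forms m a" "q \<in> forms m b" "\<And>x. x \<in> \<Union>U \<Longrightarrow> q x \<noteq> 0"
    "a - b = d"
  shows "ores U (\<lambda>x. p x / q x) \<in> osect m d U"
proof -
  have "fraction m d U (ores U (\<lambda>x. p x / q x))"
    by (rule fractionI[OF assms(2,3,5)]) (use assms(4) in \<open>auto simp: ores_def\<close>)
  then show ?thesis using assms(1) by (intro osectI) (auto simp: ores_def)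
qed

lemma osect_form:
  "zopen m U \<Longrightarrow> p \<in> forms m d \<Longrightarrow> ores U p \<in> osect m d U"
  using osect_quotient[of m U p d "\<lambda>_. 1" 0 d] form_const[of 1 m] by simp

lemma osect_powi:
  assumes "zopen m U" "i \<le> m" "\<And>x. x \<in> \<Union>U \<Longrightarrow> x i \<noteq> 0"
  shows "ores U (\<lambda>x. x i powi e) \<in> osect m e U"
proof (cases "e \<ge> 0")
  case True
  then show ?thesis
    using osect_form[OF assms(1) form_power[OF form_coord[OF assms(2)], of "nat e"]]
    by (simp add: power_int_def)
next
  case False
  have "ores U (\<lambda>x. 1 / x i ^ nat (- e)) \<in> osect m e U"
    by (rule osect_quotient[OF assms(1) form_const form_power[OF form_coord[OF assms(2)]]])
      (use assms False in auto)
  then show ?thesis using False by (simp add: power_int_def field_simps)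
qed

lemma osect_form_mult:
  assumes "zopen m U" "p \<in> forms m d" "s \<in> osect m e U" "d' = d + e"
  shows "(\<lambda>x. p x * s x) \<in> osect m d' U"
proof -
  have "(\<lambda>x. ores U p x * s x) \<in> osect m d' U"
    unfolding assms(4) by (intro osect_mult osect_form assms)
  moreover have "(\<lambda>x. ores U p x * s x) = (\<lambda>x. p x * s x)"
    using osect_outside[OF assms(3)] by (auto simp: ores_def fun_eq_iff)
  ultimately show ?thesis by simp
qed

lemma osect_const_mult:
  "zopen m U \<Longrightarrow> s \<in> osect m e U \<Longrightarrow> (\<lambda>x. c * s x) \<in> osect m e U"
  by (rule osect_form_mult[OF _ form_const]) auto

lemma ores_ident: "s \<in> osect m d U \<Longrightarrow> ores U s = s"
  using osect_outside by (fastforce simp: ores_def)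

section \<open>Presheaves of modules\<close>

text \<open>Closure is kept apart from the module laws. For a cokernel it can be read off from local
  representatives before the laws are available, and a twist is later shown to be closed only;
  accordingly the locale \<open>coker\<close> asks no more than this of its source.\<close>

locale mod_closed =
  fixes m :: nat and F :: "'s mod_sheaf"
  assumes zero_closed: "zopen m U \<Longrightarrow> \<zero>\<^bsub>sect F U\<^esub> \<in> secs F U"
    and add_closed: "zopen m U \<Longrightarrow> s \<in> secs F U \<Longrightarrow> t \<in> secs F U \<Longrightarrow>
      s \<oplus>\<^bsub>sect F U\<^esub> t \<in> secs F U"
    and smult_closed: "zopen m U \<Longrightarrow> r \<in> osect m 0 U \<Longrightarrow> s \<in> secs F U \<Longrightarrow>
      r \<odot>\<^bsub>sect F U\<^esub> s \<in> secs F U"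
    and res_closed: "zopen m U \<Longrightarrow> zopen m T \<Longrightarrow> T \<subseteq> U \<Longrightarrow>
      s \<in> secs F U \<Longrightarrow> res F U T s \<in> secs F T"

locale mod_presheaf = mod_closed +
  assumes add_assoc: "zopen m U \<Longrightarrow>
      s \<in> secs F U \<Longrightarrow> t \<in> secs F U \<Longrightarrow> u \<in> secs F U \<Longrightarrow>
      (s \<oplus>\<^bsub>sect F U\<^esub> t) \<oplus>\<^bsub>sect F U\<^esub> u = s \<oplus>\<^bsub>sect F U\<^esub> (t \<oplus>\<^bsub>sect F U\<^esub> u)"
    and add_commute: "zopen m U \<Longrightarrow>
      s \<in> secs F U \<Longrightarrow> t \<in> secs F U \<Longrightarrow> s \<oplus>\<^bsub>sect F U\<^esub> t = t \<oplus>\<^bsub>sect F U\<^esub> s"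
    and zero_add: "zopen m U \<Longrightarrow> s \<in> secs F U \<Longrightarrow>
      \<zero>\<^bsub>sect F U\<^esub> \<oplus>\<^bsub>sect F U\<^esub> s = s"
    and smult_add_right: "zopen m U \<Longrightarrow> r \<in> osect m 0 U \<Longrightarrow>
      s \<in> secs F U \<Longrightarrow> t \<in> secs F U \<Longrightarrow>
      r \<odot>\<^bsub>sect F U\<^esub> (s \<oplus>\<^bsub>sect F U\<^esub> t) = r \<odot>\<^bsub>sect F U\<^esub> s \<oplus>\<^bsub>sect F U\<^esub> r \<odot>\<^bsub>sect F U\<^esub> t"
    and smult_add_left: "zopen m U \<Longrightarrow> r \<in> osect m 0 U \<Longrightarrow> r' \<in> osect m 0 U \<Longrightarrow>
      s \<in> secs F U \<Longrightarrow>
      (\<lambda>x. r x + r' x) \<odot>\<^bsub>sect F U\<^esub> s = r \<odot>\<^bsub>sect F U\<^esub> s \<oplus>\<^bsub>sect F U\<^esub> r' \<odot>\<^bsub>sect F U\<^esub> s"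
    and smult_assoc: "zopen m U \<Longrightarrow> r \<in> osect m 0 U \<Longrightarrow> r' \<in> osect m 0 U \<Longrightarrow>
      s \<in> secs F U \<Longrightarrow>
      (\<lambda>x. r x * r' x) \<odot>\<^bsub>sect F U\<^esub> s = r \<odot>\<^bsub>sect F U\<^esub> (r' \<odot>\<^bsub>sect F U\<^esub> s)"
    and smult_one: "zopen m U \<Longrightarrow> s \<in> secs F U \<Longrightarrow>
      ores U (\<lambda>x. 1) \<odot>\<^bsub>sect F U\<^esub> s = s"
    and smult_zero: "zopen m U \<Longrightarrow> s \<in> secs F U \<Longrightarrow>
      (\<lambda>x. 0) \<odot>\<^bsub>sect F U\<^esub> s = \<zero>\<^bsub>sect F U\<^esub>"
    and res_zero: "zopen m U \<Longrightarrow> zopen m T \<Longrightarrow> T \<subseteq> U \<Longrightarrow>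
      res F U T \<zero>\<^bsub>sect F U\<^esub> = \<zero>\<^bsub>sect F T\<^esub>"
    and res_add: "zopen m U \<Longrightarrow> zopen m T \<Longrightarrow> T \<subseteq> U \<Longrightarrow>
      s \<in> secs F U \<Longrightarrow> t \<in> secs F U \<Longrightarrow>
      res F U T (s \<oplus>\<^bsub>sect F U\<^esub> t) = res F U T s \<oplus>\<^bsub>sect F T\<^esub> res F U T t"
    and res_smult: "zopen m U \<Longrightarrow> zopen m T \<Longrightarrow> T \<subseteq> U \<Longrightarrow>
      r \<in> osect m 0 U \<Longrightarrow> s \<in> secs F U \<Longrightarrow>
      res F U T (r \<odot>\<^bsub>sect F U\<^esub> s) = ores T r \<odot>\<^bsub>sect F T\<^esub> res F U T s"
    and res_self: "zopen m U \<Longrightarrow> s \<in> secs F U \<Longrightarrow> res F U U s = s"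
    and res_res: "zopen m U \<Longrightarrow> zopen m T \<Longrightarrow> zopen m T' \<Longrightarrow>
      T \<subseteq> U \<Longrightarrow> T' \<subseteq> T \<Longrightarrow> s \<in> secs F U \<Longrightarrow> res F T T' (res F U T s) = res F U T' s"

text \<open>The gluing data are an arbitrary set of pairs instead of an indexed cover, so that all
  local representatives of a section can be glued at once, as in \<open>lift_ex1\<close>.\<close>

locale sheaf_mod = mod_presheaf +
  assumes separated: "zopen m U \<Longrightarrow> s \<in> secs F U \<Longrightarrow> t \<in> secs F U \<Longrightarrow>
      (\<And>L. L \<in> U \<Longrightarrow> \<exists>T. zopen m T \<and> L \<in> T \<and> T \<subseteq> U \<and> res F U T s = res F U T t) \<Longrightarrow> s = t"
    and glue: "zopen m U \<Longrightarrow>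
      (\<And>T c. (T, c) \<in> G \<Longrightarrow> zopen m T \<and> T \<subseteq> U \<and> c \<in> secs F T) \<Longrightarrow>
      (\<And>L. L \<in> U \<Longrightarrow> \<exists>T c. (T, c) \<in> G \<and> L \<in> T) \<Longrightarrow>
      (\<And>T c T' c'. (T, c) \<in> G \<Longrightarrow> (T', c') \<in> G \<Longrightarrow>
        res F T (T \<inter> T') c = res F T' (T \<inter> T') c') \<Longrightarrow>
      \<exists>s\<in>secs F U. \<forall>(T, c)\<in>G. res F U T s = c"

lemma osect_const: "zopen m U \<Longrightarrow> ores U (\<lambda>x. c) \<in> osect m 0 U"
  by (rule osect_form[OF _ form_const])

context mod_presheaf
begin

lemma add_zero: "zopen m U \<Longrightarrow> s \<in> secs F U \<Longrightarrow>
    s \<oplus>\<^bsub>sect F U\<^esub> \<zero>\<^bsub>sect F U\<^esub> = s"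
  using add_commute zero_add zero_closed by simp

text \<open>Additive inverses are not among the axioms of \<open>mod_presheaf\<close>; the constant
  section -1 produces them from the scalar laws.\<close>

definition neg :: "pset \<Rightarrow> 'a \<Rightarrow> 'a" where
  "neg U s = ores U (\<lambda>x. -1) \<odot>\<^bsub>sect F U\<^esub> s"

lemma neg_closed: "zopen m U \<Longrightarrow> s \<in> secs F U \<Longrightarrow> neg U s \<in> secs F U"
  unfolding neg_def by (intro smult_closed osect_const)

lemma neg_add:
  assumes "zopen m U" "s \<in> secs F U"
  shows "neg U s \<oplus>\<^bsub>sect F U\<^esub> s = \<zero>\<^bsub>sect F U\<^esub>"
proof -
  have "(\<lambda>x. ores U (\<lambda>x. -1) x + ores U (\<lambda>x. 1) x) = (\<lambda>x. 0)" by (auto simp: ores_def)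
  then have "\<zero>\<^bsub>sect F U\<^esub> = (\<lambda>x. ores U (\<lambda>x. -1) x + ores U (\<lambda>x. 1) x) \<odot>\<^bsub>sect F U\<^esub> s"
    using smult_zero[OF assms] by simp
  also have "\<dots> = neg U s \<oplus>\<^bsub>sect F U\<^esub> s" unfolding neg_def
    using assms by (simp add: smult_add_left osect_const smult_one)
  finally show ?thesis by simp
qed

lemma smult_zero_right:
  assumes "zopen m U" "r \<in> osect m 0 U"
  shows "r \<odot>\<^bsub>sect F U\<^esub> \<zero>\<^bsub>sect F U\<^esub> = \<zero>\<^bsub>sect F U\<^esub>"
proof -
  have "r \<odot>\<^bsub>sect F U\<^esub> ((\<lambda>x. 0) \<odot>\<^bsub>sect F U\<^esub> \<zero>\<^bsub>sect F U\<^esub>) = (\<lambda>x. r x * 0) \<odot>\<^bsub>sect F U\<^esub> \<zero>\<^bsub>sect F U\<^esub>"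
    using assms by (intro smult_assoc[symmetric] osect_zero zero_closed)
  then show ?thesis using assms by (simp add: smult_zero zero_closed)
qed

lemma add_left_commute: "zopen m U \<Longrightarrow>
      s \<in> secs F U \<Longrightarrow> t \<in> secs F U \<Longrightarrow> u \<in> secs F U \<Longrightarrow>
      s \<oplus>\<^bsub>sect F U\<^esub> (t \<oplus>\<^bsub>sect F U\<^esub> u) = t \<oplus>\<^bsub>sect F U\<^esub> (s \<oplus>\<^bsub>sect F U\<^esub> u)"
  by (simp add: add_assoc[symmetric] add_commute[of U s t])

lemma add_neg_cancel:
  assumes "zopen m U" "s \<in> secs F U" "t \<in> secs F U"
  shows "(s \<oplus>\<^bsub>sect F U\<^esub> t) \<oplus>\<^bsub>sect F U\<^esub> neg U t = s"
  using assms by (simp add: add_assoc neg_closed add_commute[of U t] neg_add add_zero)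

end

section \<open>Morphisms, and the transport of module laws along them\<close>

lemma sheaf_homD:
  assumes "sheaf_hom m A B \<phi>" "zopen m U"
  shows "s \<in> secs A U \<Longrightarrow> \<phi> U s \<in> secs B U"
    and "s \<in> secs A U \<Longrightarrow> t \<in> secs A U \<Longrightarrow>
      \<phi> U (s \<oplus>\<^bsub>sect A U\<^esub> t) = \<phi> U s \<oplus>\<^bsub>sect B U\<^esub> \<phi> U t"
    and "r \<in> osect m 0 U \<Longrightarrow> s \<in> secs A U \<Longrightarrow>
      \<phi> U (r \<odot>\<^bsub>sect A U\<^esub> s) = r \<odot>\<^bsub>sect B U\<^esub> \<phi> U s"
    and "zopen m T \<Longrightarrow> T \<subseteq> U \<Longrightarrow> s \<in> secs A U \<Longrightarrow>
      res B U T (\<phi> U s) = \<phi> T (res A U T s)"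
  using assms unfolding sheaf_hom_def by auto

lemma sheaf_homI:
  assumes "\<And>U s. zopen m U \<Longrightarrow> s \<in> secs A U \<Longrightarrow> \<phi> U s \<in> secs B U"
    and "\<And>U s t. zopen m U \<Longrightarrow> s \<in> secs A U \<Longrightarrow> t \<in> secs A U \<Longrightarrow>
      \<phi> U (s \<oplus>\<^bsub>sect A U\<^esub> t) = \<phi> U s \<oplus>\<^bsub>sect B U\<^esub> \<phi> U t"
    and "\<And>U r s. zopen m U \<Longrightarrow> r \<in> osect m 0 U \<Longrightarrow> s \<in> secs A U \<Longrightarrow>
      \<phi> U (r \<odot>\<^bsub>sect A U\<^esub> s) = r \<odot>\<^bsub>sect B U\<^esub> \<phi> U s"
    and "\<And>U T s. zopen m U \<Longrightarrow> zopen m T \<Longrightarrow> T \<subseteq> U \<Longrightarrow> s \<in> secs A U \<Longrightarrow>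
      res B U T (\<phi> U s) = \<phi> T (res A U T s)"
  shows "sheaf_hom m A B \<phi>"
  using assms unfolding sheaf_hom_def by auto

lemma sheaf_hom_compose:
  assumes "sheaf_hom m A B \<phi>" "sheaf_hom m B C \<psi>"
  shows "sheaf_hom m A C (\<lambda>U s. \<psi> U (\<phi> U s))"
  by (rule sheaf_homI)
    (simp_all add: sheaf_homD[OF assms(1)] sheaf_homD[OF assms(2)])

text \<open>\<open>sheaf_hom\<close> does not mention zero sections; that they are preserved follows
  from compatibility with multiplication by the scalar 0.\<close>

lemma sheaf_hom_zero:
  assumes "sheaf_hom m A B \<phi>" "mod_presheaf m A" "mod_presheaf m B" "zopen m U"
  shows "\<phi> U \<zero>\<^bsub>sect A U\<^esub> = \<zero>\<^bsub>sect B U\<^esub>"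
proof -
  interpret A: mod_presheaf m A by fact
  interpret B: mod_presheaf m B by fact
  have "\<phi> U ((\<lambda>x. 0) \<odot>\<^bsub>sect A U\<^esub> \<zero>\<^bsub>sect A U\<^esub>) = (\<lambda>x. 0) \<odot>\<^bsub>sect B U\<^esub> \<phi> U \<zero>\<^bsub>sect A U\<^esub>"
    by (intro sheaf_homD(3)[OF assms(1)] assms(4) osect_zero A.zero_closed)
  then show ?thesis
    by (simp add: A.smult_zero B.smult_zero assms(4) A.zero_closed sheaf_homD(1)[OF assms(1)])
qed

text \<open>This gives the module axioms for the quotient bundle without computing with germs: it embeds
  into a direct sum of line bundles.\<close>

lemma mod_presheaf_inj:
  assumes "mod_closed m A" "mod_presheaf m B" "sheaf_hom m A B \<phi>"
    and inj: "\<And>U. zopen m U \<Longrightarrow> inj_on (\<phi> U) (secs A U)"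
    and zero: "\<And>U. zopen m U \<Longrightarrow> \<phi> U \<zero>\<^bsub>sect A U\<^esub> = \<zero>\<^bsub>sect B U\<^esub>"
  shows "mod_presheaf m A"
proof -
  interpret A: mod_closed m A by fact
  interpret B: mod_presheaf m B by fact
  note h = sheaf_homD[OF assms(3)] sheaf_homD(4)[OF assms(3), symmetric]
  note c = A.zero_closed A.add_closed A.smult_closed A.res_closed
  have eqI: "s = t" if "zopen m U" "s \<in> secs A U" "t \<in> secs A U"
    "\<phi> U s = \<phi> U t" for U s t
    using inj[OF that(1)] that by (auto dest: inj_onD)
  have h4: "\<phi> T (res A U T s) = res B U T (\<phi> U s)" if "zopen m U"
    "zopen m T" "T \<subseteq> U" "s \<in> secs A U" for U T s
    using h(4) that by simp
  note hs = h(1-3) h4 zero c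
  show ?thesis
  proof (unfold_locales, goal_cases)
    case (1 U s t u) then show ?case by (intro eqI[of U]) (simp_all add: hs B.add_assoc)
  next
    case (2 U s t) then show ?case
      by (intro eqI[of U]) (simp_all add: hs B.add_commute[of U "\<phi> U s"])
  next
    case (3 U s) then show ?case by (intro eqI[of U]) (simp_all add: hs B.zero_add)
  next
    case (4 U r s t) then show ?case by (intro eqI[of U]) (simp_all add: hs B.smult_add_right)
  next
    case (5 U r r' s) then show ?case
      by (intro eqI[of U]) (simp_all add: hs osect_add B.smult_add_left)
  next
    case (6 U r r' s) then show ?case
      using osect_mult[of r m 0 U r' 0] by (intro eqI[of U]) (simp_all add: hs B.smult_assoc)
  next
    case (7 U s) then show ?case
      by (intro eqI[of U]) (simp_all add: hs osect_const B.smult_one)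
  next
    case (8 U s) then show ?case
      by (intro eqI[of U]) (simp_all add: hs osect_zero B.smult_zero)
  next
    case (9 U T) then show ?case by (intro eqI[of T]) (simp_all add: hs B.res_zero)
  next
    case (10 U T s t) then show ?case by (intro eqI[of T]) (simp_all add: hs B.res_add)
  next
    case (11 U T r s) then show ?case
      by (intro eqI[of T]) (simp_all add: hs osect_ores B.res_smult)
  next
    case (12 U s) then show ?case by (intro eqI[of U]) (simp_all add: hs B.res_self)
  next
    case (13 U T T' s) then show ?case
      by (intro eqI[of T']) (simp_all add: hs B.res_res subset_trans[of T' T U])
  qed
qed

text \<open>Every section of \<open>B\<close> is an image, so each law in \<open>B\<close> is the
  image of the same law in \<open>A\<close>. This gives the laws for sheaves of coset valued
  functions without computing with sums of cosets.\<close>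

lemma mod_presheaf_image:
  assumes "mod_presheaf m A" "sheaf_hom m A B \<phi>"
    and surj: "\<And>U. zopen m U \<Longrightarrow> \<phi> U ` secs A U = secs B U"
    and zero: "\<And>U. zopen m U \<Longrightarrow> \<phi> U \<zero>\<^bsub>sect A U\<^esub> = \<zero>\<^bsub>sect B U\<^esub>"
  shows "mod_presheaf m B"
proof -
  interpret A: mod_presheaf m A by fact
  note h = sheaf_homD(2-4)[OF assms(2), symmetric]
  have h4: "res B U T (\<phi> U s) = \<phi> T (res A U T s)" if "zopen m U"
    "zopen m T" "T \<subseteq> U" "s \<in> secs A U" for U T s
    using sheaf_homD(4)[OF assms(2)] that by simp
  note c = A.zero_closed A.add_closed A.smult_closed A.res_closed sheaf_homD(1)[OF assms(2)]
  note hs = zero[symmetric] h(1,2) h4 c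
  have ex: "\<exists>a\<in>secs A U. s = \<phi> U a"
    if "zopen m U" "s \<in> secs B U" for U s
    using surj[OF that(1)] that(2) by blast
  show ?thesis
  proof (unfold_locales, goal_cases)
    case (1 U) then show ?case by (simp add: hs)
  next
    case (2 U s t) then show ?case using ex[of U s] ex[of U t] by (auto simp: hs)
  next
    case (3 U r s) then show ?case using ex[of U s] by (auto simp: hs)
  next
    case (4 U T s) then show ?case using ex[of U s] by (auto simp: hs)
  next
    case (5 U s t u) then show ?case using ex[of U s] ex[of U t] ex[of U u]
      by (auto simp: hs A.add_assoc)
  next
    case (6 U s t) 
    then obtain a b where "a \<in> secs A U" "b \<in> secs A U" "s = \<phi> U a" "t = \<phi> U b"
      using ex[of U s] ex[of U t] by blast
    with 6 show ?case using A.add_commute[of U a b] by (simp add: hs)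
  next
    case (7 U s) then show ?case using ex[of U s] by (auto simp: hs A.zero_add)
  next
    case (8 U r s t) then show ?case using ex[of U s] ex[of U t] by (auto simp: hs A.smult_add_right)
  next
    case (9 U r r' s) then show ?case
      using ex[of U s] by (auto simp: hs osect_add A.smult_add_left)
  next
    case (10 U r r' s) then show ?case
      using ex[of U s] osect_mult[of r m 0 U r' 0] by (auto simp: hs A.smult_assoc)
  next
    case (11 U s) then show ?case
      using ex[of U s] by (auto simp: hs osect_const A.smult_one)
  next
    case (12 U s) then show ?case
      using ex[of U s] by (auto simp: hs osect_zero A.smult_zero)
  next
    case (13 U T) then show ?case by (simp add: hs A.res_zero)
  next
    case (14 U T s t) then show ?case using ex[of U s] ex[of U t] by (auto simp: hs A.res_add)
  next
    case (15 U T r s) then show ?case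
      using ex[of U s] by (auto simp: hs osect_ores A.res_smult)
  next
    case (16 U s) then show ?case using ex[of U s] by (auto simp: hs A.res_self)
  next
    case (17 U T T' s) then show ?case
      using ex[of U s] by (auto simp: hs A.res_res subset_trans[of T' T U])
  qed
qed

section \<open>Line bundles and direct sums\<close>

lemma sect_line_sheaf:
  "secs (line_sheaf m d) U = osect m d U"
  "\<zero>\<^bsub>sect (line_sheaf m d) U\<^esub> = (\<lambda>x. 0)"
  "s \<oplus>\<^bsub>sect (line_sheaf m d) U\<^esub> t = (\<lambda>x. s x + t x)"
  "r \<odot>\<^bsub>sect (line_sheaf m d) U\<^esub> s = (\<lambda>x. r x * s x)"
  "res (line_sheaf m d) U T s = ores T s"
  by (simp_all add: line_sheaf_def)

lemma sheaf_mod_line: "sheaf_mod m (line_sheaf m d)"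
proof (unfold_locales, unfold sect_line_sheaf, goal_cases)
  case (3 U r s) then show ?case using osect_mult[of r m 0 U s d] by simp
next
  case (4 U T s) then show ?case by (simp add: osect_ores)
next
  case (18 U s t)
  show ?case
  proof
    fix x show "s x = t x"
    proof (cases "x \<in> \<Union>U")
      case True
      then obtain L where L: "x \<in> L" "L \<in> U" by blast
      with 18(4)[of L] obtain T where "L \<in> T" "ores T s = ores T t" by blast
      then have "ores T s x = ores T t x" "x \<in> \<Union>T" using L by auto
      then show ?thesis by (simp add: ores_def)
    next
      case False then show ?thesis using 18(2,3) osect_outside by metis
    qed
  qed
next
  case (19 U G)
  \<comment> \<open>Compatibility is given on \<open>T \<inter> T'\<close>, while \<open>x\<close>
    is only known to lie in both cones; \<open>cone_Int\<close> bridges the gap. Hence the definite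
    description below has a unique value.\<close>
  have eq: "c x = c' x" if "(T, c) \<in> G" "(T', c') \<in> G" "x \<in> \<Union>T" "x \<in> \<Union>T'" for T T' c c' x
  proof -
    have "T \<subseteq> proj m" "T' \<subseteq> proj m" using 19(2)[OF that(1)] 19(2)[OF that(2)] open_subset_proj by blast+
    then have "x \<in> \<Union>(T \<inter> T')" using that(3,4) cone_Int by blast
    then show ?thesis using fun_cong[OF 19(4)[OF that(1,2)], of x] by (simp add: ores_def)
  qed
  define s where "s x = (if x \<in> \<Union>U then (THE v. \<exists>T c. (T, c) \<in> G \<and> x \<in> \<Union>T \<and> v = c x) else 0)" for x
  have s: "s x = c x" if "(T, c) \<in> G" "x \<in> \<Union>T" for T c x
  proof -
    have "x \<in> \<Union>U" using 19(2)[OF that(1)] that(2) by blast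
    moreover have "(THE v. \<exists>T c. (T, c) \<in> G \<and> x \<in> \<Union>T \<and> v = c x) = c x"
    proof (rule the_equality)
      show "\<exists>T' c'. (T', c') \<in> G \<and> x \<in> \<Union>T' \<and> c x = c' x" using that by blast
      show "\<And>v. \<exists>T' c'. (T', c') \<in> G \<and> x \<in> \<Union>T' \<and> v = c' x \<Longrightarrow> v = c x"
        using eq[OF _ that(1) _ that(2)] by blast
    qed
    ultimately show ?thesis by (simp add: s_def)
  qed
  have "s \<in> osect m d U"
  proof (rule osect_local)
    show "x \<notin> \<Union>U \<Longrightarrow> s x = 0" for x by (simp add: s_def)
    fix L assume "L \<in> U"
    then obtain T c where T: "(T, c) \<in> G" "L \<in> T" using 19(3) by blast
    then show "\<exists>T t. zopen m T \<and> L \<in> T \<and> T \<subseteq> U \<and> t \<in> osect m d T \<and> (\<forall>x\<in>\<Union>T. s x = t x)"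
      using 19(2)[OF T(1)] s[OF T(1)] by (intro exI[of _ T] exI[of _ c]) simp
  qed
  moreover have "ores T s = c" if "(T, c) \<in> G" for T c
    using s[OF that] 19(2)[OF that] osect_outside[of c m d T] by (auto simp: ores_def fun_eq_iff)
  ultimately show ?case by blast
qed (auto simp: osect_zero osect_add osect_ores ores_ident ores_def fun_eq_iff algebra_simps
  dest: osect_outside)

lemma sect_dsum:
  "secs (dsum I F) U = (\<Pi>\<^sub>E i\<in>I. secs (F i) U)"
  "\<zero>\<^bsub>sect (dsum I F) U\<^esub> = (\<lambda>i\<in>I. \<zero>\<^bsub>sect (F i) U\<^esub>)"
  "s \<oplus>\<^bsub>sect (dsum I F) U\<^esub> t = (\<lambda>i\<in>I. s i \<oplus>\<^bsub>sect (F i) U\<^esub> t i)"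
  "r \<odot>\<^bsub>sect (dsum I F) U\<^esub> s = (\<lambda>i\<in>I. r \<odot>\<^bsub>sect (F i) U\<^esub> s i)"
  "res (dsum I F) U T s = (\<lambda>i\<in>I. res (F i) U T (s i))"
  by (simp_all add: dsum_def)

lemma mod_presheaf_dsum:
  assumes "\<And>i. i \<in> I \<Longrightarrow> mod_presheaf m (F i)"
  shows "mod_presheaf m (dsum I F)"
proof -
  \<comment> \<open>Some laws have a bare section on the right. Writing it as a restricted function
    makes a componentwise comparison possible.\<close>
  have ext: "s = (\<lambda>i\<in>I. s i)" if "s \<in> (\<Pi>\<^sub>E i\<in>I. X i)" for s :: "'a \<Rightarrow> 'b" and X
    using that by (auto simp: PiE_iff extensional_restrict)
  note c = mod_closed.zero_closed mod_closed.add_closed mod_closed.smult_closed mod_closed.res_closed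
  have mc: "mod_closed m (F i)" if "i \<in> I" for i using assms[OF that] by (simp add: mod_presheaf_def)
  have el: "s i \<in> secs (F i) U" if "s \<in> (\<Pi>\<^sub>E i\<in>I. secs (F i) U)" "i \<in> I" for s U i
    using that by (simp add: PiE_iff)
  show ?thesis
  proof (unfold_locales, unfold sect_dsum, goal_cases)
    case (1 U) then show ?case by (auto intro: c mc)
  next
    case (2 U s t) then show ?case by (auto intro!: c mc)
  next
    case (3 U r s) then show ?case by (auto intro!: c mc)
  next
    case (4 U T s) then show ?case by (auto intro!: c mc)
  next
    case (5 U s t u) then show ?case
      by (intro restrict_ext) (simp add: el mod_presheaf.add_assoc[OF assms])
  next
    case (6 U s t) then show ?case
      by (intro restrict_ext) (simp add: el mod_presheaf.add_commute[OF assms, of _ U "s _"])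
  next
    case (7 U s) 
    show ?case by (subst (2) ext[OF 7(2)]) 
       (intro restrict_ext, use 7 in \<open>simp add: el mod_presheaf.zero_add[OF assms]\<close>)
  next
    case (8 U r s t) then show ?case
      by (intro restrict_ext) (simp add: el mod_presheaf.smult_add_right[OF assms])
  next
    case (9 U r r' s) then show ?case
      by (intro restrict_ext) (simp add: el mod_presheaf.smult_add_left[OF assms])
  next
    case (10 U r r' s) then show ?case
      by (intro restrict_ext) (simp add: el mod_presheaf.smult_assoc[OF assms])
  next
    case (11 U s) 
    show ?case by (subst (2) ext[OF 11(2)]) 
       (intro restrict_ext, use 11 in \<open>simp add: el mod_presheaf.smult_one[OF assms]\<close>)
  next
    case (12 U s) then show ?case
      by (intro restrict_ext) (simp add: el mod_presheaf.smult_zero[OF assms])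
  next
    case (13 U T) then show ?case
      by (intro restrict_ext) (simp add: el mod_presheaf.res_zero[OF assms])
  next
    case (14 U T s t) then show ?case
      by (intro restrict_ext) (simp add: el mod_presheaf.res_add[OF assms])
  next
    case (15 U T r s) then show ?case
      by (intro restrict_ext) (simp add: el mod_presheaf.res_smult[OF assms])
  next
    case (16 U s) 
    show ?case by (subst (2) ext[OF 16(2)]) 
       (intro restrict_ext, use 16 in \<open>simp add: el mod_presheaf.res_self[OF assms]\<close>)
  next
    case (17 U T T' s) then show ?case
      by (intro restrict_ext) (simp add: el mod_presheaf.res_res[OF assms])
  qed
qed

lemma sheaf_mod_dsum:
  assumes "\<And>i. i \<in> I \<Longrightarrow> sheaf_mod m (F i)"
  shows "sheaf_mod m (dsum I F)"
proof -
  have pre: "mod_presheaf m (F i)" if "i \<in> I" for i using assms[OF that] by (simp add: sheaf_mod_def)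
  show ?thesis
  proof (rule sheaf_mod.intro[OF mod_presheaf_dsum[OF pre]], assumption,
      unfold_locales, unfold sect_dsum, goal_cases)
    case (1 U s t)
    show ?case
    proof (rule PiE_ext[OF 1(2,3)])
      fix i assume i: "i \<in> I"
      show "s i = t i"
      proof (rule sheaf_mod.separated[OF assms[OF i] 1(1)])
        show "s i \<in> secs (F i) U" "t i \<in> secs (F i) U" using 1(2,3) i by auto
        fix L assume "L \<in> U"
        then obtain T where T: "zopen m T" "L \<in> T" "T \<subseteq> U"
          "(\<lambda>i\<in>I. res (F i) U T (s i)) = (\<lambda>i\<in>I. res (F i) U T (t i))" using 1(4) by blast
        from fun_cong[OF T(4), of i] i have "res (F i) U T (s i) = res (F i) U T (t i)" by simp
        with T(1-3) show "\<exists>T. zopen m T \<and> L \<in> T \<and> T \<subseteq> U \<and> res (F i) U T (s i) = res (F i) U T (t i)"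
          by blast
      qed
    qed
  next
    case (2 U G)
    have "\<exists>s\<in>secs (F i) U. \<forall>(T, c)\<in>G. res (F i) U T s = c i" if i: "i \<in> I" for i
    proof -
      let ?G = "(\<lambda>(T, c). (T, c i)) ` G"
      have "\<exists>s\<in>secs (F i) U. \<forall>(T, c)\<in>?G. res (F i) U T s = c"
      proof (rule sheaf_mod.glue[OF assms[OF i] 2(1)])
        show "zopen m T \<and> T \<subseteq> U \<and> c \<in> secs (F i) T" if "(T, c) \<in> ?G" for T c
          using that 2(2) i by fastforce
        show "\<exists>T c. (T, c) \<in> ?G \<and> L \<in> T" if "L \<in> U" for L
          using 2(3)[OF that] by force
        fix T c T' c' assume "(T, c) \<in> ?G" "(T', c') \<in> ?G"
        then obtain b b' where b: "(T, b) \<in> G" "(T', b') \<in> G" "c = b i" "c' = b' i" by auto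
        from fun_cong[OF 2(4)[OF b(1,2)], of i] i
        show "res (F i) T (T \<inter> T') c = res (F i) T' (T \<inter> T') c'" by (simp add: b)
      qed
      then show ?thesis by auto
    qed
    then obtain s where s: "\<And>i. i \<in> I \<Longrightarrow> s i \<in> secs (F i) U \<and> (\<forall>(T, c)\<in>G. res (F i) U T (s i) = c i)"
      by metis
    have "(\<lambda>i\<in>I. res (F i) U T (restrict s I i)) = c" if "(T, c) \<in> G" for T c
    proof (rule PiE_ext)
      show "c \<in> (\<Pi>\<^sub>E i\<in>I. secs (F i) T)" using 2(2)[OF that] by simp
      show "(\<lambda>i\<in>I. res (F i) U T (restrict s I i)) \<in> (\<Pi>\<^sub>E i\<in>I. secs (F i) T)"
        using 2(2)[OF that] s that by (fastforce simp: PiE_iff)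
      show "(\<lambda>i\<in>I. res (F i) U T (restrict s I i)) i = c i" if "i \<in> I" for i
        using s[OF that] \<open>(T, c) \<in> G\<close> that by auto
    qed
    moreover have "restrict s I \<in> (\<Pi>\<^sub>E i\<in>I. secs (F i) U)" using s by auto
    ultimately show ?case by blast
  qed
qed

section \<open>Cokernels\<close>

lemma sect_coker:
  "secs (coker_sheaf m A B \<phi>) U = {s \<in> extensional U. \<forall>L\<in>U. \<exists>T b. zopen m T \<and>
     L \<in> T \<and> T \<subseteq> U \<and> b \<in> secs B T \<and> (\<forall>M\<in>T. s M = coker_germ m A B \<phi> M T b)}"
  "\<zero>\<^bsub>sect (coker_sheaf m A B \<phi>) U\<^esub> = (\<lambda>L\<in>U. coker_germ m A B \<phi> L U \<zero>\<^bsub>sect B U\<^esub>)"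
  "s \<oplus>\<^bsub>sect (coker_sheaf m A B \<phi>) U\<^esub> t = (\<lambda>L\<in>U. \<Union>(V, b)\<in>s L. \<Union>(V', b')\<in>t L.
     coker_germ m A B \<phi> L (V \<inter> V')
       (res B V (V \<inter> V') b \<oplus>\<^bsub>sect B (V \<inter> V')\<^esub> res B V' (V \<inter> V') b'))"
  "r \<odot>\<^bsub>sect (coker_sheaf m A B \<phi>) U\<^esub> s = (\<lambda>L\<in>U. \<Union>(V, b)\<in>s L.
     coker_germ m A B \<phi> L (U \<inter> V)
       (ores (U \<inter> V) r \<odot>\<^bsub>sect B (U \<inter> V)\<^esub> res B V (U \<inter> V) b))"
  "res (coker_sheaf m A B \<phi>) U T s = restrict s T"
  by (simp_all add: coker_sheaf_def)

locale coker = A: mod_closed m A + B: mod_presheaf m B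
  for m :: nat and A :: "'s mod_sheaf" and B :: "'t mod_sheaf" +
  fixes \<phi> :: "pset \<Rightarrow> 's \<Rightarrow> 't"
  assumes hom: "sheaf_hom m A B \<phi>"
begin

abbreviation germ :: "cvec set \<Rightarrow> pset \<Rightarrow> 't \<Rightarrow> (pset \<times> 't) set" where
  "germ \<equiv> coker_germ m A B \<phi>"

abbreviation CK :: "(cvec set \<Rightarrow> (pset \<times> 't) set) mod_sheaf" where
  "CK \<equiv> coker_sheaf m A B \<phi>"

text \<open>The equivalence relation hidden in \<open>coker_germ\<close>: equality of two classes in
  the stalk of the cokernel at \<open>L\<close>. Germs are its classes, so an equation between germs
  can be traded for an equation in \<open>B\<close> near \<open>L\<close>.\<close>

definition congruent :: "cvec set \<Rightarrow> pset \<Rightarrow> 't \<Rightarrow> pset \<Rightarrow> 't \<Rightarrow> bool" where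
  "congruent L U b V c \<longleftrightarrow> (\<exists>T. zopen m T \<and> L \<in> T \<and> T \<subseteq> U \<inter> V \<and>
     (\<exists>a\<in>secs A T. res B V T c = res B U T b \<oplus>\<^bsub>sect B T\<^esub> \<phi> T a))"

lemma congruentI:
  "zopen m T \<Longrightarrow> L \<in> T \<Longrightarrow> T \<subseteq> U \<Longrightarrow> T \<subseteq> V \<Longrightarrow> a \<in> secs A T \<Longrightarrow>
    res B V T c = res B U T b \<oplus>\<^bsub>sect B T\<^esub> \<phi> T a \<Longrightarrow> congruent L U b V c"
  unfolding congruent_def by blast

lemma congruentE:
  assumes "congruent L U b V c"
  obtains T a where "zopen m T" "L \<in> T" "T \<subseteq> U" "T \<subseteq> V" "a \<in> secs A T"
    "res B V T c = res B U T b \<oplus>\<^bsub>sect B T\<^esub> \<phi> T a"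
  using assms unfolding congruent_def by blast

lemma germ_iff: "(V, c) \<in> germ L U b \<longleftrightarrow>
    zopen m V \<and> L \<in> V \<and> c \<in> secs B V \<and> congruent L U b V c"
  unfolding coker_germ_def congruent_def by blast

lemmas hom_closed = sheaf_homD(1)[OF hom]
lemmas hom_add = sheaf_homD(2)[OF hom]
lemmas hom_smult = sheaf_homD(3)[OF hom]
lemmas hom_res = sheaf_homD(4)[OF hom]

text \<open>\<open>A\<close> is only known to be closed, so nothing is known about the image of its
  zero section. Multiplying that section by the scalar 0 moves the computation to \<open>B\<close>,
  where the laws hold.\<close>

lemma ex_zero_image:
  assumes "zopen m U"
  shows "\<exists>a\<in>secs A U. \<phi> U a = \<zero>\<^bsub>sect B U\<^esub>"
proof
  let ?a = "(\<lambda>x. 0) \<odot>\<^bsub>sect A U\<^esub> \<zero>\<^bsub>sect A U\<^esub>"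
  show "?a \<in> secs A U"
    by (intro A.smult_closed A.zero_closed assms osect_zero)
  show "\<phi> U ?a = \<zero>\<^bsub>sect B U\<^esub>" using assms
    by (simp add: hom_smult osect_zero A.zero_closed B.smult_zero hom_closed)
qed

lemma congruent_res:
  assumes "zopen m U" "zopen m T" "L \<in> T" "T \<subseteq> U" "b \<in> secs B U"
  shows "congruent L U b T (res B U T b)"
proof -
  from ex_zero_image[OF assms(2)] obtain a where a: "a \<in> secs A T" "\<phi> T a = \<zero>\<^bsub>sect B T\<^esub>" ..
  show ?thesis
    by (rule congruentI[OF assms(2,3,4) order_refl a(1)])
      (use assms in \<open>simp add: a B.res_closed B.add_zero B.res_self\<close>)
qed

lemma congruent_refl: "zopen m U \<Longrightarrow> L \<in> U \<Longrightarrow> b \<in> secs B U \<Longrightarrow> congruent L U b U b"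
  using congruent_res[of U U L b] by (simp add: B.res_self)

lemma congruent_sym:
  assumes "congruent L U b V c" "zopen m U" "zopen m V" "b \<in> secs B U" "c \<in> secs B V"
  shows "congruent L V c U b"
proof -
  from assms(1) obtain T a where T: "zopen m T" "L \<in> T" "T \<subseteq> U" "T \<subseteq> V" "a \<in> secs A T"
    "res B V T c = res B U T b \<oplus>\<^bsub>sect B T\<^esub> \<phi> T a" by (rule congruentE)
  \<comment> \<open>The relation is reversed by the negative of \<open>a\<close>, written as a
    scalar multiple because \<open>A\<close> carries no laws; the cancellation takes place in
    \<open>B\<close>.\<close>
  let ?a = "ores T (\<lambda>x. -1) \<odot>\<^bsub>sect A T\<^esub> a"
  have "\<phi> T ?a = B.neg T (\<phi> T a)" using T by (simp add: hom_smult osect_const B.neg_def)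
  then have "res B U T b = res B V T c \<oplus>\<^bsub>sect B T\<^esub> \<phi> T ?a"
    using T assms by (simp add: B.add_neg_cancel hom_closed B.res_closed)
  then show ?thesis using T by (intro congruentI[of T L V U ?a]) (auto intro: A.smult_closed osect_const)
qed

lemma image_eq_res:
  assumes "res B V T c = res B U T b \<oplus>\<^bsub>sect B T\<^esub> \<phi> T a" "a \<in> secs A T"
    "zopen m U" "zopen m V" "zopen m T" "zopen m S" "T \<subseteq> U" "T \<subseteq> V" "S \<subseteq> T"
    "b \<in> secs B U" "c \<in> secs B V"
  shows "res B V S c = res B U S b \<oplus>\<^bsub>sect B S\<^esub> \<phi> S (res A T S a)"
proof -
  have "res B V S c = res B T S (res B V T c)" using assms(3-) by (simp add: B.res_res)
  also have "\<dots> = res B U S b \<oplus>\<^bsub>sect B S\<^esub> \<phi> S (res A T S a)"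
    unfolding assms(1) using assms(2-)
    by (simp add: B.res_res B.res_add hom_res hom_closed B.res_closed)
  finally show ?thesis .
qed

lemma congruent_trans:
  assumes "congruent L U b V c" "congruent L V c W d" "zopen m U" "zopen m V" "zopen m W"
    "b \<in> secs B U" "c \<in> secs B V" "d \<in> secs B W"
  shows "congruent L U b W d"
proof -
  from assms(1) obtain T a where T: "zopen m T" "L \<in> T" "T \<subseteq> U" "T \<subseteq> V" "a \<in> secs A T"
    "res B V T c = res B U T b \<oplus>\<^bsub>sect B T\<^esub> \<phi> T a" by (rule congruentE)
  from assms(2) obtain T' a' where T': "zopen m T'" "L \<in> T'" "T' \<subseteq> V" "T' \<subseteq> W" "a' \<in> secs A T'"
    "res B W T' d = res B V T' c \<oplus>\<^bsub>sect B T'\<^esub> \<phi> T' a'" by (rule congruentE)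
  let ?S = "T \<inter> T'"
  have S: "zopen m ?S" using T T' by auto
  have S': "?S \<subseteq> T" "?S \<subseteq> T'" by auto
  have d: "res B W ?S d = res B V ?S c \<oplus>\<^bsub>sect B ?S\<^esub> \<phi> ?S (res A T' ?S a')"
    by (rule image_eq_res[OF T'(6,5)]) (use T T' S S' assms(3-) in auto)
  have c: "res B V ?S c = res B U ?S b \<oplus>\<^bsub>sect B ?S\<^esub> \<phi> ?S (res A T ?S a)"
    by (rule image_eq_res[OF T(6,5)]) (use T T' S S' assms(3-) in auto)
  have sub: "?S \<subseteq> U" "?S \<subseteq> W" using T(3) T'(4) by auto
  show ?thesis
    by (rule congruentI[OF S _ sub, of _ "res A T ?S a \<oplus>\<^bsub>sect A ?S\<^esub> res A T' ?S a'"])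
      (use T T' S S' assms(3-) in \<open>auto simp: d c hom_add A.res_closed A.add_closed B.add_assoc
        B.res_closed[OF _ _ sub(1)] hom_closed\<close>)
qed

lemma germ_eqI:
  assumes "congruent L U b V c" "zopen m U" "zopen m V" "b \<in> secs B U" "c \<in> secs B V"
  shows "germ L U b = germ L V c"
proof (intro Set.set_eqI iffI; clarify)
  fix W d assume "(W, d) \<in> germ L U b"
  then show "(W, d) \<in> germ L V c"
    using congruent_trans[OF congruent_sym[OF assms], of W d] assms by (simp add: germ_iff)
next
  fix W d assume "(W, d) \<in> germ L V c"
  then show "(W, d) \<in> germ L U b"
    using congruent_trans[OF assms(1), of W d] assms by (simp add: germ_iff)
qed

lemma germ_eqD:
  "germ L U b = germ L V c \<Longrightarrow> zopen m V \<Longrightarrow> L \<in> V \<Longrightarrow> c \<in> secs B V \<Longrightarrow> congruent L U b V c"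
  using congruent_refl[of V L c] germ_iff[of V c L V c] germ_iff[of V c L U b] by simp

lemma germ_res:
  "zopen m U \<Longrightarrow> zopen m T \<Longrightarrow> L \<in> T \<Longrightarrow> T \<subseteq> U \<Longrightarrow> b \<in> secs B U \<Longrightarrow>
    germ L U b = germ L T (res B U T b)"
  by (rule germ_eqI[OF congruent_res]) (auto simp: B.res_closed)

lemma congruent_add:
  assumes "congruent L V b W c" "congruent L V' b' W' c'"
    and o: "zopen m V" "zopen m V'" "zopen m W" "zopen m W'"
    and b: "b \<in> secs B V" "b' \<in> secs B V'"
      "c \<in> secs B W" "c' \<in> secs B W'"
  shows "congruent L (V \<inter> V') (res B V (V \<inter> V') b \<oplus>\<^bsub>sect B (V \<inter> V')\<^esub> res B V' (V \<inter> V') b')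
    (W \<inter> W') (res B W (W \<inter> W') c \<oplus>\<^bsub>sect B (W \<inter> W')\<^esub> res B W' (W \<inter> W') c')"
proof -
  from assms(1) obtain T a where T: "zopen m T" "L \<in> T" "T \<subseteq> V" "T \<subseteq> W" "a \<in> secs A T"
    "res B W T c = res B V T b \<oplus>\<^bsub>sect B T\<^esub> \<phi> T a" by (rule congruentE)
  from assms(2) obtain T' a' where T': "zopen m T'" "L \<in> T'" "T' \<subseteq> V'" "T' \<subseteq> W'" "a' \<in> secs A T'"
    "res B W' T' c' = res B V' T' b' \<oplus>\<^bsub>sect B T'\<^esub> \<phi> T' a'" by (rule congruentE)
  let ?S = "T \<inter> T'"
  have S: "zopen m ?S" "zopen m (V \<inter> V')" "zopen m (W \<inter> W')" using T T' o by auto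
  have S': "?S \<subseteq> T" "?S \<subseteq> T'" "?S \<subseteq> V" "?S \<subseteq> V'" "?S \<subseteq> W" "?S \<subseteq> W'" "?S \<subseteq> V \<inter> V'" "?S \<subseteq> W \<inter> W'"
    using T T' by auto
  have c: "res B W ?S c = res B V ?S b \<oplus>\<^bsub>sect B ?S\<^esub> \<phi> ?S (res A T ?S a)"
    by (rule image_eq_res[OF T(6,5)]) (use T T' S S' o b in auto)
  have c': "res B W' ?S c' = res B V' ?S b' \<oplus>\<^bsub>sect B ?S\<^esub> \<phi> ?S (res A T' ?S a')"
    by (rule image_eq_res[OF T'(6,5)]) (use T T' S S' o b in auto)
  have in1: "res B V ?S b \<in> secs B ?S" "res B V' ?S b' \<in> secs B ?S"
    using S S' o b by (auto intro: B.res_closed)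
  have in2: "res A T ?S a \<in> secs A ?S" "res A T' ?S a' \<in> secs A ?S"
    using S S' T T' by (auto intro: A.res_closed)
  have "res B (W \<inter> W') ?S (res B W (W \<inter> W') c \<oplus>\<^bsub>sect B (W \<inter> W')\<^esub> res B W' (W \<inter> W') c') =
    res B W ?S c \<oplus>\<^bsub>sect B ?S\<^esub> res B W' ?S c'"
    using S S' o b by (simp add: B.res_add B.res_closed B.res_res)
  also have "\<dots> = (res B V ?S b \<oplus>\<^bsub>sect B ?S\<^esub> res B V' ?S b') \<oplus>\<^bsub>sect B ?S\<^esub>
      \<phi> ?S (res A T ?S a \<oplus>\<^bsub>sect A ?S\<^esub> res A T' ?S a')"
    using in1 in2 S by (simp add: c c' hom_add hom_closed B.add_closed B.add_assoc B.add_left_commute)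
  also have "res B V ?S b \<oplus>\<^bsub>sect B ?S\<^esub> res B V' ?S b' =
    res B (V \<inter> V') ?S (res B V (V \<inter> V') b \<oplus>\<^bsub>sect B (V \<inter> V')\<^esub> res B V' (V \<inter> V') b')"
    using S S' o b by (simp add: B.res_add B.res_closed B.res_res)
  finally show ?thesis
    using S S' T T' in2 by (intro congruentI[OF S(1) _ S'(7,8)]) (auto intro: A.add_closed)
qed

lemma congruent_smult:
  assumes "congruent L V b W c" "L \<in> U" and r: "r \<in> osect m 0 U"
    and o: "zopen m V" "zopen m W" "zopen m U"
    and b: "b \<in> secs B V" "c \<in> secs B W"
  shows "congruent L (U \<inter> V) (ores (U \<inter> V) r \<odot>\<^bsub>sect B (U \<inter> V)\<^esub> res B V (U \<inter> V) b)
    (U \<inter> W) (ores (U \<inter> W) r \<odot>\<^bsub>sect B (U \<inter> W)\<^esub> res B W (U \<inter> W) c)"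
proof -
  from assms(1) obtain T a where T: "zopen m T" "L \<in> T" "T \<subseteq> V" "T \<subseteq> W" "a \<in> secs A T"
    "res B W T c = res B V T b \<oplus>\<^bsub>sect B T\<^esub> \<phi> T a" by (rule congruentE)
  let ?S = "U \<inter> T"
  have S: "zopen m ?S" "zopen m (U \<inter> V)" "zopen m (U \<inter> W)" using T o by auto
  have S': "?S \<subseteq> T" "?S \<subseteq> U" "?S \<subseteq> V" "?S \<subseteq> W" "?S \<subseteq> U \<inter> V" "?S \<subseteq> U \<inter> W"
    using T by auto
  have rr: "ores ?S r \<in> osect m 0 ?S" "ores (U \<inter> V) r \<in> osect m 0 (U \<inter> V)" "ores (U \<inter> W) r \<in> osect m 0 (U \<inter> W)"
    using S r by (auto intro: osect_ores)
  have oo: "ores ?S (ores X r) = ores ?S r" if "?S \<subseteq> X" for X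
    using that by (auto simp: ores_def fun_eq_iff)
  have c: "res B W ?S c = res B V ?S b \<oplus>\<^bsub>sect B ?S\<^esub> \<phi> ?S (res A T ?S a)"
    by (rule image_eq_res[OF T(6,5)]) (use T S S' o b in auto)
  have in1: "res B V ?S b \<in> secs B ?S" using S S' o b by (auto intro: B.res_closed)
  have in2: "res A T ?S a \<in> secs A ?S" using S S' T by (auto intro: A.res_closed)
  have "res B (U \<inter> W) ?S (ores (U \<inter> W) r \<odot>\<^bsub>sect B (U \<inter> W)\<^esub> res B W (U \<inter> W) c) =
    ores ?S r \<odot>\<^bsub>sect B ?S\<^esub> res B W ?S c"
    using S S' o b rr by (simp add: B.res_smult B.res_closed B.res_res oo)
  also have "\<dots> = ores ?S r \<odot>\<^bsub>sect B ?S\<^esub> res B V ?S b \<oplus>\<^bsub>sect B ?S\<^esub>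
      \<phi> ?S (ores ?S r \<odot>\<^bsub>sect A ?S\<^esub> res A T ?S a)"
    using in1 in2 S rr by (simp add: c hom_smult hom_closed B.smult_add_right)
  also have "ores ?S r \<odot>\<^bsub>sect B ?S\<^esub> res B V ?S b =
    res B (U \<inter> V) ?S (ores (U \<inter> V) r \<odot>\<^bsub>sect B (U \<inter> V)\<^esub> res B V (U \<inter> V) b)"
    using S S' o b rr by (simp add: B.res_smult B.res_closed B.res_res oo)
  finally show ?thesis
    using S S' T in2 rr assms(2) by (intro congruentI[OF S(1) _ S'(5,6)]) (auto intro: A.smult_closed)
qed

text \<open>By \<open>congruent_add\<close> every pair of representatives contributes the same germ,
  and the pair \<open>b\<close>, \<open>b'\<close> itself occurs, so the union in the definition of
  the sum collapses. \<open>germ_smult\<close> works alike.\<close>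

lemma germ_add:
  assumes "zopen m V" "zopen m V'" "L \<in> V" "L \<in> V'" "b \<in> secs B V" "b' \<in> secs B V'"
  shows "(\<Union>(W, c)\<in>germ L V b. \<Union>(W', c')\<in>germ L V' b'.
      germ L (W \<inter> W') (res B W (W \<inter> W') c \<oplus>\<^bsub>sect B (W \<inter> W')\<^esub> res B W' (W \<inter> W') c')) =
    germ L (V \<inter> V') (res B V (V \<inter> V') b \<oplus>\<^bsub>sect B (V \<inter> V')\<^esub> res B V' (V \<inter> V') b')"
    (is "?l = ?r")
proof -
  have eq: "germ L (W \<inter> W') (res B W (W \<inter> W') c \<oplus>\<^bsub>sect B (W \<inter> W')\<^esub> res B W' (W \<inter> W') c') = ?r"
    if "(W, c) \<in> germ L V b" "(W', c') \<in> germ L V' b'" for W c W' c'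
    using that assms unfolding germ_iff
    by (intro germ_eqI[symmetric] congruent_add) (auto intro: B.add_closed B.res_closed)
  have "(V, b) \<in> germ L V b" "(V', b') \<in> germ L V' b'" using assms by (simp_all add: germ_iff congruent_refl)
  then show ?thesis using eq by fast
qed

lemma germ_smult:
  assumes "zopen m V" "zopen m U" "L \<in> V" "L \<in> U" "b \<in> secs B V" "r \<in> osect m 0 U"
  shows "(\<Union>(W, c)\<in>germ L V b.
      germ L (U \<inter> W) (ores (U \<inter> W) r \<odot>\<^bsub>sect B (U \<inter> W)\<^esub> res B W (U \<inter> W) c)) =
    germ L (U \<inter> V) (ores (U \<inter> V) r \<odot>\<^bsub>sect B (U \<inter> V)\<^esub> res B V (U \<inter> V) b)"
    (is "?l = ?r")
proof -
  have eq: "germ L (U \<inter> W) (ores (U \<inter> W) r \<odot>\<^bsub>sect B (U \<inter> W)\<^esub> res B W (U \<inter> W) c) = ?r"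
    if "(W, c) \<in> germ L V b" for W c
    using that assms unfolding germ_iff
    by (intro germ_eqI[symmetric] congruent_smult) (auto intro!: B.smult_closed B.res_closed osect_ores)
  have "(V, b) \<in> germ L V b" using assms by (simp_all add: germ_iff congruent_refl)
  then show ?thesis using eq by fast
qed

text \<open>Local representatives are the interface to sections of the cokernel: sums, multiples and
  restrictions are computed on them through \<open>rep_add\<close>, \<open>rep_smult\<close> and
  \<open>rep_res\<close> instead of on sets of germs.\<close>

definition rep :: "(cvec set \<Rightarrow> (pset \<times> 't) set) \<Rightarrow> pset \<Rightarrow> 't \<Rightarrow> bool" where
  "rep s T b \<longleftrightarrow> zopen m T \<and> b \<in> secs B T \<and> (\<forall>M\<in>T. s M = germ M T b)"

lemma coker_carrier_iff: "s \<in> secs CK U \<longleftrightarrow>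
    s \<in> extensional U \<and> (\<forall>L\<in>U. \<exists>T b. L \<in> T \<and> T \<subseteq> U \<and> rep s T b)"
  unfolding sect_coker rep_def mem_Collect_eq by (simp add: conj_ac)

lemma coker_rep: "s \<in> secs CK U \<Longrightarrow> L \<in> U \<Longrightarrow> \<exists>T b. L \<in> T \<and> T \<subseteq> U \<and> rep s T b"
  by (simp add: coker_carrier_iff)

lemma rep_res: "rep s T b \<Longrightarrow> zopen m T' \<Longrightarrow> T' \<subseteq> T \<Longrightarrow> rep s T' (res B T T' b)"
  unfolding rep_def using germ_res[of T T'] by (auto simp: B.res_closed)

lemma rep_restrict: "rep s T b \<Longrightarrow> T \<subseteq> U \<Longrightarrow> rep (restrict s U) T b"
  unfolding rep_def by auto

lemma rep_common:
  assumes "s \<in> secs CK U" "t \<in> secs CK U" "L \<in> U"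
  obtains T b c where "zopen m T" "L \<in> T" "T \<subseteq> U" "rep s T b" "rep t T c"
proof -
  from coker_rep[OF assms(1,3)] coker_rep[OF assms(2,3)] obtain T b T' c where
    *: "L \<in> T" "T \<subseteq> U" "rep s T b" "L \<in> T'" "T' \<subseteq> U" "rep t T' c" by (elim exE conjE)
  have "zopen m (T \<inter> T')" using * by (auto simp: rep_def)
  then show ?thesis
    using that[of "T \<inter> T'"] rep_res[OF *(3), of "T \<inter> T'"] rep_res[OF *(6), of "T \<inter> T'"] * by auto
qed

lemma rep_add:
  assumes "rep s T b" "rep t T c" "T \<subseteq> U"
  shows "rep (s \<oplus>\<^bsub>sect CK U\<^esub> t) T (b \<oplus>\<^bsub>sect B T\<^esub> c)"
proof -
  have "(s \<oplus>\<^bsub>sect CK U\<^esub> t) M = germ M T (b \<oplus>\<^bsub>sect B T\<^esub> c)" if "M \<in> T" for M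
    using germ_add[of T T M b c] that assms unfolding rep_def sect_coker
    by (auto simp: B.res_self)
  then show ?thesis using assms by (auto simp: rep_def B.add_closed)
qed

lemma rep_smult:
  assumes "rep s T b" "T \<subseteq> U" "zopen m U" "r \<in> osect m 0 U"
  shows "rep (r \<odot>\<^bsub>sect CK U\<^esub> s) T (ores T r \<odot>\<^bsub>sect B T\<^esub> b)"
proof -
  have "U \<inter> T = T" using assms by auto
  then have "(r \<odot>\<^bsub>sect CK U\<^esub> s) M = germ M T (ores T r \<odot>\<^bsub>sect B T\<^esub> b)" if "M \<in> T" for M
    using germ_smult[of T U M b r] that assms unfolding rep_def sect_coker
    by (auto simp: B.res_self)
  then show ?thesis using assms by (auto simp: rep_def intro!: B.smult_closed osect_ores[of m T U])
qed

lemma rep_proj: "zopen m U \<Longrightarrow> b \<in> secs B U \<Longrightarrow> rep (coker_proj m A B \<phi> U b) U b"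
  by (simp add: rep_def coker_proj_def)

lemma coker_zero: "\<zero>\<^bsub>sect CK U\<^esub> = coker_proj m A B \<phi> U \<zero>\<^bsub>sect B U\<^esub>"
  by (simp add: sect_coker coker_proj_def)

lemma proj_closed: "zopen m U \<Longrightarrow> b \<in> secs B U \<Longrightarrow> coker_proj m A B \<phi> U b \<in> secs CK U"
  unfolding coker_carrier_iff using rep_proj[of U b] by (auto simp: coker_proj_def)

lemma coker_closed: "mod_closed m CK"
proof
  fix U assume U: "zopen m U"
  show "\<zero>\<^bsub>sect CK U\<^esub> \<in> secs CK U"
    unfolding coker_zero by (rule proj_closed[OF U B.zero_closed[OF U]])
  fix s assume s: "s \<in> secs CK U"
  show "s \<oplus>\<^bsub>sect CK U\<^esub> t \<in> secs CK U" if t: "t \<in> secs CK U" for t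
    unfolding coker_carrier_iff
  proof (intro conjI ballI)
    show "s \<oplus>\<^bsub>sect CK U\<^esub> t \<in> extensional U" by (simp add: sect_coker)
    fix L assume "L \<in> U"
    with s t obtain T b c where *: "zopen m T" "L \<in> T" "T \<subseteq> U" "rep s T b" "rep t T c" by (rule rep_common)
    show "\<exists>T b. L \<in> T \<and> T \<subseteq> U \<and> rep (s \<oplus>\<^bsub>sect CK U\<^esub> t) T b"
      by (intro exI conjI, rule *, rule *, rule rep_add[OF *(4,5,3)])
  qed
  show "r \<odot>\<^bsub>sect CK U\<^esub> s \<in> secs CK U" if r: "r \<in> osect m 0 U" for r
    unfolding coker_carrier_iff
  proof (intro conjI ballI)
    show "r \<odot>\<^bsub>sect CK U\<^esub> s \<in> extensional U" by (simp add: sect_coker)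
    fix L assume "L \<in> U"
    with s s obtain T b c where *: "zopen m T" "L \<in> T" "T \<subseteq> U" "rep s T b" "rep s T c" by (rule rep_common)
    show "\<exists>T b. L \<in> T \<and> T \<subseteq> U \<and> rep (r \<odot>\<^bsub>sect CK U\<^esub> s) T b"
      by (intro exI conjI, rule *, rule *, rule rep_smult[OF *(4,3) U r])
  qed
  show "res CK U T s \<in> secs CK T" if T: "zopen m T" "T \<subseteq> U" for T
    unfolding coker_carrier_iff
  proof (intro conjI ballI)
    show "res CK U T s \<in> extensional T" by (simp add: sect_coker)
    fix L assume L: "L \<in> T"
    then have "L \<in> U" using T by auto
    with s s obtain S b c where S: "zopen m S" "L \<in> S" "S \<subseteq> U" "rep s S b" "rep s S c" by (rule rep_common)
    then have "rep (restrict s T) (S \<inter> T) (res B S (S \<inter> T) b)"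
      using T by (intro rep_restrict rep_res) auto
    then show "\<exists>T' b. L \<in> T' \<and> T' \<subseteq> T \<and> rep (res CK U T s) T' b"
      unfolding sect_coker using S L by (intro exI[of _ "S \<inter> T"]) auto
  qed
qed

lemma coker_proj_hom: "sheaf_hom m B CK (coker_proj m A B \<phi>)"
proof (rule sheaf_homI)
  let ?p = "coker_proj m A B \<phi>"
  fix U assume U: "zopen m U"
  have ext: "s = t" if "s \<in> extensional U" "t \<in> extensional U" "rep s U b" "rep t U b" for s t b
    using that by (intro extensionalityI[of s U t]) (auto simp: rep_def)
  fix s assume s: "s \<in> secs B U"
  show "?p U s \<in> secs CK U" using U s by (rule proj_closed)
  show "?p U (s \<oplus>\<^bsub>sect B U\<^esub> t) = ?p U s \<oplus>\<^bsub>sect CK U\<^esub> ?p U t" if t: "t \<in> secs B U" for t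
    by (rule ext[OF _ _ rep_proj rep_add[OF rep_proj rep_proj]])
      (use U s t in \<open>auto simp: sect_coker coker_proj_def B.add_closed\<close>)
  show "?p U (r \<odot>\<^bsub>sect B U\<^esub> s) = r \<odot>\<^bsub>sect CK U\<^esub> ?p U s" if r: "r \<in> osect m 0 U" for r
  proof -
    have *: "rep (r \<odot>\<^bsub>sect CK U\<^esub> ?p U s) U (r \<odot>\<^bsub>sect B U\<^esub> s)"
      using rep_smult[OF rep_proj[OF U s] order_refl U r] ores_ident[OF r] by simp
    show ?thesis
      by (rule ext[OF _ _ rep_proj *]) (use U s r in \<open>auto simp: sect_coker coker_proj_def B.smult_closed\<close>)
  qed
  show "res CK U T (?p U s) = ?p T (res B U T s)" if T: "zopen m T" "T \<subseteq> U" for T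
    using germ_res[of U T] U T s by (auto simp: sect_coker coker_proj_def fun_eq_iff subset_iff)
qed

lemma proj_eq_iff:
  assumes "zopen m U" "b \<in> secs B U" "c \<in> secs B U"
  shows "coker_proj m A B \<phi> U b = coker_proj m A B \<phi> U c \<longleftrightarrow> (\<forall>L\<in>U. congruent L U b U c)"
proof
  assume eq: "coker_proj m A B \<phi> U b = coker_proj m A B \<phi> U c"
  show "\<forall>L\<in>U. congruent L U b U c"
  proof
    fix L assume L: "L \<in> U"
    from fun_cong[OF eq, of L] L have "germ L U b = germ L U c" by (simp add: coker_proj_def)
    then show "congruent L U b U c" using assms L by (intro germ_eqD) auto
  qed
next
  assume "\<forall>L\<in>U. congruent L U b U c"
  then show "coker_proj m A B \<phi> U b = coker_proj m A B \<phi> U c"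
    unfolding coker_proj_def using assms by (intro restrict_ext germ_eqI) auto
qed

text \<open>Two germs agree when representatives differ by an image, so vanishing of the class is
  local membership in the image of \<open>\<phi>\<close>. This has the shape of
  \<open>im_sect\<close> and yields exactness in the middle.\<close>

lemma proj_eq_zero_iff:
  assumes "zopen m U" "b \<in> secs B U"
  shows "coker_proj m A B \<phi> U b = \<zero>\<^bsub>sect CK U\<^esub> \<longleftrightarrow>
    (\<forall>L\<in>U. \<exists>T. zopen m T \<and> L \<in> T \<and> T \<subseteq> U \<and> res B U T b \<in> \<phi> T ` secs A T)"
proof -
  have "congruent L U \<zero>\<^bsub>sect B U\<^esub> U b \<longleftrightarrow>
    (\<exists>T. zopen m T \<and> L \<in> T \<and> T \<subseteq> U \<and> res B U T b \<in> \<phi> T ` secs A T)" for L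
  proof -
    have "(\<exists>a\<in>secs A T. res B U T b = res B U T \<zero>\<^bsub>sect B U\<^esub> \<oplus>\<^bsub>sect B T\<^esub> \<phi> T a) \<longleftrightarrow>
      res B U T b \<in> \<phi> T ` secs A T" if "zopen m T" "T \<subseteq> U" for T
      using that assms by (auto simp: B.res_zero B.zero_add hom_closed)
    then show ?thesis by (simp add: congruent_def cong: conj_cong)
  qed
  moreover have "coker_proj m A B \<phi> U b = \<zero>\<^bsub>sect CK U\<^esub> \<longleftrightarrow>
    coker_proj m A B \<phi> U \<zero>\<^bsub>sect B U\<^esub> = coker_proj m A B \<phi> U b" unfolding coker_zero by auto
  ultimately show ?thesis
    using proj_eq_iff[OF assms(1) B.zero_closed[OF assms(1)] assms(2)] by simp
qed

end

text \<open>The target has to be a sheaf because the induced map is obtained by gluing the values of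
  \<open>\<psi>\<close> on local representatives.\<close>

locale coker_factor = coker m A B \<phi> + C: sheaf_mod m C
  for m A B \<phi> and C :: "'u mod_sheaf" +
  fixes \<psi>
  assumes psi_hom: "sheaf_hom m B C \<psi>"
    and psi_phi: "\<And>U a. zopen m U \<Longrightarrow> a \<in> secs A U \<Longrightarrow> \<psi> U (\<phi> U a) = \<zero>\<^bsub>sect C U\<^esub>"
begin

abbreviation lift :: "pset \<Rightarrow> (cvec set \<Rightarrow> (pset \<times> 'b) set) \<Rightarrow> 'u" where
  "lift \<equiv> coker_lift m A B \<phi> C \<psi>"

lemma congruent_psi:
  assumes "congruent L U b V c" "zopen m U" "zopen m V" "b \<in> secs B U" "c \<in> secs B V"
  obtains T where "zopen m T" "L \<in> T" "T \<subseteq> U" "T \<subseteq> V" "res C V T (\<psi> V c) = res C U T (\<psi> U b)"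
proof -
  from assms(1) obtain T a where T: "zopen m T" "L \<in> T" "T \<subseteq> U" "T \<subseteq> V" "a \<in> secs A T"
    "res B V T c = res B U T b \<oplus>\<^bsub>sect B T\<^esub> \<phi> T a" by (rule congruentE)
  have "res C V T (\<psi> V c) = res C U T (\<psi> U b)"
    using T assms(2-) sheaf_homD[OF psi_hom]
    by (simp add: psi_phi hom_closed B.res_closed C.add_zero)
  with T show ?thesis using that by blast
qed

text \<open>Makes the definite description in \<open>coker_lift\<close> meaningful. Representatives
  with equal germs differ locally by an image of \<open>\<phi>\<close>, which \<open>\<psi>\<close>
  kills; separatedness spreads the agreement over the overlaps and gluing gives the section. It is
  unique because the representatives cover \<open>U\<close>.\<close>

lemma lift_ex1:
  assumes U: "zopen m U" and s: "s \<in> secs CK U"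
  shows "\<exists>!c. c \<in> secs C U \<and> (\<forall>T b. zopen m T \<and> T \<subseteq> U \<and> b \<in> secs B T \<and>
        (\<forall>L\<in>T. s L = germ L T b) \<longrightarrow> res C U T c = \<psi> T b)"
proof -
  let ?G = "{(T, \<psi> T b) |T b. T \<subseteq> U \<and> rep s T b}"
  have "\<exists>c\<in>secs C U. \<forall>(T, d)\<in>?G. res C U T c = d"
  proof (rule C.glue[OF U])
    show "zopen m T \<and> T \<subseteq> U \<and> d \<in> secs C T" if "(T, d) \<in> ?G" for T d
      using that sheaf_homD(1)[OF psi_hom] by (auto simp: rep_def)
    show "\<exists>T d. (T, d) \<in> ?G \<and> L \<in> T" if L: "L \<in> U" for L
      using coker_rep[OF s L] by blast
    fix T d T' d' assume "(T, d) \<in> ?G" "(T', d') \<in> ?G"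
    then obtain b b' where b: "T \<subseteq> U" "T' \<subseteq> U" "rep s T b" "rep s T' b'" "d = \<psi> T b" "d' = \<psi> T' b'" by blast
    have o: "zopen m T" "zopen m T'" "zopen m (T \<inter> T')" "b \<in> secs B T" "b' \<in> secs B T'"
      using b by (auto simp: rep_def)
    note [simp] = sheaf_homD(1)[OF psi_hom]
    show "res C T (T \<inter> T') d = res C T' (T \<inter> T') d'"
    proof (rule C.separated[OF o(3)])
      show "res C T (T \<inter> T') d \<in> secs C (T \<inter> T')" "res C T' (T \<inter> T') d' \<in> secs C (T \<inter> T')"
        using b o by (auto intro!: C.res_closed)
      fix L assume L: "L \<in> T \<inter> T'"
      then have "germ L T' b' = germ L T b" using b by (auto simp: rep_def)
      then have "congruent L T' b' T b" using L o by (intro germ_eqD) auto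
      then obtain S where S: "zopen m S" "L \<in> S" "S \<subseteq> T'" "S \<subseteq> T" "res C T S (\<psi> T b) = res C T' S (\<psi> T' b')"
        using o(2,1,5,4) by (rule congruent_psi)
      then have "res C (T \<inter> T') S (res C T (T \<inter> T') d) = res C (T \<inter> T') S (res C T' (T \<inter> T') d')"
        using o by (simp add: b C.res_res)
      with S show "\<exists>S. zopen m S \<and> L \<in> S \<and> S \<subseteq> T \<inter> T' \<and>
         res C (T \<inter> T') S (res C T (T \<inter> T') d) = res C (T \<inter> T') S (res C T' (T \<inter> T') d')" by blast
    qed
  qed
  then obtain c where c0: "c \<in> secs C U" "\<forall>(T, d)\<in>?G. res C U T c = d" by blast
  have c: "c \<in> secs C U" "\<And>T b. T \<subseteq> U \<Longrightarrow> rep s T b \<Longrightarrow> res C U T c = \<psi> T b"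
    using c0 by auto
  show ?thesis
  proof (rule ex1I)
    show "c \<in> secs C U \<and> (\<forall>T b. zopen m T \<and> T \<subseteq> U \<and> b \<in> secs B T \<and>
        (\<forall>L\<in>T. s L = germ L T b) \<longrightarrow> res C U T c = \<psi> T b)" using c by (auto simp: rep_def)
    fix c' assume c': "c' \<in> secs C U \<and> (\<forall>T b. zopen m T \<and> T \<subseteq> U \<and> b \<in> secs B T \<and>
        (\<forall>L\<in>T. s L = germ L T b) \<longrightarrow> res C U T c' = \<psi> T b)"
    show "c' = c"
    proof (rule C.separated[OF U])
      show "c' \<in> secs C U" "c \<in> secs C U" using c c' by auto
      fix L assume "L \<in> U"
      then obtain T b where T: "L \<in> T" "T \<subseteq> U" "rep s T b" using coker_rep[OF s] by blast
      then have "res C U T c' = \<psi> T b" using c' by (auto simp: rep_def)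
      then have "res C U T c' = res C U T c" using c(2)[OF T(2,3)] by simp
      then show "\<exists>T. zopen m T \<and> L \<in> T \<and> T \<subseteq> U \<and> res C U T c' = res C U T c" using T by (auto simp: rep_def)
    qed
  qed
qed

lemma lift_closed: "zopen m U \<Longrightarrow> s \<in> secs CK U \<Longrightarrow> lift U s \<in> secs C U"
  unfolding coker_lift_def by (rule conjunct1[OF theI'[OF lift_ex1]])

lemma lift_rep: "zopen m U \<Longrightarrow> s \<in> secs CK U \<Longrightarrow> T \<subseteq> U \<Longrightarrow> rep s T b \<Longrightarrow> res C U T (lift U s) = \<psi> T b"
  using conjunct2[OF theI'[OF lift_ex1, of U s]] unfolding coker_lift_def rep_def by simp

lemma lift_eqI:
  assumes "zopen m U" "s \<in> secs CK U" "c \<in> secs C U"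
    and "\<And>L. L \<in> U \<Longrightarrow> \<exists>T b. L \<in> T \<and> T \<subseteq> U \<and> rep s T b \<and> res C U T c = \<psi> T b"
  shows "lift U s = c"
proof (rule C.separated[OF assms(1) lift_closed[OF assms(1,2)] assms(3)])
  fix L assume "L \<in> U"
  then obtain T b where T: "L \<in> T" "T \<subseteq> U" "rep s T b" "res C U T c = \<psi> T b" using assms(4) by blast
  then have "res C U T (lift U s) = res C U T c" using lift_rep[OF assms(1,2)] by simp
  with T show "\<exists>T. zopen m T \<and> L \<in> T \<and> T \<subseteq> U \<and> res C U T (lift U s) = res C U T c" by (auto simp: rep_def)
qed

lemma lift_hom: "sheaf_hom m CK C lift"
proof (rule sheaf_homI)
  interpret CK: mod_closed m CK by (rule coker_closed)
  fix U assume U: "zopen m U"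
  fix s assume s: "s \<in> secs CK U"
  show "lift U s \<in> secs C U" using U s by (rule lift_closed)
  show "lift U (s \<oplus>\<^bsub>sect CK U\<^esub> t) = lift U s \<oplus>\<^bsub>sect C U\<^esub> lift U t" if t: "t \<in> secs CK U" for t
  proof (rule lift_eqI[OF U])
    show "s \<oplus>\<^bsub>sect CK U\<^esub> t \<in> secs CK U" using U s t by (rule CK.add_closed)
    show "lift U s \<oplus>\<^bsub>sect C U\<^esub> lift U t \<in> secs C U" using U s t by (simp add: C.add_closed lift_closed)
    fix L assume "L \<in> U"
    with s t obtain T b c where T: "zopen m T" "L \<in> T" "T \<subseteq> U" "rep s T b" "rep t T c" by (rule rep_common)
    have bc: "b \<in> secs B T" "c \<in> secs B T" using T by (auto simp: rep_def)
    have "res C U T (lift U s \<oplus>\<^bsub>sect C U\<^esub> lift U t) = \<psi> T (b \<oplus>\<^bsub>sect B T\<^esub> c)"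
      using U s t T bc by (simp add: C.res_add lift_closed lift_rep sheaf_homD(2)[OF psi_hom])
    then show "\<exists>T b. L \<in> T \<and> T \<subseteq> U \<and> rep (s \<oplus>\<^bsub>sect CK U\<^esub> t) T b \<and>
        res C U T (lift U s \<oplus>\<^bsub>sect C U\<^esub> lift U t) = \<psi> T b"
      using T rep_add[OF T(4,5,3)] by (intro exI[of _ T] exI[of _ "b \<oplus>\<^bsub>sect B T\<^esub> c"]) simp
  qed
  show "lift U (r \<odot>\<^bsub>sect CK U\<^esub> s) = r \<odot>\<^bsub>sect C U\<^esub> lift U s" if r: "r \<in> osect m 0 U" for r
  proof (rule lift_eqI[OF U])
    show "r \<odot>\<^bsub>sect CK U\<^esub> s \<in> secs CK U" using U r s by (rule CK.smult_closed)
    show "r \<odot>\<^bsub>sect C U\<^esub> lift U s \<in> secs C U" using U s r by (simp add: C.smult_closed lift_closed)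
    fix L assume "L \<in> U"
    with s s obtain T b c where T: "zopen m T" "L \<in> T" "T \<subseteq> U" "rep s T b" "rep s T c" by (rule rep_common)
    have b: "b \<in> secs B T" using T by (auto simp: rep_def)
    have "res C U T (r \<odot>\<^bsub>sect C U\<^esub> lift U s) = \<psi> T (ores T r \<odot>\<^bsub>sect B T\<^esub> b)"
      using U s r T b lift_rep[OF U s T(3,4)] by (simp add: C.res_smult lift_closed sheaf_homD(3)[OF psi_hom] osect_ores[of m T U])
    then show "\<exists>T b. L \<in> T \<and> T \<subseteq> U \<and> rep (r \<odot>\<^bsub>sect CK U\<^esub> s) T b \<and>
        res C U T (r \<odot>\<^bsub>sect C U\<^esub> lift U s) = \<psi> T b"
      using T rep_smult[OF T(4,3) U r] by (intro exI[of _ T] exI[of _ "ores T r \<odot>\<^bsub>sect B T\<^esub> b"]) simp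
  qed
  show "res C U T (lift U s) = lift T (res CK U T s)" if T: "zopen m T" "T \<subseteq> U" for T
  proof (rule lift_eqI[OF T(1), symmetric])
    show "res CK U T s \<in> secs CK T" using U T s by (rule CK.res_closed)
    show "res C U T (lift U s) \<in> secs C T" using U T s by (simp add: C.res_closed lift_closed)
    fix L assume L: "L \<in> T"
    then have "L \<in> U" using T by auto
    with s s obtain S b c where S: "zopen m S" "L \<in> S" "S \<subseteq> U" "rep s S b" "rep s S c" by (rule rep_common)
    have TS: "zopen m (S \<inter> T)" using T S by auto
    have rp: "rep s (S \<inter> T) (res B S (S \<inter> T) b)" using S TS by (intro rep_res) auto
    then have "res C T (S \<inter> T) (res C U T (lift U s)) = \<psi> (S \<inter> T) (res B S (S \<inter> T) b)"
      using lift_rep[OF U s _ rp] T TS S U s by (simp add: C.res_res lift_closed le_infI1)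
    moreover have "rep (res CK U T s) (S \<inter> T) (res B S (S \<inter> T) b)"
      unfolding sect_coker using rp by (rule rep_restrict) auto
    ultimately show "\<exists>T' b. L \<in> T' \<and> T' \<subseteq> T \<and> rep (res CK U T s) T' b \<and>
        res C T T' (res C U T (lift U s)) = \<psi> T' b" using S L by (intro exI[of _ "S \<inter> T"] exI[of _ "res B S (S \<inter> T) b"]) auto
  qed
qed

text \<open>Uniqueness of the induced map: \<open>\<kappa>\<close> after the lift has the prescribed
  values on representatives. In this way \<open>corr_map\<close> and \<open>wedge_map\<close> are
  both read off from one lift.\<close>

lemma lift_compose:
  assumes "coker_factor m A B \<phi> C' \<psi>'" "sheaf_hom m C C' \<kappa>"
    and eq: "\<And>U b. zopen m U \<Longrightarrow> b \<in> secs B U \<Longrightarrow> \<psi>' U b = \<kappa> U (\<psi> U b)"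
    and U: "zopen m U" and s: "s \<in> secs CK U"
  shows "coker_lift m A B \<phi> C' \<psi>' U s = \<kappa> U (lift U s)"
proof -
  show ?thesis
  proof (rule coker_factor.lift_eqI[OF assms(1) U s sheaf_homD(1)[OF assms(2) U lift_closed[OF U s]]])
    fix L assume L: "L \<in> U"
    with s s obtain T b c where T: "zopen m T" "L \<in> T" "T \<subseteq> U" "rep s T b" "rep s T c" by (rule rep_common)
    have "res C' U T (\<kappa> U (lift U s)) = \<kappa> T (res C U T (lift U s))"
      using sheaf_homD(4)[OF assms(2) U T(1,3) lift_closed[OF U s]] .
    also have "\<dots> = \<psi>' T b" using lift_rep[OF U s T(3,4)] eq[OF T(1), of b] T(4) by (simp add: rep_def)
    finally show "\<exists>T b. L \<in> T \<and> T \<subseteq> U \<and> rep s T b \<and> res C' U T (\<kappa> U (lift U s)) = \<psi>' T b"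
      using T by (intro exI[of _ T] exI[of _ b]) simp
  qed
qed

end

section \<open>The exact sequence attached to a complement of an image\<close>

context coker
begin

text \<open>The abstract core of the proof. With \<open>Y\<close> embedded in \<open>B\<close> and
  \<open>A'\<close> the preimage of \<open>Y\<close> under the injective \<open>\<phi>\<close>, the
  sheaf \<open>A'\<close> plays the role of the intersection of \<open>Y\<close> with the image of
  \<open>A\<close>. The assumption \<open>decomp\<close> says that the two together span
  \<open>B\<close> locally, so \<open>Y\<close> modulo \<open>A'\<close> is the whole cokernel. The
  first map is well defined by \<open>inv_into\<close> because \<open>A'\<close> is mapped into the
  image of the injective \<open>\<iota>\<close>.\<close>

lemma short_exact_coker:
  fixes Y :: "'y mod_sheaf" and A' :: "'s mod_sheaf"
  assumes "mod_presheaf m Y" and i_hom: "sheaf_hom m Y B \<iota>"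
    and i_inj: "\<And>U. zopen m U \<Longrightarrow> inj_on (\<iota> U) (secs Y U)"
    and A': "\<And>U. zopen m U \<Longrightarrow> secs A' U =
        {s \<in> secs A U. \<phi> U s \<in> \<iota> U ` secs Y U}"
      "\<And>U. \<zero>\<^bsub>sect A' U\<^esub> = \<zero>\<^bsub>sect A U\<^esub>"
      "\<And>U s t. s \<oplus>\<^bsub>sect A' U\<^esub> t = s \<oplus>\<^bsub>sect A U\<^esub> t"
      "\<And>U r s. r \<odot>\<^bsub>sect A' U\<^esub> s = r \<odot>\<^bsub>sect A U\<^esub> s"
      "\<And>U T s. res A' U T s = res A U T s"
    and phi_zero: "\<And>U. zopen m U \<Longrightarrow> \<phi> U \<zero>\<^bsub>sect A U\<^esub> = \<zero>\<^bsub>sect B U\<^esub>"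
    and phi_ker: "\<And>U s. zopen m U \<Longrightarrow> s \<in> secs A U \<Longrightarrow> \<phi> U s = \<zero>\<^bsub>sect B U\<^esub> \<Longrightarrow> s = \<zero>\<^bsub>sect A U\<^esub>"
    and decomp: "\<And>U b L. zopen m U \<Longrightarrow> b \<in> secs B U \<Longrightarrow> L \<in> U \<Longrightarrow>
      \<exists>T a h. zopen m T \<and> L \<in> T \<and> T \<subseteq> U \<and> a \<in> secs A T \<and> h \<in> secs Y T \<and>
        res B U T b = \<iota> T h \<oplus>\<^bsub>sect B T\<^esub> \<phi> T a"
  shows "short_exact m A' Y CK (\<lambda>U s. inv_into (secs Y U) (\<iota> U) (\<phi> U s))
      (\<lambda>U h. coker_proj m A B \<phi> U (\<iota> U h))"
    and "\<And>U s. zopen m U \<Longrightarrow> s \<in> secs A' U \<Longrightarrow>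
      \<iota> U (inv_into (secs Y U) (\<iota> U) (\<phi> U s)) = \<phi> U s"
proof -
  interpret Y: mod_presheaf m Y by fact
  let ?f = "\<lambda>U s. inv_into (secs Y U) (\<iota> U) (\<phi> U s)"
  let ?p = "\<lambda>U h. coker_proj m A B \<phi> U (\<iota> U h)"
  note i = sheaf_homD[OF i_hom]
  have AA: "s \<in> secs A U" if "zopen m U" "s \<in> secs A' U" for U s
    using that by (simp add: A'(1))
  have f: "?f U s \<in> secs Y U" "\<iota> U (?f U s) = \<phi> U s"
    if "zopen m U" "s \<in> secs A' U" for U s
    using that by (auto simp: A'(1) inv_into_into f_inv_into_f)
  then show "\<And>U s. zopen m U \<Longrightarrow> s \<in> secs A' U \<Longrightarrow> \<iota> U (?f U s) = \<phi> U s" by blast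
  have f_eq: "?f U s = h" if "zopen m U" "h \<in> secs Y U" "\<phi> U s = \<iota> U h" for U s h
    using that i_inj[OF that(1)] by simp
  have i_zero: "\<iota> U \<zero>\<^bsub>sect Y U\<^esub> = \<zero>\<^bsub>sect B U\<^esub>" if "zopen m U" for U
    by (rule sheaf_hom_zero[OF i_hom Y.mod_presheaf_axioms B.mod_presheaf_axioms that])
  have f_hom: "sheaf_hom m A' Y ?f"
  proof (rule sheaf_homI)
    fix U assume U: "zopen m U"
    fix s assume s: "s \<in> secs A' U"
    show "?f U s \<in> secs Y U" by (rule f[OF U s])
    show "?f U (s \<oplus>\<^bsub>sect A' U\<^esub> t) = ?f U s \<oplus>\<^bsub>sect Y U\<^esub> ?f U t" if t: "t \<in> secs A' U" for t
    proof (rule f_eq[OF U])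
      show "?f U s \<oplus>\<^bsub>sect Y U\<^esub> ?f U t \<in> secs Y U"
        by (rule Y.add_closed[OF U f(1)[OF U s] f(1)[OF U t]])
      show "\<phi> U (s \<oplus>\<^bsub>sect A' U\<^esub> t) = \<iota> U (?f U s \<oplus>\<^bsub>sect Y U\<^esub> ?f U t)"
        by (simp only: A'(3) hom_add[OF U AA[OF U s] AA[OF U t]] i(2)[OF U f(1)[OF U s] f(1)[OF U t]]
            f(2)[OF U s] f(2)[OF U t])
    qed
    show "?f U (r \<odot>\<^bsub>sect A' U\<^esub> s) = r \<odot>\<^bsub>sect Y U\<^esub> ?f U s" if r: "r \<in> osect m 0 U" for r
    proof (rule f_eq[OF U])
      show "r \<odot>\<^bsub>sect Y U\<^esub> ?f U s \<in> secs Y U"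
        by (rule Y.smult_closed[OF U r f(1)[OF U s]])
      show "\<phi> U (r \<odot>\<^bsub>sect A' U\<^esub> s) = \<iota> U (r \<odot>\<^bsub>sect Y U\<^esub> ?f U s)"
        by (simp only: A'(4) hom_smult[OF U r AA[OF U s]] i(3)[OF U r f(1)[OF U s]] f(2)[OF U s])
    qed
    show "res Y U T (?f U s) = ?f T (res A' U T s)" if T: "zopen m T" "T \<subseteq> U" for T
    proof (rule f_eq[OF T(1), symmetric])
      show "res Y U T (?f U s) \<in> secs Y T" by (rule Y.res_closed[OF U T f(1)[OF U s]])
      have "\<iota> T (res Y U T (?f U s)) = res B U T (\<iota> U (?f U s))"
        by (rule i(4)[OF U T f(1)[OF U s], symmetric])
      also have "\<dots> = \<phi> T (res A U T s)" unfolding f(2)[OF U s] by (rule hom_res[OF U T AA[OF U s]])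
      finally show "\<phi> T (res A' U T s) = \<iota> T (res Y U T (?f U s))" by (simp add: A')
    qed
  qed
  have p_hom: "sheaf_hom m Y CK ?p" by (rule sheaf_hom_compose[OF i_hom coker_proj_hom])
  have "ker_sect A' Y ?f U = {\<zero>\<^bsub>sect A' U\<^esub>}" if U: "zopen m U" for U
  proof (intro Set.set_eqI iffI)
    fix s assume "s \<in> ker_sect A' Y ?f U"
    then have s: "s \<in> secs A' U" "?f U s = \<zero>\<^bsub>sect Y U\<^esub>" by (auto simp: ker_sect_def)
    then have "\<phi> U s = \<zero>\<^bsub>sect B U\<^esub>" using f(2)[OF U s(1)] i_zero[OF U] by simp
    then show "s \<in> {\<zero>\<^bsub>sect A' U\<^esub>}" using phi_ker[OF U AA[OF U s(1)]] by (simp add: A')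
  next
    fix s assume "s \<in> {\<zero>\<^bsub>sect A' U\<^esub>}"
    then have s: "s = \<zero>\<^bsub>sect A U\<^esub>" by (simp add: A')
    have z: "\<phi> U s = \<iota> U \<zero>\<^bsub>sect Y U\<^esub>" using phi_zero[OF U] i_zero[OF U] s by simp
    then have "s \<in> secs A' U"
      unfolding A'(1)[OF U] using s A.zero_closed[OF U] Y.zero_closed[OF U] by auto
    moreover have "?f U s = \<zero>\<^bsub>sect Y U\<^esub>" by (rule f_eq[OF U Y.zero_closed[OF U] z])
    ultimately show "s \<in> ker_sect A' Y ?f U" by (simp add: ker_sect_def)
  qed
  moreover have "ker_sect Y CK ?p U = im_sect m A' Y ?f U" if U: "zopen m U" for U
  proof -
    \<comment> \<open>A preimage under \<open>\<phi>\<close> of something coming from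
      \<open>Y\<close> lies in \<open>A'\<close> by the description of its sections, so being an
      image can be tested in \<open>B\<close> or in \<open>Y\<close> alike.\<close>
    have "res B U T (\<iota> U t) \<in> \<phi> T ` secs A T \<longleftrightarrow> res Y U T t \<in> ?f T ` secs A' T"
      if t: "t \<in> secs Y U" and T: "zopen m T" "T \<subseteq> U" for t T
    proof -
      have rt: "res B U T (\<iota> U t) = \<iota> T (res Y U T t)" by (rule i(4)[OF U T t])
      have rc: "res Y U T t \<in> secs Y T" by (rule Y.res_closed[OF U T t])
      show ?thesis
      proof
        assume "res B U T (\<iota> U t) \<in> \<phi> T ` secs A T"
        then obtain a where a: "a \<in> secs A T" "\<phi> T a = \<iota> T (res Y U T t)" using rt by auto
        then have "a \<in> secs A' T" unfolding A'(1)[OF T(1)] using rc by auto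
        moreover have "?f T a = res Y U T t" by (rule f_eq[OF T(1) rc a(2)])
        ultimately show "res Y U T t \<in> ?f T ` secs A' T" by (metis (no_types, lifting) imageI)
      next
        assume "res Y U T t \<in> ?f T ` secs A' T"
        then obtain a where a: "a \<in> secs A' T" "res Y U T t = ?f T a" by blast
        then have "res B U T (\<iota> U t) = \<phi> T a" using rt f(2)[OF T(1) a(1)] by simp
        then show "res B U T (\<iota> U t) \<in> \<phi> T ` secs A T" using AA[OF T(1) a(1)] by blast
      qed
    qed
    then show ?thesis
      unfolding ker_sect_def im_sect_def
      by (intro Collect_cong conj_cong refl)
        (simp add: proj_eq_zero_iff[OF U i(1)[OF U]] cong: conj_cong)
  qed
  moreover have "im_sect m Y CK ?p U = secs CK U" if U: "zopen m U" for U
  proof -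
    have "\<exists>T. zopen m T \<and> L \<in> T \<and> T \<subseteq> U \<and> res CK U T s \<in> ?p T ` secs Y T"
      if s: "s \<in> secs CK U" and L: "L \<in> U" for s L
    proof -
      from coker_rep[OF s L] obtain T b where T: "L \<in> T" "T \<subseteq> U" "rep s T b" by blast
      then have Tb: "zopen m T" "b \<in> secs B T" by (auto simp: rep_def)
      \<comment> \<open>The summand from \<open>A\<close> dies in the cokernel, so
        \<open>\<iota> T' h\<close> represents the section on \<open>T'\<close>.\<close>
      from decomp[OF Tb T(1)] obtain T' a h where T': "zopen m T'" "L \<in> T'" "T' \<subseteq> T"
        "a \<in> secs A T'" "h \<in> secs Y T'"
        "res B T T' b = \<iota> T' h \<oplus>\<^bsub>sect B T'\<^esub> \<phi> T' a" by blast
      have "s M = germ M T' (\<iota> T' h)" if M: "M \<in> T'" for M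
      proof -
        have "s M = germ M T' (res B T T' b)" using rep_res[OF T(3) T'(1,3)] M by (simp add: rep_def)
        also have "\<dots> = germ M T' (\<iota> T' h)"
        proof (rule germ_eqI[symmetric])
          show "congruent M T' (\<iota> T' h) T' (res B T T' b)"
            by (rule congruentI[OF T'(1) M order_refl order_refl T'(4)])
              (use T' Tb in \<open>simp add: B.res_self i B.add_closed hom_closed\<close>)
        qed (use T' Tb in \<open>simp_all add: i B.add_closed hom_closed\<close>)
        finally show ?thesis .
      qed
      then have "res CK U T' s = ?p T' h" by (simp add: sect_coker coker_proj_def cong: restrict_cong)
      then show ?thesis using T T' by (intro exI[of _ T']) auto
    qed
    then show ?thesis by (auto simp: im_sect_def)
  qed
  ultimately show "short_exact m A' Y CK ?f ?p"
    unfolding short_exact_def using f_hom p_hom by blast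
qed

end

section \<open>Twists\<close>

lemma sect_twist:
  "secs (twist m e F) U = {s \<in> (\<Pi>\<^sub>E i\<in>{..m}. secs F (U \<inter> chart m i)).
     \<forall>i\<le>m. \<forall>j\<le>m. res F (U \<inter> chart m j) (U \<inter> chart m i \<inter> chart m j) (s j) =
       ores (U \<inter> chart m i \<inter> chart m j) (\<lambda>x. (x i / x j) powi e)
         \<odot>\<^bsub>sect F (U \<inter> chart m i \<inter> chart m j)\<^esub>
       res F (U \<inter> chart m i) (U \<inter> chart m i \<inter> chart m j) (s i)}"
  "\<zero>\<^bsub>sect (twist m e F) U\<^esub> = (\<lambda>i\<in>{..m}. \<zero>\<^bsub>sect F (U \<inter> chart m i)\<^esub>)"
  "s \<oplus>\<^bsub>sect (twist m e F) U\<^esub> t = (\<lambda>i\<in>{..m}. s i \<oplus>\<^bsub>sect F (U \<inter> chart m i)\<^esub> t i)"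
  "r \<odot>\<^bsub>sect (twist m e F) U\<^esub> s =
     (\<lambda>i\<in>{..m}. ores (U \<inter> chart m i) r \<odot>\<^bsub>sect F (U \<inter> chart m i)\<^esub> s i)"
  "res (twist m e F) U T s = (\<lambda>i\<in>{..m}. res F (U \<inter> chart m i) (T \<inter> chart m i) (s i))"
  by (simp_all add: twist_def Let_def)

text \<open>These are the transition functions of \<open>O(e)\<close>: the degrees \<open>e\<close>
  and \<open>-e\<close> of numerator and denominator cancel.\<close>

lemma osect_ratio_powi:
  assumes "zopen m U" "i \<le> m" "j \<le> m" "\<And>x. x \<in> \<Union>U \<Longrightarrow> x i \<noteq> 0 \<and> x j \<noteq> 0"
  shows "ores U (\<lambda>x. (x i / x j) powi e) \<in> osect m 0 U"
proof -
  have "(\<lambda>x. ores U (\<lambda>x. x i powi e) x * ores U (\<lambda>x. x j powi (- e)) x) \<in> osect m (e + - e) U"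
    by (intro osect_mult osect_powi) (use assms in auto)
  also have "(\<lambda>x. ores U (\<lambda>x. x i powi e) x * ores U (\<lambda>x. x j powi (- e)) x) =
      ores U (\<lambda>x. (x i / x j) powi e)"
    by (auto simp: ores_def fun_eq_iff power_int_divide_distrib power_int_minus field_simps)
  finally show ?thesis by simp
qed

lemma chart_coord: "x \<in> \<Union>(U \<inter> chart m i \<inter> chart m j) \<Longrightarrow> x i \<noteq> 0 \<and> x j \<noteq> 0"
  unfolding chart_def by blast

text \<open>Even closure draws on the module laws of \<open>F\<close>: the gluing condition of a
  family survives sums by distributivity, and multiples because scalars associate and commute. This
  is the reason why the quotient bundle is first shown to be a \<open>mod_presheaf\<close>.\<close>

lemma mod_closed_twist:
  assumes "mod_presheaf m F"
  shows "mod_closed m (twist m e F)"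
proof -
  interpret F: mod_presheaf m F by fact
  let ?r = "\<lambda>U i j. ores (U \<inter> chart m i \<inter> chart m j) (\<lambda>x. (x i / x j) powi e)"
  have o: "zopen m (U \<inter> chart m i)" "zopen m (U \<inter> chart m i \<inter> chart m j)"
    if "zopen m U" "i \<le> m" "j \<le> m" for U i j
    using that openin_chart by blast+
  have sub: "U \<inter> chart m i \<inter> chart m j \<subseteq> U \<inter> chart m i" "U \<inter> chart m i \<inter> chart m j \<subseteq> U \<inter> chart m j" for U i j
    by auto
  have r: "?r U i j \<in> osect m 0 (U \<inter> chart m i \<inter> chart m j)"
    if "zopen m U" "i \<le> m" "j \<le> m" for U i j
    by (rule osect_ratio_powi[OF o(2)[OF that] that(2,3) chart_coord])
  have oo: "ores T' (ores T r) = ores T' r" if "T' \<subseteq> T" for T T' r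
    using that by (auto simp: ores_def fun_eq_iff)
  show ?thesis
  proof
    fix U assume U: "zopen m U"
    note oU = o[OF U]
    note rU = r[OF U]
    show "\<zero>\<^bsub>sect (twist m e F) U\<^esub> \<in> secs (twist m e F) U"
    proof -
      have "?r U i j \<odot>\<^bsub>sect F (U \<inter> chart m i \<inter> chart m j)\<^esub> \<zero>\<^bsub>sect F (U \<inter> chart m i \<inter> chart m j)\<^esub>
        = \<zero>\<^bsub>sect F (U \<inter> chart m i \<inter> chart m j)\<^esub>" if "i \<le> m" "j \<le> m" for i j
        using F.smult_zero_right[OF oU(2)[OF that] rU[OF that]] .
      then show ?thesis using oU sub by (simp add: sect_twist F.zero_closed F.res_zero)
    qed
    fix s assume s: "s \<in> secs (twist m e F) U"
    have sc: "s i \<in> secs F (U \<inter> chart m i)" if "i \<le> m" for i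
      using s that by (auto simp: sect_twist PiE_iff)
    have st: "res F (U \<inter> chart m j) (U \<inter> chart m i \<inter> chart m j) (s j) =
       ?r U i j \<odot>\<^bsub>sect F (U \<inter> chart m i \<inter> chart m j)\<^esub>
       res F (U \<inter> chart m i) (U \<inter> chart m i \<inter> chart m j) (s i)" if "i \<le> m" "j \<le> m" for i j
      using s that by (simp add: sect_twist)
    show "s \<oplus>\<^bsub>sect (twist m e F) U\<^esub> t \<in> secs (twist m e F) U"
      if t: "t \<in> secs (twist m e F) U" for t
    proof -
      have tc: "t i \<in> secs F (U \<inter> chart m i)" if "i \<le> m" for i
        using t that by (auto simp: sect_twist PiE_iff)
      have tt: "res F (U \<inter> chart m j) (U \<inter> chart m i \<inter> chart m j) (t j) =
         ?r U i j \<odot>\<^bsub>sect F (U \<inter> chart m i \<inter> chart m j)\<^esub>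
         res F (U \<inter> chart m i) (U \<inter> chart m i \<inter> chart m j) (t i)" if "i \<le> m" "j \<le> m" for i j
        using t that by (simp add: sect_twist)
      show ?thesis
        using oU sub sc tc rU
        by (simp add: sect_twist F.add_closed F.res_add st tt F.smult_add_right F.res_closed)
    qed
    show "q \<odot>\<^bsub>sect (twist m e F) U\<^esub> s \<in> secs (twist m e F) U" if q: "q \<in> osect m 0 U" for q
    proof -
      have qc: "ores (U \<inter> chart m i) q \<in> osect m 0 (U \<inter> chart m i)" if "i \<le> m" for i
        by (rule osect_ores[OF oU(1)[OF that that] _ q]) auto
      have qc2: "ores (U \<inter> chart m i \<inter> chart m j) q \<in> osect m 0 (U \<inter> chart m i \<inter> chart m j)"
        if "i \<le> m" "j \<le> m" for i j
        by (rule osect_ores[OF oU(2)[OF that] _ q]) auto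
      have "res F (U \<inter> chart m j) (U \<inter> chart m i \<inter> chart m j)
            (ores (U \<inter> chart m j) q \<odot>\<^bsub>sect F (U \<inter> chart m j)\<^esub> s j) =
         ?r U i j \<odot>\<^bsub>sect F (U \<inter> chart m i \<inter> chart m j)\<^esub>
         res F (U \<inter> chart m i) (U \<inter> chart m i \<inter> chart m j)
            (ores (U \<inter> chart m i) q \<odot>\<^bsub>sect F (U \<inter> chart m i)\<^esub> s i)"
        (is "?lhs = ?rhs") if ij: "i \<le> m" "j \<le> m" for i j
      proof -
        let ?T = "U \<inter> chart m i \<inter> chart m j"
        let ?s = "res F (U \<inter> chart m i) ?T (s i)"
        note oT = oU(2)[OF ij]
        have sT: "?s \<in> secs F ?T" by (rule F.res_closed[OF oU(1)[OF ij(1) ij(1)] oT sub(1) sc[OF ij(1)]])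
        have "?lhs = ores ?T (ores (U \<inter> chart m j) q) \<odot>\<^bsub>sect F ?T\<^esub> res F (U \<inter> chart m j) ?T (s j)"
          by (rule F.res_smult[OF oU(1)[OF ij(2) ij(2)] oT sub(2) qc[OF ij(2)] sc[OF ij(2)]])
        also have "\<dots> = ores ?T q \<odot>\<^bsub>sect F ?T\<^esub> (?r U i j \<odot>\<^bsub>sect F ?T\<^esub> ?s)"
          by (simp only: oo[OF sub(2)] st[OF ij])
        also have "\<dots> = (\<lambda>x. ores ?T q x * ?r U i j x) \<odot>\<^bsub>sect F ?T\<^esub> ?s"
          by (rule F.smult_assoc[OF oT qc2[OF ij] rU[OF ij] sT, symmetric])
        also have "\<dots> = (\<lambda>x. ?r U i j x * ores ?T q x) \<odot>\<^bsub>sect F ?T\<^esub> ?s" by (simp only: mult.commute)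
        also have "\<dots> = ?r U i j \<odot>\<^bsub>sect F ?T\<^esub> (ores ?T q \<odot>\<^bsub>sect F ?T\<^esub> ?s)"
          by (rule F.smult_assoc[OF oT rU[OF ij] qc2[OF ij] sT])
        also have "ores ?T q \<odot>\<^bsub>sect F ?T\<^esub> ?s = res F (U \<inter> chart m i) ?T
            (ores (U \<inter> chart m i) q \<odot>\<^bsub>sect F (U \<inter> chart m i)\<^esub> s i)"
          by (simp only: oo[OF sub(1)] F.res_smult[OF oU(1)[OF ij(1) ij(1)] oT sub(1) qc[OF ij(1)] sc[OF ij(1)]])
        finally show ?thesis .
      qed
      then show ?thesis
        using oU qc sc by (simp add: sect_twist F.smult_closed)
    qed
    show "res (twist m e F) U T s \<in> secs (twist m e F) T" if T: "zopen m T" "T \<subseteq> U" for T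
    proof -
      note oT = o[OF T(1)]
      have Tsub: "T \<inter> chart m i \<subseteq> U \<inter> chart m i" for i using T by auto
      have rc: "res F (U \<inter> chart m i) (T \<inter> chart m i) (s i) \<in> secs F (T \<inter> chart m i)" if "i \<le> m" for i
        by (rule F.res_closed[OF oU(1)[OF that that] oT(1)[OF that that] Tsub sc[OF that]])
      have "res F (T \<inter> chart m j) (T \<inter> chart m i \<inter> chart m j) (res F (U \<inter> chart m j) (T \<inter> chart m j) (s j)) =
         ?r T i j \<odot>\<^bsub>sect F (T \<inter> chart m i \<inter> chart m j)\<^esub>
         res F (T \<inter> chart m i) (T \<inter> chart m i \<inter> chart m j) (res F (U \<inter> chart m i) (T \<inter> chart m i) (s i))"
        (is "?lhs = ?rhs") if ij: "i \<le> m" "j \<le> m" for i j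
      proof -
        let ?S = "T \<inter> chart m i \<inter> chart m j" and ?V = "U \<inter> chart m i \<inter> chart m j"
        have SV: "?S \<subseteq> ?V" using T by auto
        note oS = oT(2)[OF ij] and oV = oU(2)[OF ij]
        have ci: "res F (U \<inter> chart m i) ?V (s i) \<in> secs F ?V"
          by (rule F.res_closed[OF oU(1)[OF ij(1) ij(1)] oV sub(1) sc[OF ij(1)]])
        have "?lhs = res F (U \<inter> chart m j) ?S (s j)"
          by (rule F.res_res[OF oU(1)[OF ij(2) ij(2)] oT(1)[OF ij(2) ij(2)] oS Tsub sub(2) sc[OF ij(2)]])
        also have "\<dots> = res F ?V ?S (res F (U \<inter> chart m j) ?V (s j))"
          by (rule F.res_res[OF oU(1)[OF ij(2) ij(2)] oV oS sub(2) SV sc[OF ij(2)], symmetric])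
        also have "\<dots> = ores ?S (?r U i j) \<odot>\<^bsub>sect F ?S\<^esub> res F ?V ?S (res F (U \<inter> chart m i) ?V (s i))"
          by (simp only: st[OF ij] F.res_smult[OF oV oS SV rU[OF ij] ci])
        also have "res F ?V ?S (res F (U \<inter> chart m i) ?V (s i)) = res F (U \<inter> chart m i) ?S (s i)"
          by (rule F.res_res[OF oU(1)[OF ij(1) ij(1)] oV oS sub(1) SV sc[OF ij(1)]])
        also have "\<dots> = res F (T \<inter> chart m i) ?S (res F (U \<inter> chart m i) (T \<inter> chart m i) (s i))"
          by (rule F.res_res[OF oU(1)[OF ij(1) ij(1)] oT(1)[OF ij(1) ij(1)] oS Tsub sub(1) sc[OF ij(1)], symmetric])
        finally show ?thesis by (simp only: oo[OF SV])
      qed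
      then show ?thesis using rc by (simp add: sect_twist)
    qed
  qed
qed

section \<open>The hyperplanes in the weight spaces\<close>

definition scl :: "complex \<Rightarrow> bivec \<Rightarrow> bivec" where "scl c v = (\<lambda>i. c * v i)"

lemma scl_scl: "scl a (scl b v) = scl (a * b) v"
  by (rule ext) (simp add: scl_def)

lemma scl_one: "scl 1 v = v"
  by (rule ext) (simp add: scl_def)

lemma scl_zero: "scl 0 v = 0" "scl c 0 = 0"
  by (rule ext, simp add: scl_def)+

lemma subspace_iff:
  "cfun.subspace (S :: bivec set) \<longleftrightarrow>
    0 \<in> S \<and> (\<forall>u\<in>S. \<forall>v\<in>S. u + v \<in> S) \<and> (\<forall>c. \<forall>u\<in>S. scl c u \<in> S)"
  by (simp add: cfun.subspace_def scl_def)

lemma basis_wedge_apply: "basis_wedge i j (p, q) =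
    (if p < q then (if p = i \<and> q = j then 1 else 0) - (if q = i \<and> p = j then 1 else 0) else 0)"
  by (auto simp: basis_wedge_def wedge_def unit_vec_def)

lemma basis_wedge_swap: "basis_wedge j i = scl (-1) (basis_wedge i j)"
  by (auto simp: fun_eq_iff scl_def basis_wedge_apply)

lemma basis_wedge_self: "basis_wedge i i = 0"
  by (auto simp: fun_eq_iff basis_wedge_apply)

lemma basis_wedge_nonzero: "i \<noteq> j \<Longrightarrow> basis_wedge i j \<noteq> 0"
proof
  assume "i \<noteq> j" "basis_wedge i j = 0"
  then have "basis_wedge i j (min i j, max i j) = 0" by simp
  then show False using \<open>i \<noteq> j\<close> by (auto simp: basis_wedge_apply min_def max_def split: if_splits)
qed

lemma basis_wedge_in_weight:
  assumes "i \<le> 2*n+1" "j \<le> 2*n+1" "i + j = k"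
  shows "basis_wedge i j \<in> ext2_weight n k"
proof -
  consider "i < j" | "i = j" | "j < i" by linarith
  then show ?thesis
  proof cases
    case 1 then show ?thesis unfolding ext2_weight_def using assms by (intro cfun.span_base) blast
  next
    case 2 then show ?thesis unfolding ext2_weight_def by (simp add: basis_wedge_self cfun.span_zero)
  next
    case 3
    then have "basis_wedge j i \<in> ext2_weight n k"
      unfolding ext2_weight_def using assms by (intro cfun.span_base CollectI exI[of _ j] exI[of _ i]) auto
    then show ?thesis unfolding basis_wedge_swap[of i j] ext2_weight_def scl_def by (intro cfun.span_scale)
  qed
qed

lemma unit_vec_vecs: "i \<le> m \<Longrightarrow> unit_vec i \<in> vecs m"
  by (simp add: unit_vec_def vecs_def)

lemma wedge_expand:
  assumes "u \<in> vecs m" "v \<in> vecs m"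
  shows "wedge u v = (\<lambda>pq. \<Sum>i\<le>m. \<Sum>j\<le>m. u i * v j * basis_wedge i j pq)"
proof
  fix pq :: "nat \<times> nat"
  obtain p q where pq: "pq = (p, q)" by fastforce
  show "wedge u v pq = (\<Sum>i\<le>m. \<Sum>j\<le>m. u i * v j * basis_wedge i j pq)"
  proof (cases "p < q")
    case False then show ?thesis by (simp add: pq wedge_def basis_wedge_def)
  next
    case True
    have e: "(\<Sum>j\<le>m. u j * unit_vec j i) = u i" if "u \<in> vecs m" for u :: cvec and i
      using that by (cases "i \<le> m") (auto simp: vecs_def unit_vec_def if_distrib cong: if_cong)
    have "(\<Sum>i\<le>m. \<Sum>j\<le>m. u i * v j * basis_wedge i j pq) =
      (\<Sum>i\<le>m. \<Sum>j\<le>m. (u i * unit_vec i p) * (v j * unit_vec j q)) -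
      (\<Sum>i\<le>m. \<Sum>j\<le>m. (u i * unit_vec i q) * (v j * unit_vec j p))"
      using True by (simp add: pq basis_wedge_def wedge_def algebra_simps sum_subtractf)
    also have "\<dots> = u p * v q - u q * v p"
      by (simp add: sum_product[symmetric] e assms)
    finally show ?thesis using True by (simp add: pq wedge_def)
  qed
qed

lemma sum_by_weight:
  fixes h :: "nat \<Rightarrow> nat \<Rightarrow> 'a :: comm_monoid_add"
  shows "(\<Sum>i\<le>m. \<Sum>j\<le>m. h i j) = (\<Sum>k\<le>2*m. \<Sum>(i, j)\<in>{(i, j). i \<le> m \<and> j \<le> m \<and> i + j = k}. h i j)"
proof -
  have "(\<Sum>i\<le>m. \<Sum>j\<le>m. h i j) = (\<Sum>(i, j)\<in>{..m} \<times> {..m}. h i j)"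
    by (simp add: sum.cartesian_product)
  also have "\<dots> = (\<Sum>k\<le>2*m. \<Sum>(i, j)\<in>{x\<in>{..m} \<times> {..m}. fst x + snd x = k}. h i j)"
    by (rule sum.group[symmetric]) auto
  also have "\<dots> = (\<Sum>k\<le>2*m. \<Sum>(i, j)\<in>{(i, j). i \<le> m \<and> j \<le> m \<and> i + j = k}. h i j)"
    by (intro sum.cong refl) auto
  finally show ?thesis .
qed

section \<open>Weight components and the size of the exterior square\<close>

definition weight_part :: "nat \<Rightarrow> bivec \<Rightarrow> bivec" where
  "weight_part k v = (\<lambda>(p, q). if p + q = k then v (p, q) else 0)"

lemma weight_part_weight:
  assumes "v \<in> ext2_weight n j"
  shows "weight_part k v = (if j = k then v else 0)"
proof -
  have "\<forall>p q. p + q \<noteq> j \<longrightarrow> v (p, q) = 0"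
    using assms unfolding ext2_weight_def
  proof (induction rule: cfun.span_induct)
    case base
    show ?case by (auto simp: cfun.subspace_def)
  next
    case (step x) then show ?case by (auto simp: basis_wedge_apply)
  qed
  then show ?thesis by (auto simp: weight_part_def fun_eq_iff)
qed

lemma weight_part_add: "weight_part k (u + v) = weight_part k u + weight_part k v"
  by (auto simp: weight_part_def fun_eq_iff)

lemma weight_part_scl: "weight_part k (scl c v) = scl c (weight_part k v)"
  by (auto simp: weight_part_def scl_def fun_eq_iff)

lemma weight_part_zero: "weight_part k 0 = 0"
  by (auto simp: weight_part_def fun_eq_iff)

lemma subspace_weight_part:
  "cfun.subspace S \<Longrightarrow> cfun.subspace {v. weight_part k v \<in> S}"
  unfolding subspace_iff
  by (simp add: weight_part_add weight_part_scl weight_part_zero)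

text \<open>A spanning set of at most this size bounds the size of every independent set, which is
  the form in which the dimension of the exterior square enters
  \<open>weight_decomp\<close>.\<close>

lemma card_basis_wedges: "card {basis_wedge p q |p q. p < q \<and> q \<le> 2*n+1} \<le> (2*n+2) choose 2"
  and finite_basis_wedges: "finite {basis_wedge p q |p q. p < q \<and> q \<le> 2*n+1}"
proof -
  let ?P = "SIGMA q:{..2*n+1}. {..<q}"
  have eq: "{basis_wedge p q |p q. p < q \<and> q \<le> 2*n+1} = (\<lambda>(q, p). basis_wedge p q) ` ?P"
    by (force simp: image_def)
  show "finite {basis_wedge p q |p q. p < q \<and> q \<le> 2*n+1}" unfolding eq by simp
  have "card ?P = (\<Sum>q\<le>2*n+1. q)" by simp
  also have "\<dots> = (2*n+2) choose 2"
    using gauss_sum_nat[of "2*n+1"] by (simp add: choose_two atMost_atLeast0 mult.commute)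
  finally show "card {basis_wedge p q |p q. p < q \<and> q \<le> 2*n+1} \<le> (2*n+2) choose 2"
    unfolding eq using card_image_le[of ?P] by (metis finite_SigmaI finite_atMost finite_lessThan)
qed

lemma cosetI: "w \<in> S \<Longrightarrow> x = v + w \<Longrightarrow> x \<in> coset S v"
  unfolding coset_def by (rule image_eqI)

lemma cosetE:
  assumes "x \<in> coset S v"
  obtains w where "w \<in> S" "x = v + w"
  using assms unfolding coset_def by (rule imageE) (rule that)

section \<open>Coordinates modulo the hyperplanes\<close>

locale tango_space =
  fixes n :: nat and W :: "bivec set" and f :: "bivec \<Rightarrow> complex" and d :: "nat \<Rightarrow> bivec"
  assumes n1: "n \<ge> 1"
    and W_subspace: "cfun.subspace W"
    and W_sub: "W \<subseteq> ext2 n"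
    and W_dim: "cfun.dim W = ((2*n+2) choose 2) - 4*n - 1"
    and W_invariant: "W = cfun.span (\<Union>k\<in>{1..4*n+1}. W \<inter> ext2_weight n k)"
    and W_indecomposable: "\<forall>u\<in>vecs (2*n+1). \<forall>v\<in>vecs (2*n+1). wedge u v \<in> W \<longrightarrow> wedge u v = 0"
    and f_linear: "linear_form_on (ext2 n) f"
    and f_nonzero: "\<exists>w\<in>ext2 n. f w \<noteq> 0"
    and f_W: "\<forall>w\<in>W. f w = 0"
    and f_weight: "\<forall>k\<in>{1..4*n+1} - {2*n+1}. \<forall>w\<in>ext2_weight n k. f w = 0"
    and d_choice: "\<forall>k\<in>{1..4*n+1} - {2*n+1}. d k \<in> ext2_weight n k - W"
begin

abbreviation "K \<equiv> {1..4*n+1}"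

abbreviation "Wk k \<equiv> W \<inter> ext2_weight n k"

lemma weight_subspace: "cfun.subspace (ext2_weight n k)"
  by (simp add: ext2_weight_def)

lemma weight_subset_ext2: "ext2_weight n k \<subseteq> ext2 n"
  unfolding ext2_weight_def ext2_def by (intro cfun.span_mono) blast

lemma ext2_closed:
  "u \<in> ext2 n \<Longrightarrow> v \<in> ext2 n \<Longrightarrow> u + v \<in> ext2 n" "u \<in> ext2 n \<Longrightarrow> scl c u \<in> ext2 n"
  unfolding ext2_def scl_def by (rule cfun.span_add cfun.span_scale; assumption)+

lemma W_closed:
  "u \<in> W \<Longrightarrow> v \<in> W \<Longrightarrow> u + v \<in> W" "u \<in> W \<Longrightarrow> scl c u \<in> W" "0 \<in> W"
  using W_subspace unfolding subspace_iff by blast+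

lemma f_add: "u \<in> ext2 n \<Longrightarrow> v \<in> ext2 n \<Longrightarrow> f (u + v) = f u + f v"
  and f_scl: "u \<in> ext2 n \<Longrightarrow> f (scl c u) = c * f u"
  using f_linear unfolding linear_form_on_def scl_def[symmetric] by auto

lemma zero_in_ext2: "0 \<in> ext2 n"
  by (simp add: ext2_def cfun.span_zero)

lemma f_zero: "f 0 = 0"
  using f_W W_closed(3) by blast

text \<open>The basis bivectors are weight vectors, and \<open>f\<close> kills those of all other
  weights. If it killed the middle weight as well, it would vanish on a spanning set. Rescaling
  turns a nonzero value into 1.\<close>

lemma ex_dN: "\<exists>v\<in>ext2_weight n (2*n+1). f v = 1"
proof -
  have "\<exists>v\<in>ext2_weight n (2*n+1). f v \<noteq> 0"
  proof (rule ccontr)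
    assume *: "\<not> ?thesis"
    have "w \<in> ext2 n \<and> f w = 0" if "w \<in> ext2 n" for w
      using that[unfolded ext2_def]
    proof (induction rule: cfun.span_induct)
      case base
      show ?case unfolding subspace_iff
        using ext2_closed f_add f_scl zero_in_ext2 f_zero by auto
    next
      case (step x)
      then obtain p q where pq: "x = basis_wedge p q" "p < q" "q \<le> 2*n+1" by blast
      have x: "x \<in> ext2_weight n (p + q)" unfolding pq(1) using pq(2,3) by (intro basis_wedge_in_weight) auto
      have "f x = 0"
      proof (cases "p + q = 2*n+1")
        case True then show ?thesis using * x by auto
      next
        case False
        have "p + q \<in> {1..4*n+1} - {2*n+1}" using pq False by auto
        then show ?thesis using f_weight x by blast
      qed
      then show ?case using x weight_subset_ext2 by blast
    qed
    then show False using f_nonzero by blast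
  qed
  then obtain v where v: "v \<in> ext2_weight n (2*n+1)" "f v \<noteq> 0" by blast
  then have "f (scl (1 / f v) v) = 1" using f_scl[of v "1 / f v"] weight_subset_ext2 by (simp add: subset_iff)
  moreover have "scl (1 / f v) v \<in> ext2_weight n (2*n+1)"
    using v(1) unfolding ext2_weight_def scl_def by (rule cfun.span_scale)
  ultimately show ?thesis by blast
qed

text \<open>Completes the given \<open>d k\<close> by a vector of middle weight. Its value 1 under
  \<open>f\<close> keeps it out of \<open>W\<close> and normalises the middle coordinate so that
  \<open>f_theta\<close> holds.\<close>

definition D :: "nat \<Rightarrow> bivec" where
  "D k = (if k = 2*n+1 then SOME v. v \<in> ext2_weight n (2*n+1) \<and> f v = 1 else d k)"

lemma D_N: "D (2*n+1) \<in> ext2_weight n (2*n+1)" "f (D (2*n+1)) = 1"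
  using someI_ex[of "\<lambda>v. v \<in> ext2_weight n (2*n+1) \<and> f v = 1"] ex_dN unfolding D_def by auto

lemma D_weight: "k \<in> K \<Longrightarrow> D k \<in> ext2_weight n k"
  using D_N(1) d_choice by (cases "k = 2*n+1") (auto simp: D_def)

lemma D_notin_W: "k \<in> K \<Longrightarrow> D k \<notin> W"
  using D_N f_W d_choice by (cases "k = 2*n+1") (auto simp: D_def[of k])

text \<open>The condition defines a subspace, so it is enough to look at the homogeneous generators
  from \<open>W_invariant\<close>; the weight part of such a generator is itself or zero.\<close>

lemma W_weight_part:
  assumes "w \<in> W"
  shows "weight_part k w \<in> W"
proof -
  have "w \<in> cfun.span (\<Union>k\<in>{1..4*n+1}. W \<inter> ext2_weight n k)" using assms W_invariant by simp
  then show ?thesis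
  proof (induction rule: cfun.span_induct)
    case base
    show ?case using subspace_weight_part[OF W_subspace] by simp
  next
    case (step x)
    then obtain j where "x \<in> W" "x \<in> ext2_weight n j" by blast
    then show ?case using weight_part_weight[of x n j k] W_closed(3) by (simp only: mem_Collect_eq split: if_split) simp
  qed
qed

text \<open>Otherwise \<open>W\<close>, the \<open>D k\<close> and a further bivector would be too many independent directions.\<close>

lemma weight_decomp:
  assumes k: "k \<in> K" and v: "v \<in> ext2_weight n k"
  shows "\<exists>c. v + scl (- c) (D k) \<in> W"
proof (rule ccontr)
  assume neg: "\<not> ?thesis"
  obtain B where B: "B \<subseteq> W" "cfun.independent B" "W \<subseteq> cfun.span B" "card B = cfun.dim W"
    using cfun.basis_exists by blast
  let ?T = "{basis_wedge p q |p q. p < q \<and> q \<le> 2*n+1}"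
  have finB: "finite B"
    using cfun.independent_span_bound[OF finite_basis_wedges B(2)] B(1) W_sub unfolding ext2_def by blast
  have indep: "cfun.independent (B \<union> D ` {1..j}) \<and> card (B \<union> D ` {1..j}) = card B + j" if "j \<le> 4*n+1" for j
    using that
  proof (induction j)
    case 0 then show ?case using B by simp
  next
    case (Suc j)
    let ?S = "B \<union> D ` {1..j}"
    \<comment> \<open>Taking the part of weight \<open>Suc j\<close> sends all vectors chosen so far
      into \<open>W\<close>: those of \<open>B\<close> by invariance, the earlier \<open>D i\<close>
      to zero. It fixes \<open>D (Suc j)\<close>, which lies outside \<open>W\<close>.\<close>
    have nin: "D (Suc j) \<notin> cfun.span ?S"
    proof
      assume "D (Suc j) \<in> cfun.span ?S"
      then have "weight_part (Suc j) (D (Suc j)) \<in> W"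
      proof (induction rule: cfun.span_induct)
        case base
        show ?case using subspace_weight_part[OF W_subspace] by simp
      next
        case (step x)
        then show ?case
        proof
          assume "x \<in> B" then show ?thesis using B(1) W_weight_part by blast
        next
          assume "x \<in> D ` {1..j}"
          then obtain i where i: "x = D i" "1 \<le> i" "i \<le> j" by auto
          then have "x \<in> ext2_weight n i" using D_weight[of i] Suc.prems by auto
          then have "weight_part (Suc j) x = 0" using weight_part_weight[of x n i "Suc j"] i by simp
          then show ?thesis using W_closed(3) by (simp only: mem_Collect_eq)
        qed
      qed
      moreover have "weight_part (Suc j) (D (Suc j)) = D (Suc j)"
        using weight_part_weight[OF D_weight, of "Suc j" "Suc j"] Suc.prems by simp
      ultimately show False using D_notin_W[of "Suc j"] Suc.prems by auto
    qed
    have nin': "D (Suc j) \<notin> ?S" using nin by (rule contrapos_nn) (rule cfun.span_base)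
    have "B \<union> D ` {1..Suc j} = insert (D (Suc j)) ?S" by (auto simp: atLeastAtMostSuc_conv)
    then show ?case using Suc nin nin' finB by (simp add: cfun.independent_insert)
  qed
  let ?S = "B \<union> D ` {1..4*n+1}"
  \<comment> \<open>The vectors whose component of weight \<open>k\<close> lies in \<open>W\<close>
    plus the line through \<open>D k\<close>. They form a subspace containing \<open>?S\<close> but
    not \<open>v\<close>, so \<open>v\<close> is independent of \<open>?S\<close>.\<close>
  let ?X = "{u. \<exists>c. weight_part k u + scl (- c) (D k) \<in> W}"
  have "cfun.subspace ?X" unfolding subspace_iff
  proof (intro conjI allI ballI)
    have "weight_part k 0 + scl (- 0) (D k) = 0" by (simp only: weight_part_zero minus_zero scl_zero add_0_left)
    then show "0 \<in> ?X" using W_closed(3) by (metis (mono_tags, lifting) mem_Collect_eq)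
    fix u assume "u \<in> ?X"
    then obtain c where c: "weight_part k u + scl (- c) (D k) \<in> W" by blast
    have "weight_part k (scl a u) + scl (- (a * c)) (D k) = scl a (weight_part k u + scl (- c) (D k))" for a
      unfolding weight_part_scl by (auto simp: scl_def fun_eq_iff algebra_simps)
    then show "scl a u \<in> ?X" for a using W_closed(2)[OF c, of a] by (metis (mono_tags, lifting) mem_Collect_eq)
    fix v assume "v \<in> ?X"
    then obtain c' where c': "weight_part k v + scl (- c') (D k) \<in> W" by blast
    have "weight_part k (u + v) + scl (- (c + c')) (D k) =
      (weight_part k u + scl (- c) (D k)) + (weight_part k v + scl (- c') (D k))"
      unfolding weight_part_add by (auto simp: scl_def fun_eq_iff algebra_simps)
    then show "u + v \<in> ?X" using W_closed(1)[OF c c'] by (metis (mono_tags, lifting) mem_Collect_eq)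
  qed
  moreover have "?S \<subseteq> ?X"
  proof
    fix x assume "x \<in> ?S"
    then show "x \<in> ?X"
    proof
      assume "x \<in> B"
      then have "weight_part k x + scl (- 0) (D k) \<in> W"
        using B(1) W_weight_part[of x k] by (auto simp: scl_zero)
      then show ?thesis by blast
    next
      assume "x \<in> D ` {1..4*n+1}"
      then obtain i where i: "x = D i" "i \<in> K" by auto
      then have x: "weight_part k x = (if i = k then x else 0)"
        using weight_part_weight[OF D_weight[of i]] by simp
      have "\<exists>c. weight_part k x + scl (- c) (D k) = 0"
      proof (cases "i = k")
        case True
        then have "weight_part k x + scl (- 1) (D k) = 0"
          unfolding x using i by (intro ext) (simp add: scl_def)
        then show ?thesis ..
      next
        case False
        then have "weight_part k x = 0" using x by simp
        then have "weight_part k x + scl (- 0) (D k) = 0" by (simp only: minus_zero scl_zero add_0_left)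
        then show ?thesis ..
      qed
      then obtain c where "weight_part k x + scl (- c) (D k) = 0" ..
      then show ?thesis using W_closed(3) by (intro CollectI exI[of _ c]) (simp only:)
    qed
  qed
  ultimately have "cfun.span ?S \<subseteq> ?X" by (rule cfun.span_minimal[rotated])
  moreover have "v \<notin> ?X" using neg weight_part_weight[OF v, of k] by simp
  ultimately have nin: "v \<notin> cfun.span ?S" by blast
  then have "cfun.independent (insert v ?S)" using indep[of "4*n+1"] by (simp add: cfun.independent_insert)
  moreover have "insert v ?S \<subseteq> cfun.span ?T"
  proof -
    have "v \<in> ext2 n" using v weight_subset_ext2 by blast
    moreover have "B \<subseteq> ext2 n" using B(1) W_sub by (rule subset_trans)
    moreover have "D ` {1..4*n+1} \<subseteq> ext2 n"
      using D_weight weight_subset_ext2 by (intro image_subsetI) blast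
    ultimately show ?thesis unfolding ext2_def[symmetric] by (intro insert_subsetI Un_least)
  qed
  ultimately have "card (insert v ?S) \<le> card ?T"
    using cfun.independent_span_bound[OF finite_basis_wedges, of "insert v ?S"] by simp
  moreover have "v \<notin> ?S" using nin by (rule contrapos_nn) (rule cfun.span_base)
  then have "card (insert v ?S) = Suc (card B + (4*n+1))" using indep[of "4*n+1"] finB by simp
  \<comment> \<open>The dimension of \<open>W\<close> is a difference of natural numbers. This bound
    makes the subtraction exact, and the independent set exceeds the spanning set by one.\<close>
  moreover have "4*n+1 \<le> (2*n+2) choose 2"
  proof -
    have "(2*n+2) choose 2 = (n+1) * (2*n+1)" by (simp add: choose_two)
    moreover have "n * 2 \<le> n * n * 2" using n1 by simp
    ultimately show ?thesis using n1 by (simp add: algebra_simps)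
  qed
  ultimately show False using card_basis_wedges[of n] B(4) W_dim by simp
qed

text \<open>The linear form on the weight space of weight \<open>k\<close> with kernel \<open>W\<^sub>k\<close> and value \<open>1\<close> at \<open>D k\<close>;
  in the middle weight it is \<open>f\<close>.\<close>

definition \<theta> :: "nat \<Rightarrow> bivec \<Rightarrow> complex" where
  "\<theta> k v = (SOME c. v + scl (- c) (D k) \<in> W)"

lemma theta: "k \<in> K \<Longrightarrow> v \<in> ext2_weight n k \<Longrightarrow> v + scl (- \<theta> k v) (D k) \<in> W"
  unfolding \<theta>_def using weight_decomp by (rule someI_ex)

lemma D_multiple:
  assumes "k \<in> K" "scl c (D k) \<in> W"
  shows "c = 0"
proof (rule ccontr)
  assume "c \<noteq> 0"
  then have "scl (1 / c) (scl c (D k)) = D k" by (simp add: scl_scl scl_one)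
  then show False using W_closed(2)[OF assms(2), of "1 / c"] D_notin_W[OF assms(1)] by simp
qed

text \<open>Two admissible coefficients differ by a number whose multiple of \<open>D k\<close> lies
  in \<open>W\<close>, hence by zero. Linearity of \<open>\<theta> k\<close>, whose values are mere
  choices, comes from this uniqueness.\<close>

lemma theta_eqI:
  assumes "k \<in> K" "v \<in> ext2_weight n k" "v + scl (- c) (D k) \<in> W"
  shows "\<theta> k v = c"
proof -
  have "scl (c - \<theta> k v) (D k) = (v + scl (- \<theta> k v) (D k)) + scl (-1) (v + scl (- c) (D k))"
    by (auto simp: scl_def fun_eq_iff algebra_simps)
  then have "scl (c - \<theta> k v) (D k) \<in> W"
    using W_closed(1)[OF theta[OF assms(1,2)] W_closed(2)[OF assms(3), of "-1"]] by (simp only:)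
  then have "c - \<theta> k v = 0" by (rule D_multiple[OF assms(1)])
  then show ?thesis by simp
qed

lemma weight_closed:
  "u \<in> ext2_weight n k \<Longrightarrow> v \<in> ext2_weight n k \<Longrightarrow> u + v \<in> ext2_weight n k"
  "u \<in> ext2_weight n k \<Longrightarrow> scl c u \<in> ext2_weight n k"
  "0 \<in> ext2_weight n k"
  using weight_subspace[of k] unfolding subspace_iff by blast+

lemma theta_add:
  assumes "k \<in> K" "u \<in> ext2_weight n k" "v \<in> ext2_weight n k"
  shows "\<theta> k (u + v) = \<theta> k u + \<theta> k v"
proof (rule theta_eqI[OF assms(1) weight_closed(1)[OF assms(2,3)]])
  have "u + v + scl (- (\<theta> k u + \<theta> k v)) (D k) =
      (u + scl (- \<theta> k u) (D k)) + (v + scl (- \<theta> k v) (D k))"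
    by (auto simp: scl_def fun_eq_iff algebra_simps)
  then show "u + v + scl (- (\<theta> k u + \<theta> k v)) (D k) \<in> W"
    using W_closed(1)[OF theta[OF assms(1,2)] theta[OF assms(1,3)]] by (simp only:)
qed

lemma theta_scl:
  assumes "k \<in> K" "u \<in> ext2_weight n k"
  shows "\<theta> k (scl c u) = c * \<theta> k u"
proof (rule theta_eqI[OF assms(1) weight_closed(2)[OF assms(2)]])
  have "scl c u + scl (- (c * \<theta> k u)) (D k) = scl c (u + scl (- \<theta> k u) (D k))"
    by (auto simp: scl_def fun_eq_iff algebra_simps)
  then show "scl c u + scl (- (c * \<theta> k u)) (D k) \<in> W"
    using W_closed(2)[OF theta[OF assms], of c] by (simp only:)
qed

lemma weight_sum_closed:
  "finite I \<Longrightarrow> (\<And>i. i \<in> I \<Longrightarrow> b i \<in> ext2_weight n k) \<Longrightarrow> (\<lambda>pq. \<Sum>i\<in>I. h i * b i pq) \<in> ext2_weight n k"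
proof (induction I rule: finite_induct)
  case empty then show ?case using weight_closed(3) by (simp add: zero_fun_def)
next
  case (insert i I)
  then have "scl (h i) (b i) + (\<lambda>pq. \<Sum>i\<in>I. h i * b i pq) \<in> ext2_weight n k"
    by (intro weight_closed) auto
  then show ?case using insert by (simp add: plus_fun_def scl_def)
qed

lemma theta_sum:
  assumes k: "k \<in> K"
  shows "finite I \<Longrightarrow> (\<And>i. i \<in> I \<Longrightarrow> b i \<in> ext2_weight n k) \<Longrightarrow>
    \<theta> k (\<lambda>pq. \<Sum>i\<in>I. h i * b i pq) = (\<Sum>i\<in>I. h i * \<theta> k (b i))"
proof (induction I rule: finite_induct)
  case empty
  have "\<theta> k 0 = 0" by (rule theta_eqI[OF k weight_closed(3)])
    (simp only: minus_zero scl_zero add_0_left W_closed(3))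
  then show ?case by (simp add: zero_fun_def)
next
  case (insert i I)
  have "(\<lambda>pq. \<Sum>j\<in>insert i I. h j * b j pq) = scl (h i) (b i) + (\<lambda>pq. \<Sum>i\<in>I. h i * b i pq)"
    using insert by (simp add: plus_fun_def scl_def)
  then show ?case
    using insert k by (simp add: theta_add theta_scl weight_closed weight_sum_closed)
qed

lemma theta_zero_iff:
  assumes "k \<in> K" "v \<in> ext2_weight n k"
  shows "\<theta> k v = 0 \<longleftrightarrow> v \<in> W"
proof -
  have e: "v + scl (- 0) (D k) = v" by (simp only: minus_zero scl_zero add_0_right)
  show ?thesis using theta[OF assms] theta_eqI[OF assms, of 0] unfolding e
    by (metis e)
qed

text \<open>\<open>f\<close> kills the difference of \<open>v\<close> and its multiple of
  \<open>D (2*n+1)\<close>, and is 1 on the latter vector. Hence the correlation map is the middle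
  coordinate of the wedge map.\<close>

lemma f_theta:
  assumes "v \<in> ext2_weight n (2*n+1)"
  shows "f v = \<theta> (2*n+1) v"
proof -
  have N: "2*n+1 \<in> K" by auto
  have v: "v \<in> ext2 n" "D (2*n+1) \<in> ext2 n" using assms D_N(1) weight_subset_ext2 by auto
  have "f (v + scl (- \<theta> (2*n+1) v) (D (2*n+1))) = 0" using theta[OF N assms] f_W by blast
  then show ?thesis unfolding f_add[OF v(1) ext2_closed(2)[OF v(2)]] f_scl[OF v(2)] D_N(2) by simp
qed

section \<open>Cosets of the hyperplanes\<close>

lemma Wk_closed:
  "u \<in> Wk k \<Longrightarrow> v \<in> Wk k \<Longrightarrow> u + v \<in> Wk k" "u \<in> Wk k \<Longrightarrow> scl c u \<in> Wk k" "0 \<in> Wk k"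
  using W_closed weight_closed by auto

lemma coset_subsetI:
  assumes "\<And>w. w \<in> Wk k \<Longrightarrow> \<exists>w'\<in>Wk k. a + w = b + w'"
  shows "coset (Wk k) a \<subseteq> coset (Wk k) b"
proof
  fix x assume "x \<in> coset (Wk k) a"
  then obtain w where "w \<in> Wk k" "x = a + w" by (rule cosetE)
  with assms obtain w' where "w' \<in> Wk k" "x = b + w'" by metis
  then show "x \<in> coset (Wk k) b" by (rule cosetI)
qed

lemma coset_theta:
  assumes "k \<in> K" "v \<in> ext2_weight n k"
  shows "coset (Wk k) v = coset (Wk k) (scl (\<theta> k v) (D k))"
proof -
  let ?w = "v + scl (- \<theta> k v) (D k)"
  have w: "?w \<in> Wk k"
    using theta[OF assms] weight_closed(1)[OF assms(2) weight_closed(2)[OF D_weight[OF assms(1)]]] by (rule IntI)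
  have 1: "v + a = scl (\<theta> k v) (D k) + (?w + a)" for a by (rule ext) (simp add: scl_def)
  have 2: "scl (\<theta> k v) (D k) + a = v + (scl (-1) ?w + a)" for a by (rule ext) (simp add: scl_def)
  show ?thesis
  proof (intro subset_antisym coset_subsetI)
    fix a assume a: "a \<in> Wk k"
    show "\<exists>w'\<in>Wk k. v + a = scl (\<theta> k v) (D k) + w'"
      using 1[of a] Wk_closed(1)[OF w a] by (intro bexI[of _ "?w + a"]) (simp only:)+
    show "\<exists>w'\<in>Wk k. scl (\<theta> k v) (D k) + a = v + w'"
      using 2[of a] Wk_closed(1)[OF Wk_closed(2)[OF w, of "-1"] a] by (intro bexI[of _ "scl (-1) ?w + a"]) (simp only:)+
  qed
qed

lemma coset_inj:
  assumes "k \<in> K" "coset (Wk k) (scl a (D k)) = coset (Wk k) (scl b (D k))"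
  shows "a = b"
proof -
  have "scl a (D k) \<in> coset (Wk k) (scl a (D k))" by (rule cosetI[OF Wk_closed(3)]) simp
  then have "scl a (D k) \<in> coset (Wk k) (scl b (D k))" unfolding assms(2) .
  then obtain w where w: "w \<in> Wk k" "scl a (D k) = scl b (D k) + w" by (rule cosetE)
  have "scl (a - b) (D k) = w"
  proof
    fix i show "scl (a - b) (D k) i = w i" using fun_cong[OF w(2), of i] by (simp add: scl_def left_diff_distrib)
  qed
  then have "a - b = 0" using D_multiple[OF assms(1), of "a - b"] w(1) by blast
  then show ?thesis by simp
qed

lemma coset_add: "{u + v |u v. u \<in> coset (Wk k) a \<and> v \<in> coset (Wk k) b} = coset (Wk k) (a + b)"
proof (intro Set.set_eqI iffI)
  fix x assume "x \<in> {u + v |u v. u \<in> coset (Wk k) a \<and> v \<in> coset (Wk k) b}"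
  then obtain u v where uv: "x = u + v" "u \<in> coset (Wk k) a" "v \<in> coset (Wk k) b" by blast
  from uv(2) obtain w where w: "w \<in> Wk k" "u = a + w" by (rule cosetE)
  from uv(3) obtain w' where w': "w' \<in> Wk k" "v = b + w'" by (rule cosetE)
  have "x = (a + b) + (w + w')" unfolding uv(1) w(2) w'(2) by (simp only: add_ac)
  then show "x \<in> coset (Wk k) (a + b)" by (rule cosetI[OF Wk_closed(1)[OF w(1) w'(1)]])
next
  fix x assume "x \<in> coset (Wk k) (a + b)"
  then obtain w where w: "w \<in> Wk k" "x = (a + b) + w" by (rule cosetE)
  have "x = (a + w) + b" unfolding w(2) by (simp only: add_ac)
  moreover have "a + w \<in> coset (Wk k) a" by (rule cosetI[OF w(1) refl])
  moreover have "b \<in> coset (Wk k) b" by (rule cosetI[OF Wk_closed(3)]) simp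
  ultimately show "x \<in> {u + v |u v. u \<in> coset (Wk k) a \<and> v \<in> coset (Wk k) b}" by blast
qed

text \<open>The summand from \<open>Wk k\<close> matters for \<open>c = 0\<close>, where scaling
  alone would shrink the coset to a single vector. For nonzero scalars, as in the twist,
  \<open>coset_scale\<close> does without it.\<close>

lemma coset_smult: "{scl c u + w |u w. u \<in> coset (Wk k) a \<and> w \<in> Wk k} = coset (Wk k) (scl c a)"
proof (intro Set.set_eqI iffI)
  fix x assume "x \<in> {scl c u + w |u w. u \<in> coset (Wk k) a \<and> w \<in> Wk k}"
  then obtain u w' where x: "x = scl c u + w'" "u \<in> coset (Wk k) a" "w' \<in> Wk k" by blast
  from x(2) obtain w where w: "w \<in> Wk k" "u = a + w" by (rule cosetE)
  have "x = scl c a + (scl c w + w')" unfolding x(1) w(2) by (rule ext) (simp add: scl_def distrib_left)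
  then show "x \<in> coset (Wk k) (scl c a)" by (rule cosetI[OF Wk_closed(1)[OF Wk_closed(2)[OF w(1)] x(3)]])
next
  fix x assume "x \<in> coset (Wk k) (scl c a)"
  then obtain w where w: "w \<in> Wk k" "x = scl c a + w" by (rule cosetE)
  moreover have "a \<in> coset (Wk k) a" by (rule cosetI[OF Wk_closed(3)]) simp
  ultimately show "x \<in> {scl c u + w |u w. u \<in> coset (Wk k) a \<and> w \<in> Wk k}" by blast
qed

lemma coset_scale:
  assumes "c \<noteq> 0"
  shows "scl c ` coset (Wk k) a = coset (Wk k) (scl c a)"
proof (intro subset_antisym image_subsetI subsetI)
  fix u assume "u \<in> coset (Wk k) a"
  then obtain w where w: "w \<in> Wk k" "u = a + w" by (rule cosetE)
  have "scl c u = scl c a + scl c w" unfolding w(2) by (rule ext) (simp add: scl_def distrib_left)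
  then show "scl c u \<in> coset (Wk k) (scl c a)" by (rule cosetI[OF Wk_closed(2)[OF w(1)]])
next
  fix x assume "x \<in> coset (Wk k) (scl c a)"
  then obtain w where w: "w \<in> Wk k" "x = scl c a + w" by (rule cosetE)
  have "x = scl c (a + scl (1 / c) w)"
    unfolding w(2) by (rule ext) (simp add: scl_def distrib_left assms)
  moreover have "a + scl (1 / c) w \<in> coset (Wk k) a" by (rule cosetI[OF Wk_closed(2)[OF w(1)] refl])
  ultimately show "x \<in> scl c ` coset (Wk k) a" by (rule image_eqI)
qed

text \<open>The structure constants of the wedge product modulo \<open>W\<close>. They carry meaning
  for \<open>i + j = k\<close> only, since outside the weight space \<open>\<theta> k\<close> is an
  uncontrolled choice.\<close>

definition coef :: "nat \<Rightarrow> nat \<Rightarrow> nat \<Rightarrow> complex" where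
  "coef k i j = \<theta> k (basis_wedge i j)"

lemma coef_swap:
  assumes "k \<in> K" "i \<le> 2*n+1" "j \<le> 2*n+1" "i + j = k"
  shows "coef k j i = - coef k i j"
  unfolding coef_def basis_wedge_swap[of j i]
  using theta_scl[OF assms(1) basis_wedge_in_weight[OF assms(2-4)], of "-1"] by simp

text \<open>This is the nondegeneracy of \<open>f\<close>, whose matrix lives on the antidiagonal: a
  zero entry would put a decomposable basis bivector into \<open>W\<close>. That bivector is nonzero
  because 2n+1 is odd, so the two indices differ.\<close>

lemma coef_N_nonzero:
  assumes "i \<le> 2*n+1"
  shows "coef (2*n+1) i (2*n+1-i) \<noteq> 0"
proof
  assume "coef (2*n+1) i (2*n+1-i) = 0"
  moreover have "2*n+1 \<in> K" by auto
  moreover have "basis_wedge i (2*n+1-i) \<in> ext2_weight n (2*n+1)"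
    using assms by (intro basis_wedge_in_weight) auto
  ultimately have "basis_wedge i (2*n+1-i) \<in> W" unfolding coef_def using theta_zero_iff by blast
  then have "basis_wedge i (2*n+1-i) = 0"
    unfolding basis_wedge_def using W_indecomposable assms by (auto simp: unit_vec_vecs)
  moreover have "i \<noteq> 2*n+1-i" by presburger
  ultimately show False using basis_wedge_nonzero by blast
qed

abbreviation pairs :: "nat \<Rightarrow> (nat \<times> nat) set" where
  "pairs k \<equiv> {(i, j). i \<le> 2*n+1 \<and> j \<le> 2*n+1 \<and> i + j = k}"

lemma finite_pairs: "finite (pairs k)"
  by (rule finite_subset[of _ "{..2*n+1} \<times> {..2*n+1}"]) auto

lemma theta_pairs:
  assumes "k \<in> K"
  shows "\<theta> k (\<lambda>pq. \<Sum>(i, j)\<in>pairs k. h i j * basis_wedge i j pq) = (\<Sum>(i, j)\<in>pairs k. h i j * coef k i j)"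
    and "(\<lambda>pq. \<Sum>(i, j)\<in>pairs k. h i j * basis_wedge i j pq) \<in> ext2_weight n k"
  using theta_sum[OF assms finite_pairs, of k "\<lambda>(i, j). basis_wedge i j" "\<lambda>(i, j). h i j"]
    weight_sum_closed[OF finite_pairs, of k "\<lambda>(i, j). basis_wedge i j" k "\<lambda>(i, j). h i j"]
  by (auto simp: coef_def case_prod_beta basis_wedge_in_weight)

text \<open>Vanishing of all coordinates puts every weight component of the decomposable
  \<open>wedge u v\<close> into \<open>W\<close>, hence the whole bivector, which must then be zero.
  The conclusion expresses proportionality by 2 x 2 minors, ready for division by a nonzero entry of
  \<open>u\<close>.\<close>

lemma wedge_zero:
  assumes "u \<in> vecs (2*n+1)" "v \<in> vecs (2*n+1)"
    and "\<And>k. k \<in> K \<Longrightarrow> (\<Sum>(i, j)\<in>pairs k. u i * v j * coef k i j) = 0"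
  shows "u i * v j = u j * v i"
proof -
  let ?w = "\<lambda>k pq. \<Sum>(i, j)\<in>pairs k. u i * v j * basis_wedge i j pq"
  have wk: "?w k \<in> W" if "k \<le> 4*n+2" for k
  proof (cases "k \<in> K")
    case True
    then show ?thesis
      using theta_zero_iff[OF True theta_pairs(2)[OF True]] theta_pairs(1)[OF True, of "\<lambda>i j. u i * v j"]
        assms(3)[OF True] by simp
  next
    case False
    \<comment> \<open>The double sum over indices also meets the extreme weights outside
      \<open>K\<close>; there the two indices coincide and the basis bivector is zero.\<close>
    then have "k = 0 \<or> k = 4*n+2" using that by auto
    then have ij: "i = j" if "(i, j) \<in> pairs k" for i j using that by auto
    have "(case x of (i, j) \<Rightarrow> u i * v j * basis_wedge i j pq) = 0" if "x \<in> pairs k" for x pq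
    proof -
      obtain i j where x: "x = (i, j)" by fastforce
      then have "basis_wedge i j = 0" using ij[of i j] that by (simp only: basis_wedge_self)
      then show ?thesis by (simp only: x prod.case zero_fun_apply mult_zero_right)
    qed
    then have "?w k = 0" by (intro ext) (simp only: zero_fun_apply, rule sum.neutral, blast)
    then show ?thesis using W_closed(3) by simp
  qed
  have "(\<lambda>pq. \<Sum>k\<in>I. ?w k pq) \<in> W" if "finite I" "I \<subseteq> {..4*n+2}" for I
    using that
  proof (induction I rule: finite_induct)
    case empty then show ?case using W_closed(3) by (simp add: zero_fun_def)
  next
    case (insert k I)
    then have "?w k + (\<lambda>pq. \<Sum>k\<in>I. ?w k pq) \<in> W" by (intro W_closed wk insert.IH) auto
    then show ?case using insert by (simp add: plus_fun_def scl_def)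
  qed
  from this[of "{..2*(2*n+1)}"] have "wedge u v \<in> W"
    unfolding wedge_expand[OF assms(1,2)] sum_by_weight by simp
  then have w: "wedge u v = 0" using W_indecomposable assms(1,2) by blast
  have lt: "u i * v j = u j * v i" if "i < j" for i j
    using fun_cong[OF w, of "(i, j)"] that by (simp add: wedge_def)
  show ?thesis by (rule linorder_cases[of i j]) (use lt[of i j] lt[of j i] in auto)
qed

end

section \<open>Direct sums of morphisms, and transport of the sheaf axioms\<close>

lemma sheaf_hom_cong:
  assumes "sheaf_hom m A B \<phi>" "mod_closed m A"
    and "\<And>U s. zopen m U \<Longrightarrow> s \<in> secs A U \<Longrightarrow> \<phi>' U s = \<phi> U s"
  shows "sheaf_hom m A B \<phi>'"
proof -
  interpret A: mod_closed m A by fact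
  note h = sheaf_homD[OF assms(1)]
  show ?thesis
    by (rule sheaf_homI) (simp_all add: assms(3) h A.add_closed A.smult_closed A.res_closed)
qed

lemma dsum_hom:
  assumes "\<And>i. i \<in> I \<Longrightarrow> sheaf_hom m (F i) (G i) (\<phi> i)"
  shows "sheaf_hom m (dsum I F) (dsum I G) (\<lambda>U s. \<lambda>i\<in>I. \<phi> i U (s i))"
proof (rule sheaf_homI, unfold sect_dsum, goal_cases)
  case (1 U s) then show ?case by (auto simp: PiE_iff intro: sheaf_homD(1)[OF assms])
next
  case (2 U s t) then show ?case by (intro restrict_ext) (simp add: PiE_iff sheaf_homD(2)[OF assms])
next
  case (3 U r s) then show ?case by (intro restrict_ext) (simp add: PiE_iff sheaf_homD(3)[OF assms])
next
  case (4 U T s) then show ?case by (intro restrict_ext) (simp add: PiE_iff sheaf_homD(4)[OF assms])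
qed

lemma dsum_hom_surj:
  assumes "\<And>i. i \<in> I \<Longrightarrow> \<phi> i U ` secs (F i) U = secs (G i) U"
  shows "(\<lambda>s. \<lambda>i\<in>I. \<phi> i U (s i)) ` secs (dsum I F) U = secs (dsum I G) U"
proof (intro subset_antisym image_subsetI subsetI)
  fix s assume "s \<in> secs (dsum I F) U"
  then show "(\<lambda>i\<in>I. \<phi> i U (s i)) \<in> secs (dsum I G) U"
    using assms by (fastforce simp: sect_dsum PiE_iff)
next
  fix t assume t: "t \<in> secs (dsum I G) U"
  then have "\<forall>i\<in>I. \<exists>s\<in>secs (F i) U. t i = \<phi> i U s" 
    using assms by (fastforce simp: sect_dsum PiE_iff)
  then obtain s where s: "\<forall>i\<in>I. s i \<in> secs (F i) U \<and> t i = \<phi> i U (s i)" by metis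
  show "t \<in> (\<lambda>s. \<lambda>i\<in>I. \<phi> i U (s i)) ` secs (dsum I F) U"
  proof (rule image_eqI)
    show "restrict s I \<in> secs (dsum I F) U" using s by (simp add: sect_dsum)
    show "t = (\<lambda>i\<in>I. \<phi> i U (restrict s I i))"
      using t s by (intro extensionalityI[of t I]) (auto simp: sect_dsum PiE_iff)
  qed
qed

lemma dsum_hom_inj:
  assumes "\<And>i. i \<in> I \<Longrightarrow> inj_on (\<phi> i U) (secs (F i) U)"
  shows "inj_on (\<lambda>s. \<lambda>i\<in>I. \<phi> i U (s i)) (secs (dsum I F) U)"
proof (rule inj_onI)
  fix s t assume s: "s \<in> secs (dsum I F) U" and t: "t \<in> secs (dsum I F) U"
    and eq: "(\<lambda>i\<in>I. \<phi> i U (s i)) = (\<lambda>i\<in>I. \<phi> i U (t i))"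
  show "s = t"
  proof (rule PiE_ext[OF s[unfolded sect_dsum] t[unfolded sect_dsum]])
    fix i assume i: "i \<in> I"
    from fun_cong[OF eq, of i] i have "\<phi> i U (s i) = \<phi> i U (t i)" by simp
    then show "s i = t i" using assms[OF i] s t i by (auto simp: sect_dsum PiE_iff dest: inj_onD)
  qed
qed

text \<open>Injectivity on sections carries separatedness over, and gluing data are pulled back
  along the bijections and glued in \<open>A\<close>. It makes sheaves of cosets inherit their
  axioms from line bundles.\<close>

lemma sheaf_mod_iso:
  assumes "sheaf_mod m A" "sheaf_hom m A B \<phi>"
    and surj: "\<And>U. zopen m U \<Longrightarrow> \<phi> U ` secs A U = secs B U"
    and inj: "\<And>U. zopen m U \<Longrightarrow> inj_on (\<phi> U) (secs A U)"
    and zero: "\<And>U. zopen m U \<Longrightarrow> \<phi> U \<zero>\<^bsub>sect A U\<^esub> = \<zero>\<^bsub>sect B U\<^esub>"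
  shows "sheaf_mod m B"
proof -
  interpret A: sheaf_mod m A by fact
  interpret B: mod_presheaf m B
    by (rule mod_presheaf_image[OF A.mod_presheaf_axioms assms(2) surj zero])
  note h = sheaf_homD(1)[OF assms(2)]
  note h4 = sheaf_homD(4)[OF assms(2)]
  have ex: "\<exists>a\<in>secs A U. s = \<phi> U a"
    if "zopen m U" "s \<in> secs B U" for U s
    using surj[OF that(1)] that(2) by blast
  show ?thesis
  proof
    fix U s t assume U: "zopen m U" and s: "s \<in> secs B U" and t: "t \<in> secs B U"
      and loc: "\<And>L. L \<in> U \<Longrightarrow> \<exists>T. zopen m T \<and> L \<in> T \<and> T \<subseteq> U \<and> res B U T s = res B U T t"
    from ex[OF U s] ex[OF U t] obtain a b where
      ab: "a \<in> secs A U" "b \<in> secs A U" "s = \<phi> U a" "t = \<phi> U b" by blast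
    have "a = b"
    proof (rule A.separated[OF U ab(1,2)])
      fix L assume "L \<in> U"
      then obtain T where T: "zopen m T" "L \<in> T" "T \<subseteq> U" "res B U T s = res B U T t"
        using loc by blast
      then have "\<phi> T (res A U T a) = \<phi> T (res A U T b)" using h4[OF U T(1,3)] ab by simp
      then have "res A U T a = res A U T b"
        by (rule inj_onD[OF inj[OF T(1)]]) (rule A.res_closed[OF U T(1,3)], rule ab)+
      then show "\<exists>T. zopen m T \<and> L \<in> T \<and> T \<subseteq> U \<and> res A U T a = res A U T b"
        using T by blast
    qed
    then show "s = t" using ab by simp
  next
    fix U G assume U: "zopen m U"
      and G: "\<And>T c. (T, c) \<in> G \<Longrightarrow> zopen m T \<and> T \<subseteq> U \<and> c \<in> secs B T"
      and cov: "\<And>L. L \<in> U \<Longrightarrow> \<exists>T c. (T, c) \<in> G \<and> L \<in> T"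
      and comp: "\<And>T c T' c'. (T, c) \<in> G \<Longrightarrow> (T', c') \<in> G \<Longrightarrow>
        res B T (T \<inter> T') c = res B T' (T \<inter> T') c'"
    let ?G = "{(T, a). a \<in> secs A T \<and> (T, \<phi> T a) \<in> G}"
    have "\<exists>s\<in>secs A U. \<forall>(T, c)\<in>?G. res A U T s = c"
    proof (rule A.glue[OF U])
      show "zopen m T \<and> T \<subseteq> U \<and> c \<in> secs A T" if "(T, c) \<in> ?G" for T c
        using that G by blast
      show "\<exists>T c. (T, c) \<in> ?G \<and> L \<in> T" if L: "L \<in> U" for L
      proof -
        from cov[OF L] obtain T c where T: "(T, c) \<in> G" "L \<in> T" by blast
        then obtain a where "a \<in> secs A T" "c = \<phi> T a" using ex G by blast
        then show ?thesis using T by blast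
      qed
      fix T c T' c' assume c: "(T, c) \<in> ?G" "(T', c') \<in> ?G"
      then have o: "zopen m T" "zopen m T'" "zopen m (T \<inter> T')"
        and cc: "c \<in> secs A T" "c' \<in> secs A T'"
        using G by auto
      have "\<phi> (T \<inter> T') (res A T (T \<inter> T') c) = \<phi> (T \<inter> T') (res A T' (T \<inter> T') c')"
        using h4[OF o(1,3) _ cc(1)] h4[OF o(2,3) _ cc(2)] comp c by auto
      then show "res A T (T \<inter> T') c = res A T' (T \<inter> T') c'"
        by (rule inj_onD[OF inj[OF o(3)]])
          (rule A.res_closed[OF o(1,3) _ cc(1)], simp, rule A.res_closed[OF o(2,3) _ cc(2)], simp)
    qed
    then obtain s where s: "s \<in> secs A U" "\<forall>(T, c)\<in>?G. res A U T s = c" by blast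
    have "res B U T (\<phi> U s) = c" if c: "(T, c) \<in> G" for T c
    proof -
      have T: "zopen m T" "T \<subseteq> U" "c \<in> secs B T" using G[OF c] by auto
      from ex[OF T(1,3)] obtain a where a: "a \<in> secs A T" "c = \<phi> T a" by blast
      then have "res A U T s = a" using s(2) c by auto
      then show ?thesis using h4[OF U T(1,2) s(1)] a(2) by simp
    qed
    then show "\<exists>s\<in>secs B U. \<forall>(T, c)\<in>G. res B U T s = c"
      using h[OF U s(1)] by blast
  qed
qed

section \<open>The quotients of the weight spaces as line bundles\<close>

lemma sect_quot:
  "secs (quot_sheaf m e E W) U =
     {(\<lambda>x. if x \<in> \<Union>U then coset W (\<lambda>i. \<Sum>l<r. h l x * b l i) else {}) |(r :: nat) h b.
         \<forall>l<r. h l \<in> osect m e U \<and> b l \<in> E}"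
  "\<zero>\<^bsub>sect (quot_sheaf m e E W) U\<^esub> = (\<lambda>x. if x \<in> \<Union>U then W else {})"
  "s \<oplus>\<^bsub>sect (quot_sheaf m e E W) U\<^esub> t = (\<lambda>x. {u + v |u v. u \<in> s x \<and> v \<in> t x})"
  "q \<odot>\<^bsub>sect (quot_sheaf m e E W) U\<^esub> s = (\<lambda>x. {scl (q x) u + w |u w. u \<in> s x \<and> w \<in> W})"
  "res (quot_sheaf m e E W) U T s = (\<lambda>x. if x \<in> \<Union>T then s x else {})"
  by (simp_all add: quot_sheaf_def scl_def)

context tango_space
begin

text \<open>The trivialisation of the one-dimensional quotient by the class of \<open>D k\<close>;
  for every degree it identifies the line bundle with the sheaf \<open>quotk\<close>.\<close>

definition to_coset :: "nat \<Rightarrow> pset \<Rightarrow> (cvec \<Rightarrow> complex) \<Rightarrow> cvec \<Rightarrow> bivec set" where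
  "to_coset k U h = (\<lambda>x. if x \<in> \<Union>U then coset (Wk k) (scl (h x) (D k)) else {})"

abbreviation quotk :: "nat \<Rightarrow> int \<Rightarrow> nat \<Rightarrow> (cvec \<Rightarrow> bivec set) mod_sheaf" where
  "quotk m e k \<equiv> quot_sheaf m e (ext2_weight n k) (Wk k)"

lemma scl_add_left: "scl (a + b) v = scl a v + scl b v"
  by (rule ext) (simp add: scl_def distrib_right)

text \<open>A section of the quotient sheaf is a finite sum of functions times vectors. Modulo
  \<open>Wk k\<close> each vector \<open>b l\<close> is \<open>\<theta> k (b l)\<close> times
  \<open>D k\<close>, so the sum has a single coefficient, regular because it combines regular
  functions with constants.\<close>

lemma to_coset_surj:
  assumes k: "k \<in> K" and U: "zopen m U"
  shows "to_coset k U ` osect m e U = secs (quotk m e k) U"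
proof (intro subset_antisym image_subsetI subsetI)
  fix h assume h: "h \<in> osect m e U"
  have "to_coset k U h = (\<lambda>x. if x \<in> \<Union>U then coset (Wk k) (\<lambda>i. \<Sum>l<Suc 0. h x * D k i) else {})"
    unfolding to_coset_def scl_def by (intro ext) simp
  then show "to_coset k U h \<in> secs (quotk m e k) U"
    unfolding sect_quot using h D_weight[OF k]
    by (intro CollectI exI[of _ "Suc 0"] exI[of _ "\<lambda>_. h"] exI[of _ "\<lambda>_. D k"]) simp
next
  fix s assume "s \<in> secs (quotk m e k) U"
  then obtain r h b where s: "s = (\<lambda>x. if x \<in> \<Union>U then coset (Wk k) (\<lambda>i. \<Sum>l<r. h l x * b l i) else {})"
    and hb: "\<forall>l<(r::nat). h l \<in> osect m e U \<and> b l \<in> ext2_weight n k"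
    unfolding sect_quot by blast
  have "coset (Wk k) (\<lambda>i. \<Sum>l<r. h l x * b l i) = coset (Wk k) (scl (\<Sum>l<r. h l x * \<theta> k (b l)) (D k))" for x
  proof -
    have "(\<lambda>i. \<Sum>l<r. h l x * b l i) \<in> ext2_weight n k"
      by (rule weight_sum_closed) (use hb in auto)
    moreover have "\<theta> k (\<lambda>i. \<Sum>l<r. h l x * b l i) = (\<Sum>l<r. h l x * \<theta> k (b l))"
      by (rule theta_sum[OF k]) (use hb in auto)
    ultimately show ?thesis using coset_theta[OF k] by metis
  qed
  then have "s = to_coset k U (\<lambda>x. \<Sum>l<r. h l x * \<theta> k (b l))" unfolding s to_coset_def by (simp only:)
  moreover have "(\<lambda>x. \<Sum>l<r. \<theta> k (b l) * h l x) \<in> osect m e U"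
    by (intro osect_sum[OF U] osect_const_mult[OF U]) (use hb in auto)
  ultimately show "s \<in> to_coset k U ` osect m e U" by (simp add: mult.commute)
qed

lemma to_coset_inj:
  assumes "k \<in> K"
  shows "inj_on (to_coset k U) (osect m e U)"
proof (rule inj_onI)
  fix s t assume s: "s \<in> osect m e U" and t: "t \<in> osect m e U" and eq: "to_coset k U s = to_coset k U t"
  show "s = t"
  proof
    fix x show "s x = t x"
    proof (cases "x \<in> \<Union>U")
      case True
      then show ?thesis using fun_cong[OF eq, of x] coset_inj[OF assms] by (simp add: to_coset_def)
    next
      case False
      then show ?thesis using osect_outside[OF s] osect_outside[OF t] by simp
    qed
  qed
qed

lemma to_coset_zero: "to_coset k U (\<lambda>x. 0) = (\<lambda>x. if x \<in> \<Union>U then Wk k else {})"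
proof -
  have "coset (Wk k) 0 = Wk k" by (simp add: coset_def)
  then show ?thesis unfolding to_coset_def scl_zero by (simp only:)
qed

lemma to_coset_hom:
  assumes k: "k \<in> K"
  shows "sheaf_hom m (line_sheaf m e) (quotk m e k) (to_coset k)"
proof (rule sheaf_homI)
  fix U assume U: "zopen m U"
  fix s assume s: "s \<in> secs (line_sheaf m e) U"
  then show "to_coset k U s \<in> secs (quotk m e k) U"
    using to_coset_surj[OF k U, of e] unfolding sect_line_sheaf by blast
  show "to_coset k U (s \<oplus>\<^bsub>sect (line_sheaf m e) U\<^esub> t) =
      to_coset k U s \<oplus>\<^bsub>sect (quotk m e k) U\<^esub> to_coset k U t" for t
    unfolding sect_line_sheaf sect_quot to_coset_def
    by (rule ext) (simp add: scl_add_left coset_add del: Int_iff Union_iff)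
  show "to_coset k U (r \<odot>\<^bsub>sect (line_sheaf m e) U\<^esub> s) =
      r \<odot>\<^bsub>sect (quotk m e k) U\<^esub> to_coset k U s" for r
    unfolding sect_line_sheaf sect_quot to_coset_def
    by (rule ext) (simp add: coset_smult scl_scl del: Int_iff Union_iff)
  show "res (quotk m e k) U T (to_coset k U s) = to_coset k T (res (line_sheaf m e) U T s)"
    if "T \<subseteq> U" for T
  proof -
    have "x \<in> \<Union>U" if "x \<in> \<Union>T" for x using that \<open>T \<subseteq> U\<close> by blast
    then show ?thesis unfolding sect_line_sheaf sect_quot to_coset_def ores_def
      by (intro ext) (simp del: Union_iff)
  qed
qed

end

section \<open>The correlation and Tango bundles\<close>

text \<open>The weights are integers and \<open>g\<close> is any suitable family of forms, so that
  the sequence on P(V) and its weighted version are two instances.\<close>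

locale tango_bundles = tango_space +
  fixes \<alpha> \<beta> \<gamma> :: int and g :: "nat \<Rightarrow> cvec \<Rightarrow> complex"
  assumes g_forms: "\<And>i. i \<le> 2*n+1 \<Longrightarrow>
      g i \<in> forms (2*n+1) (\<gamma> + (2 * int n + 1) * \<alpha> + int i * (\<beta> - \<alpha>))"
    and g_no_common_zero: "\<And>x. x \<in> vecs (2*n+1) \<Longrightarrow> x \<noteq> 0 \<Longrightarrow> \<exists>i\<le>2*n+1. g i x \<noteq> 0"
begin

abbreviation "m \<equiv> 2*n+1"

text \<open>With \<open>sw\<close> below, \<open>wt (i + j) = sw i + sw j\<close>, and
  \<open>g i\<close> has degree \<open>\<gamma> + sw i\<close>; the degree checks for
  \<open>wedge_coords\<close> rest on these two relations.\<close>

definition wt :: "nat \<Rightarrow> int" where "wt k = 2 * (2 * int n + 1) * \<alpha> + int k * (\<beta> - \<alpha>)"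

definition sw :: "nat \<Rightarrow> int" where "sw j = (2 * int n + 1) * \<alpha> + int j * (\<beta> - \<alpha>)"

abbreviation "O\<gamma> \<equiv> line_sheaf m (- \<gamma>)"

abbreviation "SU \<equiv> sym_sheaf n \<alpha> \<beta>"

abbreviation "QB \<equiv> quotient_bundle n \<alpha> \<beta> \<gamma> g"

definition lines :: "int \<Rightarrow> (nat \<Rightarrow> cvec \<Rightarrow> complex) mod_sheaf" where
  "lines e = dsum K (\<lambda>k. line_sheaf m (wt k + e))"

text \<open>The coordinate \<open>\<theta> k\<close> of the part of weight \<open>k\<close> of
  \<open>g \<and> s\<close>, on the split bundle and thus before passing to the quotient by
  \<open>g\<close>.\<close>

definition wedge_coords :: "pset \<Rightarrow> (nat \<Rightarrow> cvec \<Rightarrow> complex) \<Rightarrow> nat \<Rightarrow> cvec \<Rightarrow> complex" where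
  "wedge_coords U s = (\<lambda>k\<in>K. \<lambda>x. \<Sum>(i, j)\<in>pairs k. coef k i j * g i x * s j x)"

lemma SU_dsum: "SU = dsum {..m} (\<lambda>j. line_sheaf m (sw j))"
  by (simp add: sym_sheaf_def sw_def)

lemma SU_sheaf: "sheaf_mod m SU"
  unfolding SU_dsum by (rule sheaf_mod_dsum) (rule sheaf_mod_line)

lemma lines_sheaf: "sheaf_mod m (lines e)"
  unfolding lines_def by (rule sheaf_mod_dsum) (rule sheaf_mod_line)

lemma O_sheaf: "sheaf_mod m O\<gamma>"
  by (rule sheaf_mod_line)

lemma SU_sect: "s \<in> secs SU U \<Longrightarrow> j \<le> m \<Longrightarrow> s j \<in> osect m (sw j) U"
  by (simp add: SU_dsum sect_dsum sect_line_sheaf PiE_iff)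

lemma SU_carrier: "secs SU U = (\<Pi>\<^sub>E j\<in>{..m}. osect m (sw j) U)"
  by (simp add: SU_dsum sect_dsum sect_line_sheaf)

lemma lines_sect: "s \<in> secs (lines e) U \<Longrightarrow> k \<in> K \<Longrightarrow> s k \<in> osect m (wt k + e) U"
  by (simp add: lines_def sect_dsum sect_line_sheaf PiE_iff)

lemma lines_ops:
  "secs (lines e) U = (\<Pi>\<^sub>E k\<in>K. osect m (wt k + e) U)"
  "\<zero>\<^bsub>sect (lines e) U\<^esub> = (\<lambda>k\<in>K. \<lambda>x. 0)"
  "s \<oplus>\<^bsub>sect (lines e) U\<^esub> t = (\<lambda>k\<in>K. \<lambda>x. s k x + t k x)"
  "r \<odot>\<^bsub>sect (lines e) U\<^esub> s = (\<lambda>k\<in>K. \<lambda>x. r x * s k x)"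
  "res (lines e) U T s = (\<lambda>k\<in>K. ores T (s k))"
  by (simp_all add: lines_def sect_dsum sect_line_sheaf)

lemma SU_ops:
  "\<zero>\<^bsub>sect SU U\<^esub> = (\<lambda>k\<in>{..m}. \<lambda>x. 0)"
  "s \<oplus>\<^bsub>sect SU U\<^esub> t = (\<lambda>k\<in>{..m}. \<lambda>x. s k x + t k x)"
  "r \<odot>\<^bsub>sect SU U\<^esub> s = (\<lambda>k\<in>{..m}. \<lambda>x. r x * s k x)"
  "res SU U T s = (\<lambda>k\<in>{..m}. ores T (s k))"
  by (simp_all add: SU_dsum sect_dsum sect_line_sheaf)

lemma mult_g_hom: "sheaf_hom m O\<gamma> SU (mult_g n g)"
proof (rule sheaf_homI)
  fix U assume U: "zopen m U"
  fix s assume "s \<in> secs O\<gamma> U"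
  then have s: "s \<in> osect m (- \<gamma>) U" by (simp add: sect_line_sheaf)
  show "mult_g n g U s \<in> secs SU U"
    unfolding SU_carrier mult_g_def
    by (intro restrict_PiE_iff[THEN iffD2] ballI osect_form_mult[OF U g_forms s]) (auto simp: sw_def)
  show "mult_g n g U (s \<oplus>\<^bsub>sect O\<gamma> U\<^esub> t) = mult_g n g U s \<oplus>\<^bsub>sect SU U\<^esub> mult_g n g U t" for t
    unfolding mult_g_def SU_ops sect_line_sheaf by (intro restrict_ext ext) (simp add: distrib_left)
  show "mult_g n g U (r \<odot>\<^bsub>sect O\<gamma> U\<^esub> s) = r \<odot>\<^bsub>sect SU U\<^esub> mult_g n g U s" for r
    unfolding mult_g_def SU_ops sect_line_sheaf by (intro restrict_ext ext) simp
  show "res SU U T (mult_g n g U s) = mult_g n g T (res O\<gamma> U T s)" for T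
    unfolding mult_g_def SU_ops sect_line_sheaf by (intro restrict_ext ext) (simp add: ores_def)
qed

lemma wedge_coords_apply:
  "k \<in> K \<Longrightarrow> wedge_coords U s k x = (\<Sum>(i, j)\<in>pairs k. coef k i j * g i x * s j x)"
  by (simp add: wedge_coords_def)

lemma wedge_coords_hom: "sheaf_hom m SU (lines \<gamma>) wedge_coords"
proof (rule sheaf_homI)
  fix U assume U: "zopen m U"
  fix s assume s: "s \<in> secs SU U"
  show "wedge_coords U s \<in> secs (lines \<gamma>) U"
    unfolding lines_ops wedge_coords_def
  proof (intro restrict_PiE_iff[THEN iffD2] ballI osect_sum[OF U finite_pairs])
    fix k p assume "p \<in> pairs k"
    then obtain i j where p: "p = (i, j)" and ij: "i \<le> m" "j \<le> m" "k = i + j" by auto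
    have "(\<lambda>x. g i x * s j x) \<in> osect m (wt (i + j) + \<gamma>) U"
      by (rule osect_form_mult[OF U g_forms[OF ij(1)] SU_sect[OF s ij(2)]]) (simp add: wt_def sw_def algebra_simps)
    from osect_const_mult[OF U this, of "coef (i + j) i j"]
    show "(\<lambda>x. case p of (i, j) \<Rightarrow> coef k i j * g i x * s j x) \<in> osect m (wt k + \<gamma>) U"
      unfolding p ij(3) prod.case by (simp only: mult.assoc)
  qed
  show "wedge_coords U (s \<oplus>\<^bsub>sect SU U\<^esub> t) = wedge_coords U s \<oplus>\<^bsub>sect (lines \<gamma>) U\<^esub> wedge_coords U t" for t
    unfolding wedge_coords_def SU_ops lines_ops
    by (intro restrict_ext ext) (auto simp: sum.distrib[symmetric] distrib_left intro!: sum.cong)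
  show "wedge_coords U (r \<odot>\<^bsub>sect SU U\<^esub> s) = r \<odot>\<^bsub>sect (lines \<gamma>) U\<^esub> wedge_coords U s" for r
    unfolding wedge_coords_def SU_ops lines_ops
    by (intro restrict_ext ext) (auto simp: sum_distrib_left intro!: sum.cong)
  show "res (lines \<gamma>) U T (wedge_coords U s) = wedge_coords T (res SU U T s)" for T
    unfolding wedge_coords_def SU_ops lines_ops
    by (intro restrict_ext ext) (auto simp: ores_def intro!: sum.cong sum.neutral)
qed

text \<open>\<open>v \<and> v = 0\<close> in coordinates: interchanging the indices changes the sign
  of \<open>coef\<close>, so the sum equals its own negative. For \<open>v = g\<close> it makes
  \<open>wedge_coords\<close> descend to the quotient bundle.\<close>

lemma antisymmetric_sum:
  fixes v :: "nat \<Rightarrow> complex"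
  assumes k: "k \<in> K"
  shows "(\<Sum>(i, j)\<in>pairs k. coef k i j * v i * v j) = 0"
proof -
  have "(\<Sum>(i, j)\<in>pairs k. coef k i j * v i * v j) = (\<Sum>(j, i)\<in>pairs k. coef k i j * v i * v j)"
    by (rule sum.reindex_bij_witness[of _ prod.swap prod.swap]) auto
  also have "\<dots> = (\<Sum>(i, j)\<in>pairs k. - (coef k i j * v i * v j))"
  proof (rule sum.cong[OF refl])
    fix p assume "p \<in> pairs k"
    then obtain i j where p: "p = (i, j)" and ij: "i \<le> 2*n+1" "j \<le> 2*n+1" "i + j = k" by auto
    show "(case p of (j, i) \<Rightarrow> coef k i j * v i * v j) = (case p of (i, j) \<Rightarrow> - (coef k i j * v i * v j))"
      unfolding p prod.case coef_swap[OF k ij] by simp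
  qed
  also have "\<dots> = - (\<Sum>(i, j)\<in>pairs k. coef k i j * v i * v j)"
    by (simp add: sum_negf case_prod_beta)
  finally show ?thesis by simp
qed

lemma wedge_coords_mult_g: "wedge_coords U (mult_g n g U h) = \<zero>\<^bsub>sect (lines \<gamma>) U\<^esub>"
  unfolding wedge_coords_def lines_ops
proof (intro restrict_ext ext)
  fix k x assume k: "k \<in> K"
  have "(\<Sum>(i, j)\<in>pairs k. coef k i j * g i x * mult_g n g U h j x) =
      (\<Sum>(i, j)\<in>pairs k. coef k i j * g i x * g j x) * h x"
    unfolding sum_distrib_right by (rule sum.cong) (auto simp: mult_g_def)
  then show "(\<Sum>(i, j)\<in>pairs k. coef k i j * g i x * mult_g n g U h j x) = 0"
    using antisymmetric_sum[OF k, of "\<lambda>i. g i x"] by simp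
qed

sublocale Q: coker m O\<gamma> SU "mult_g n g"
  using O_sheaf SU_sheaf mult_g_hom
  by (simp add: coker_def coker_axioms_def sheaf_mod_def mod_presheaf_def)

lemma QB_eq: "QB = Q.CK"
  by (simp add: quotient_bundle_def)

sublocale wc: coker_factor m O\<gamma> SU "mult_g n g" "lines \<gamma>" wedge_coords
  by (intro coker_factor.intro coker_factor_axioms.intro Q.coker_axioms lines_sheaf wedge_coords_hom
      wedge_coords_mult_g)

text \<open>The map \<open>w\<close> of the overview, before the twist by
  \<open>O(-\<gamma>)\<close>.\<close>

abbreviation \<Lambda> where "\<Lambda> \<equiv> wc.lift"

lemma Lambda_hom: "sheaf_hom m QB (lines \<gamma>) \<Lambda>"
  unfolding QB_eq by (rule wc.lift_hom)

lemma Lambda_sect: "zopen m U \<Longrightarrow> s \<in> secs QB U \<Longrightarrow> \<Lambda> U s \<in> secs (lines \<gamma>) U"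
  using sheaf_homD(1)[OF Lambda_hom] .

lemma point_nonzero:
  assumes "L \<in> proj m"
  obtains i where "i \<le> m" "zopen m (basic_open m (g i))" "L \<in> basic_open m (g i)"
proof -
  obtain x where x: "x \<in> L" using proj_nonempty[OF assms] by blast
  then obtain i where i: "i \<le> m" "g i x \<noteq> 0"
    using g_no_common_zero[OF proj_point(1,2)[OF assms x]] by blast
  have "L \<in> basic_open m (g i)" using basic_open_iff[OF g_forms[OF i(1)] assms x] i(2) by simp
  then show ?thesis using that[OF i(1)] openin_basic_open[OF g_forms[OF i(1)]] by blast
qed

lemma basic_open_nonzero: "x \<in> \<Union>(U \<inter> basic_open m h) \<Longrightarrow> h x \<noteq> 0"
  unfolding basic_open_def by blast

text \<open>The local core of injectivity. Equal coordinates give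
  \<open>g \<and> (c - b) = 0\<close>, so by \<open>wedge_zero\<close> the difference is
  proportional to \<open>g\<close>. Where \<open>g i0\<close> has no zero, the factor is the
  quotient of the components at \<open>i0\<close>; its degree
  \<open>sw i0 - (\<gamma> + sw i0)\<close> is \<open>-\<gamma>\<close>, as the source of
  \<open>mult_g\<close> demands.\<close>

lemma wedge_coords_eq_congruent:
  assumes T: "zopen m T" and b: "b \<in> secs SU T" and c: "c \<in> secs SU T"
    and eq: "wedge_coords T b = wedge_coords T c" and L: "L \<in> T"
  shows "Q.congruent L T b T c"
proof -
  have Tp: "T \<subseteq> proj m" by (rule open_subset_proj[OF T])
  from L Tp obtain i0 where i0: "i0 \<le> m" "zopen m (basic_open m (g i0))" "L \<in> basic_open m (g i0)"
    using point_nonzero[of L] by blast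
  let ?S = "T \<inter> basic_open m (g i0)"
  have S: "zopen m ?S" using T i0(2) by auto
  let ?a = "\<lambda>x. ores ?S (\<lambda>x. 1 / g i0 x) x * (ores ?S (c i0) x + (-1) * ores ?S (b i0) x)"
  have inv: "ores ?S (\<lambda>x. 1 / g i0 x) \<in> osect m (- (\<gamma> + (2 * int n + 1) * \<alpha> + int i0 * (\<beta> - \<alpha>))) ?S"
    by (rule osect_quotient[OF S form_const g_forms[OF i0(1)]]) (rule basic_open_nonzero, assumption, simp)
  have "(\<lambda>x. ores ?S (c i0) x + (-1) * ores ?S (b i0) x) \<in> osect m (sw i0) ?S"
    by (intro osect_add osect_const_mult[OF S] osect_ores[OF S _ SU_sect[OF b i0(1)]]
        osect_ores[OF S _ SU_sect[OF c i0(1)]]) auto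
  from osect_mult[OF inv this] have a: "?a \<in> secs O\<gamma> ?S"
    by (simp add: sect_line_sheaf sw_def)
  have main: "c j x = b j x + g j x * ?a x" if x: "x \<in> \<Union>?S" and j: "j \<le> m" for x j
  proof -
    have gx: "g i0 x \<noteq> 0" by (rule basic_open_nonzero[OF x])
    \<comment> \<open>\<open>wedge_zero\<close> speaks of \<open>vecs m\<close>, while the
      components beyond \<open>m\<close> are unspecified here; hence the cut-off.\<close>
    let ?u = "\<lambda>i. if i \<le> m then g i x else 0" and ?v = "\<lambda>i. if i \<le> m then c i x - b i x else 0"
    have "?u i0 * ?v j = ?u j * ?v i0"
    proof (rule wedge_zero)
      show "?u \<in> vecs m" "?v \<in> vecs m" by (auto simp: vecs_def)
      fix k assume k: "k \<in> K"
      have "(\<Sum>(i, j)\<in>pairs k. ?u i * ?v j * coef k i j) =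
        (\<Sum>(i, j)\<in>pairs k. coef k i j * g i x * c j x) - (\<Sum>(i, j)\<in>pairs k. coef k i j * g i x * b j x)"
        unfolding sum_subtractf[symmetric] by (rule sum.cong) (auto simp: algebra_simps)
      also have "\<dots> = wedge_coords T c k x - wedge_coords T b k x" by (simp only: wedge_coords_apply[OF k])
      finally show "(\<Sum>(i, j)\<in>pairs k. ?u i * ?v j * coef k i j) = 0" by (simp add: eq)
    qed
    then have "g i0 x * (c j x - b j x) = g j x * (c i0 x - b i0 x)" using i0(1) j by simp
    then have "c j x - b j x = g j x * ((c i0 x - b i0 x) / g i0 x)" using gx by (simp add: field_simps)
    moreover have "?a x = (c i0 x - b i0 x) / g i0 x" using x by (simp add: ores_def)
    ultimately have "c j x - b j x = g j x * ?a x" by (simp only:)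
    then show ?thesis by (simp only: diff_eq_eq add.commute)
  qed
  show ?thesis
  proof (rule Q.congruentI[OF S _ _ _ a])
    show "res SU T ?S c = res SU T ?S b \<oplus>\<^bsub>sect SU ?S\<^esub> mult_g n g ?S ?a"
      unfolding SU_ops mult_g_def
    proof (intro restrict_ext ext)
      fix j x assume j: "j \<in> {..m}"
      show "ores ?S (c j) x = (\<lambda>k\<in>{..m}. ores ?S (b k)) j x + (\<lambda>i\<in>{..m}. \<lambda>x. g i x * ?a x) j x"
        using main[of x j] j by (cases "x \<in> \<Union>?S") (simp_all add: ores_def)
    qed
  qed (use L i0 in auto)
qed

lemma Lambda_inj:
  assumes U: "zopen m U"
  shows "inj_on (\<Lambda> U) (secs QB U)"
proof (rule inj_onI)
  fix s t assume s: "s \<in> secs QB U" and t: "t \<in> secs QB U" and eq: "\<Lambda> U s = \<Lambda> U t"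
  note st = s[unfolded QB_eq] t[unfolded QB_eq]
  show "s = t"
  proof (rule extensionalityI[of s U t])
    show "s \<in> extensional U" "t \<in> extensional U" using st unfolding Q.coker_carrier_iff by auto
    fix L assume L: "L \<in> U"
    from st L obtain T b c where T: "zopen m T" "L \<in> T" "T \<subseteq> U" "Q.rep s T b" "Q.rep t T c" by (rule Q.rep_common)
    have bc: "b \<in> secs SU T" "c \<in> secs SU T" using T unfolding Q.rep_def by auto
    have "wedge_coords T b = wedge_coords T c"
      using wc.lift_rep[OF U st(1) T(3,4)] wc.lift_rep[OF U st(2) T(3,5)] eq by simp
    then have "Q.congruent L T b T c" by (rule wedge_coords_eq_congruent[OF T(1) bc _ T(2)])
    then have "Q.germ L T b = Q.germ L T c" by (rule Q.germ_eqI[OF _ T(1,1) bc])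
    then show "s L = t L" using T unfolding Q.rep_def by simp
  qed
qed

lemma Lambda_proj:
  assumes "zopen m U" "b \<in> secs SU U"
  shows "\<Lambda> U (coker_proj m O\<gamma> SU (mult_g n g) U b) = wedge_coords U b"
proof -
  let ?s = "coker_proj m O\<gamma> SU (mult_g n g) U b"
  have s: "?s \<in> secs Q.CK U" by (rule Q.proj_closed[OF assms])
  have "res (lines \<gamma>) U U (\<Lambda> U ?s) = wedge_coords U b"
    by (rule wc.lift_rep[OF assms(1) s order_refl Q.rep_proj[OF assms]])
  then show ?thesis using wc.C.res_self[OF assms(1) wc.lift_closed[OF assms(1) s]] by simp
qed

lemma Lambda_zero: "zopen m U \<Longrightarrow> \<Lambda> U \<zero>\<^bsub>sect QB U\<^esub> = \<zero>\<^bsub>sect (lines \<gamma>) U\<^esub>"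
proof -
  assume U: "zopen m U"
  have "wedge_coords U \<zero>\<^bsub>sect SU U\<^esub> = \<zero>\<^bsub>sect (lines \<gamma>) U\<^esub>"
    by (rule sheaf_hom_zero[OF wedge_coords_hom Q.B.mod_presheaf_axioms wc.C.mod_presheaf_axioms U])
  then show ?thesis unfolding QB_eq Q.coker_zero using Lambda_proj[OF U Q.B.zero_closed[OF U]] by simp
qed

lemma QB_presheaf: "mod_presheaf m QB"
  by (rule mod_presheaf_inj[OF Q.coker_closed[folded QB_eq] wc.C.mod_presheaf_axioms Lambda_hom])
    (erule Lambda_inj Lambda_zero)+

section \<open>The correlation map and the wedge map in coordinates\<close>

lemma f_coef:
  assumes "i \<le> m" "j \<le> m"
  shows "f (basis_wedge i j) = (if i + j = m then coef m i j else 0)"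
proof (cases "i + j = m")
  case True
  then have "basis_wedge i j \<in> ext2_weight n m" using assms by (intro basis_wedge_in_weight) auto
  then show ?thesis using f_theta True by (simp add: coef_def)
next
  case False
  show ?thesis
  proof (cases "i + j \<in> K")
    case True
    then have "i + j \<in> K - {2*n+1}" using False by blast
    from bspec[OF bspec[OF f_weight this] basis_wedge_in_weight[OF assms refl]] False
    show ?thesis by (simp only: if_False)
  next
    case False
    \<comment> \<open>Outside \<open>K\<close> the weight is 0 or 4n+2, and each of these is reached
      by equal indices only.\<close>
    then have "i = j" using assms by auto
    then show ?thesis using \<open>i + j \<noteq> m\<close> f_zero by (simp only: basis_wedge_self if_False)
  qed
qed

text \<open>Sorting the double sum by weight, \<open>f_coef\<close> removes every weight except the
  middle one, where \<open>f\<close> is the coordinate.\<close>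

lemma corr_wedge_coords:
  "(\<Sum>i\<le>m. \<Sum>j\<le>m. f (basis_wedge i j) * g i x * s j x) = wedge_coords U s m x"
proof -
  have "(\<Sum>i\<le>m. \<Sum>j\<le>m. f (basis_wedge i j) * g i x * s j x) =
    (\<Sum>k\<le>2*m. \<Sum>(i, j)\<in>pairs k. f (basis_wedge i j) * g i x * s j x)"
    by (rule sum_by_weight)
  also have "\<dots> = (\<Sum>k\<le>2*m. if k = m then \<Sum>(i, j)\<in>pairs m. coef m i j * g i x * s j x else 0)"
    by (rule sum.cong[OF refl]) (auto simp: f_coef intro!: sum.cong sum.neutral)
  also have "\<dots> = wedge_coords U s m x" by (simp add: wedge_coords_apply)
  finally show ?thesis .
qed

lemma lines_proj_hom:
  "k \<in> K \<Longrightarrow> sheaf_hom m (lines e) (line_sheaf m (wt k + e)) (\<lambda>U s. s k)"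
  by (rule sheaf_homI) (auto simp: lines_ops sect_line_sheaf PiE_iff)

text \<open>Before passing to the quotient this is \<open>corr_wedge_coords\<close>; uniqueness of
  lifts carries it over. The degrees match because \<open>wt m\<close> equals (2n+1)(\<alpha> +
  \<beta>).\<close>

lemma corr_map_eq:
  assumes U: "zopen m U" and s: "s \<in> secs QB U"
  shows "corr_map n \<alpha> \<beta> \<gamma> g f U s = \<Lambda> U s m"
proof -
  let ?c = "\<lambda>U s x. \<Sum>i\<le>m. \<Sum>j\<le>m. f (basis_wedge i j) * g i x * s j x"
  have mK: "m \<in> K" by auto
  have deg: "\<gamma> + (2 * int n + 1) * (\<alpha> + \<beta>) = wt m + \<gamma>" by (simp add: wt_def algebra_simps)
  have eq: "?c U s = wedge_coords U s m" for U s by (rule ext) (rule corr_wedge_coords)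
  have h: "sheaf_hom m SU (line_sheaf m (wt m + \<gamma>)) ?c"
    by (rule sheaf_hom_cong[OF sheaf_hom_compose[OF wedge_coords_hom lines_proj_hom[OF mK]]
        Q.B.mod_closed_axioms eq])
  have cf: "coker_factor m O\<gamma> SU (mult_g n g) (line_sheaf m (wt m + \<gamma>)) ?c"
  proof (intro coker_factor.intro coker_factor_axioms.intro Q.coker_axioms sheaf_mod_line h)
    fix U a
    have "wedge_coords U (mult_g n g U a) m = (\<lambda>x. 0)"
      unfolding wedge_coords_mult_g lines_ops using mK by (simp only: restrict_apply if_True)
    then show "?c U (mult_g n g U a) = \<zero>\<^bsub>sect (line_sheaf m (wt m + \<gamma>)) U\<^esub>"
      unfolding sect_line_sheaf by (rule trans[OF eq])
  qed
  show ?thesis unfolding corr_map_def deg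
    by (rule wc.lift_compose[OF cf lines_proj_hom[OF mK] eq U s[unfolded QB_eq]])
qed

definition to_cosets :: "pset \<Rightarrow> (nat \<Rightarrow> cvec \<Rightarrow> complex) \<Rightarrow> nat \<Rightarrow> cvec \<Rightarrow> bivec set" where
  "to_cosets U h = (\<lambda>k\<in>K. to_coset k U (h k))"

abbreviation EQ :: "int \<Rightarrow> (nat \<Rightarrow> cvec \<Rightarrow> bivec set) mod_sheaf" where
  "EQ e \<equiv> ext2_quot_sheaf n \<alpha> \<beta> W e"


lemma EQ_dsum: "EQ e = dsum K (\<lambda>k. quotk m (wt k + e) k)"
  by (simp add: ext2_quot_sheaf_def wt_def)

lemma to_cosets_hom: "sheaf_hom m (lines e) (EQ e) to_cosets"
  unfolding EQ_dsum lines_def to_cosets_def by (rule dsum_hom) (rule to_coset_hom)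

lemma to_cosets_surj: "zopen m U \<Longrightarrow> to_cosets U ` secs (lines e) U = secs (EQ e) U"
  unfolding EQ_dsum lines_def to_cosets_def
  by (rule dsum_hom_surj) (simp only: sect_line_sheaf to_coset_surj)

lemma to_cosets_inj: "inj_on (to_cosets U) (secs (lines e) U)"
  unfolding lines_def to_cosets_def
  by (rule dsum_hom_inj) (simp only: sect_line_sheaf to_coset_inj)

lemma to_cosets_zero: "to_cosets U \<zero>\<^bsub>sect (lines e) U\<^esub> = \<zero>\<^bsub>sect (EQ e) U\<^esub>"
  unfolding EQ_dsum lines_ops sect_dsum sect_quot to_cosets_def
  by (intro restrict_ext) (simp only: restrict_apply if_True to_coset_zero)

lemma EQ_sheaf: "sheaf_mod m (EQ e)"
  by (rule sheaf_mod_iso[OF lines_sheaf to_cosets_hom])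
    (erule to_cosets_surj, rule to_cosets_inj, rule to_cosets_zero)

text \<open>Again uniqueness of lifts, now with the trivialisation \<open>to_cosets\<close> after
  \<open>\<Lambda>\<close>: modulo the hyperplane, \<open>coset_theta\<close> replaces the component
  of weight \<open>k\<close> by its coordinate times \<open>D k\<close>.\<close>

lemma wedge_map_eq:
  assumes U: "zopen m U" and s: "s \<in> secs QB U"
  shows "wedge_map n \<alpha> \<beta> \<gamma> g W U s = to_cosets U (\<Lambda> U s)"
proof -
  let ?w = "\<lambda>U s. \<lambda>k\<in>{1..4*n+1}. \<lambda>x. if x \<in> \<Union>U
          then coset (W \<inter> ext2_weight n k)
            (\<lambda>pq. \<Sum>(i, j)\<in>{(i, j). i \<le> 2*n+1 \<and> j \<le> 2*n+1 \<and> i + j = k}.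
               g i x * s j x * basis_wedge i j pq)
          else {}"
  have eq: "?w U s = to_cosets U (wedge_coords U s)" for U s
    unfolding to_cosets_def
  proof (rule restrict_ext)
    fix k assume k: "k \<in> K"
    have "coset (Wk k) (\<lambda>pq. \<Sum>(i, j)\<in>pairs k. g i x * s j x * basis_wedge i j pq) =
      coset (Wk k) (scl (wedge_coords U s k x) (D k))" for x
    proof -
      have "(\<Sum>(i, j)\<in>pairs k. g i x * s j x * coef k i j) = wedge_coords U s k x"
        unfolding wedge_coords_apply[OF k] by (rule sum.cong) (auto simp: mult_ac)
      then show ?thesis
        using coset_theta[OF k theta_pairs(2)[OF k, of "\<lambda>i j. g i x * s j x"]]
        unfolding theta_pairs(1)[OF k, of "\<lambda>i j. g i x * s j x"] by simp
    qed
    then show "(\<lambda>x. if x \<in> \<Union>U then coset (Wk k) (\<lambda>pq. \<Sum>(i, j)\<in>pairs k. g i x * s j x * basis_wedge i j pq) else {})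
      = to_coset k U (wedge_coords U s k)" unfolding to_coset_def by (simp only:)
  qed
  have h: "sheaf_hom m SU (EQ \<gamma>) ?w"
    by (rule sheaf_hom_cong[OF sheaf_hom_compose[OF wedge_coords_hom to_cosets_hom]
        Q.B.mod_closed_axioms eq])
  have cf: "coker_factor m O\<gamma> SU (mult_g n g) (EQ \<gamma>) ?w"
  proof (intro coker_factor.intro coker_factor_axioms.intro Q.coker_axioms EQ_sheaf h)
    fix U a
    have "to_cosets U (wedge_coords U (mult_g n g U a)) = \<zero>\<^bsub>sect (EQ \<gamma>) U\<^esub>"
      unfolding wedge_coords_mult_g by (rule to_cosets_zero)
    then show "?w U (mult_g n g U a) = \<zero>\<^bsub>sect (EQ \<gamma>) U\<^esub>" by (rule trans[OF eq])
  qed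
  show ?thesis unfolding wedge_map_def
    by (rule wc.lift_compose[OF cf to_cosets_hom eq U s[unfolded QB_eq]])
qed

end

section \<open>The twist by \<open>O(-\<gamma>)\<close> in coordinates\<close>

lemma sect_ker:
  "secs (ker_sheaf A B \<phi>) U = ker_sect A B \<phi> U"
  "\<zero>\<^bsub>sect (ker_sheaf A B \<phi>) U\<^esub> = \<zero>\<^bsub>sect A U\<^esub>"
  "s \<oplus>\<^bsub>sect (ker_sheaf A B \<phi>) U\<^esub> t = s \<oplus>\<^bsub>sect A U\<^esub> t"
  "r \<odot>\<^bsub>sect (ker_sheaf A B \<phi>) U\<^esub> s = r \<odot>\<^bsub>sect A U\<^esub> s"
  "res (ker_sheaf A B \<phi>) U T s = res A U T s"
  by (simp_all add: ker_sheaf_def)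

context tango_bundles
begin

abbreviation TQ where "TQ \<equiv> twist m (- \<gamma>) QB"

text \<open>The twisted map in coordinates. A family over the charts becomes one function after
  multiplication by \<open>x i powi (-\<gamma>)\<close>, the trivialisation of
  \<open>O(-\<gamma>)\<close> on the chart. The least nonzero coordinate only fixes a choice; by
  \<open>untwist_chart\<close> any chart through the point gives the same value.\<close>

definition untwist where
  "untwist U s = (\<lambda>k\<in>K. \<lambda>x. if x \<in> \<Union>U
     then (let i = (LEAST i. x i \<noteq> 0) in x i powi (- \<gamma>) * \<Lambda> (U \<inter> chart m i) (s i) k x) else 0)"

lemma TQ_closed: "mod_closed m TQ"
  by (rule mod_closed_twist[OF QB_presheaf])

lemma TQ_sect: "s \<in> secs TQ U \<Longrightarrow> i \<le> m \<Longrightarrow> s i \<in> secs QB (U \<inter> chart m i)"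
  by (auto simp: sect_twist PiE_iff)

lemma zop_chart: "zopen m U \<Longrightarrow> i \<le> m \<Longrightarrow> zopen m (U \<inter> chart m i)"
  using openin_chart by blast

lemma least_coord:
  assumes "zopen m U" "x \<in> \<Union>U"
  shows "(LEAST i. x i \<noteq> 0) \<le> m" "x (LEAST i. x i \<noteq> 0) \<noteq> 0"
    "x \<in> \<Union>(U \<inter> chart m (LEAST i. x i \<noteq> 0))"
proof -
  have U: "U \<subseteq> proj m" by (rule open_subset_proj[OF assms(1)])
  obtain i where i: "i \<le> m" "x i \<noteq> 0" using cone_nonzero_coord[OF U assms(2)] by blast
  show "(LEAST i. x i \<noteq> 0) \<le> m" using Least_le[of "\<lambda>i. x i \<noteq> 0" i] i by simp
  show "x (LEAST i. x i \<noteq> 0) \<noteq> 0" using LeastI[of "\<lambda>i. x i \<noteq> 0" i] i by simp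
  then show "x \<in> \<Union>(U \<inter> chart m (LEAST i. x i \<noteq> 0))" using cone_chart[OF U] assms(2) by blast
qed

lemma untwist_least:
  assumes "k \<in> K" "x \<in> \<Union>U"
  shows "untwist U s k x = x (LEAST i. x i \<noteq> 0) powi (- \<gamma>) *
    \<Lambda> (U \<inter> chart m (LEAST i. x i \<noteq> 0)) (s (LEAST i. x i \<noteq> 0)) k x"
  using assms unfolding untwist_def Let_def by (simp only: restrict_apply if_True)

lemma untwist_outside: "k \<in> K \<Longrightarrow> x \<notin> \<Union>U \<Longrightarrow> untwist U s k x = 0"
  unfolding untwist_def by (simp only: restrict_apply if_True if_False)

lemma Lambda_res:
  assumes "zopen m U" "zopen m T" "T \<subseteq> U" "s \<in> secs QB U" "k \<in> K"
  shows "\<Lambda> T (res QB U T s) k = ores T (\<Lambda> U s k)"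
  using fun_cong[OF sheaf_homD(4)[OF Lambda_hom assms(1-4)], of k] assms(5) by (simp add: lines_ops)

text \<open>Since \<open>\<Lambda>\<close> is linear over functions of degree 0, it turns the gluing
  condition of the family, an equation between cokernel sections, into an equation between complex
  values.\<close>

lemma Lambda_chart:
  assumes U: "zopen m U" and s: "s \<in> secs TQ U" and k: "k \<in> K"
    and x: "x \<in> \<Union>U" "i \<le> m" "x i \<noteq> 0" "j \<le> m" "x j \<noteq> 0"
  shows "\<Lambda> (U \<inter> chart m j) (s j) k x = (x i / x j) powi (- \<gamma>) * \<Lambda> (U \<inter> chart m i) (s i) k x"
proof -
  let ?T = "U \<inter> chart m i \<inter> chart m j" and ?r = "\<lambda>x. (x i / x j) powi (- \<gamma>)"
  have T: "zopen m ?T" using zop_chart[OF zop_chart[OF U x(2)] x(4)] .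
  have Ui: "zopen m (U \<inter> chart m i)" "zopen m (U \<inter> chart m j)" using zop_chart[OF U] x by auto
  have xT: "x \<in> \<Union>?T"
    using cone_chart[OF open_subset_proj[OF Ui(1)], of x j] cone_chart[OF open_subset_proj[OF U], of x i] x by simp
  have r: "ores ?T ?r \<in> osect m 0 ?T" by (rule osect_ratio_powi[OF T x(2,4) chart_coord])
  have sub: "?T \<subseteq> U \<inter> chart m i" "?T \<subseteq> U \<inter> chart m j" by auto
  note si = TQ_sect[OF s x(2)] and sj = TQ_sect[OF s x(4)]
  have "res QB (U \<inter> chart m j) ?T (s j) = ores ?T ?r \<odot>\<^bsub>sect QB ?T\<^esub> res QB (U \<inter> chart m i) ?T (s i)"
    using s x unfolding sect_twist by simp
  then have "\<Lambda> ?T (res QB (U \<inter> chart m j) ?T (s j)) =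
    \<Lambda> ?T (ores ?T ?r \<odot>\<^bsub>sect QB ?T\<^esub> res QB (U \<inter> chart m i) ?T (s i))" by simp
  also have "\<dots> = ores ?T ?r \<odot>\<^bsub>sect (lines \<gamma>) ?T\<^esub> \<Lambda> ?T (res QB (U \<inter> chart m i) ?T (s i))"
    by (rule sheaf_homD(3)[OF Lambda_hom T r
        mod_closed.res_closed[OF Q.coker_closed[folded QB_eq] Ui(1) T sub(1) si]])
  finally have "\<Lambda> ?T (res QB (U \<inter> chart m j) ?T (s j)) k x =
      ores ?T ?r x * \<Lambda> ?T (res QB (U \<inter> chart m i) ?T (s i)) k x"
    using k by (simp add: lines_ops)
  then show ?thesis
    unfolding Lambda_res[OF Ui(1) T sub(1) si k] Lambda_res[OF Ui(2) T sub(2) sj k]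
    using xT by (simp add: ores_def)
qed

lemma untwist_chart:
  assumes U: "zopen m U" and s: "s \<in> secs TQ U" and k: "k \<in> K"
    and x: "x \<in> \<Union>U" "i \<le> m" "x i \<noteq> 0"
  shows "untwist U s k x = x i powi (- \<gamma>) * \<Lambda> (U \<inter> chart m i) (s i) k x"
proof -
  let ?j = "LEAST i. x i \<noteq> 0"
  note j = least_coord[OF U x(1)]
  have "untwist U s k x = x ?j powi (- \<gamma>) * ((x i / x ?j) powi (- \<gamma>) * \<Lambda> (U \<inter> chart m i) (s i) k x)"
    unfolding untwist_least[OF k x(1)] Lambda_chart[OF U s k x j(1,2)] ..
  also have "x ?j powi (- \<gamma>) * ((x i / x ?j) powi (- \<gamma>) * \<Lambda> (U \<inter> chart m i) (s i) k x) =
     x i powi (- \<gamma>) * \<Lambda> (U \<inter> chart m i) (s i) k x"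
    using j(2) by (simp add: power_int_divide_distrib)
  finally show ?thesis .
qed

lemma untwist_sect:
  assumes U: "zopen m U" and s: "s \<in> secs TQ U" and k: "k \<in> K"
  shows "untwist U s k \<in> osect m (wt k + 0) U"
proof (rule osect_local)
  show "x \<notin> \<Union>U \<Longrightarrow> untwist U s k x = 0" for x by (rule untwist_outside[OF k])
  fix L assume L: "L \<in> U"
  then obtain i where i: "i \<le> m" "L \<in> chart m i" using proj_in_chart open_subset_proj[OF U] by blast
  let ?T = "U \<inter> chart m i"
  let ?t = "\<lambda>x. ores ?T (\<lambda>x. x i powi (- \<gamma>)) x * \<Lambda> ?T (s i) k x"
  have T: "zopen m ?T" by (rule zop_chart[OF U i(1)])
  have nz: "x i \<noteq> 0" if "x \<in> \<Union>?T" for x using cone_chart[OF open_subset_proj[OF U]] that by blast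
  have "\<Lambda> ?T (s i) k \<in> osect m (wt k + \<gamma>) ?T"
    by (rule lines_sect[OF Lambda_sect[OF T TQ_sect[OF s i(1)]] k])
  moreover have "ores ?T (\<lambda>x. x i powi (- \<gamma>)) \<in> osect m (- \<gamma>) ?T"
    by (rule osect_powi[OF T i(1)]) (rule nz)
  ultimately have "?t \<in> osect m (- \<gamma> + (wt k + \<gamma>)) ?T" by (intro osect_mult)
  then have "?t \<in> osect m (wt k + 0) ?T" by simp
  moreover have "\<forall>x\<in>\<Union>?T. untwist U s k x = ?t x"
  proof
    fix x assume x: "x \<in> \<Union>?T"
    then have "x \<in> \<Union>U" by blast
    from untwist_chart[OF U s k this i(1) nz[OF x]] x show "untwist U s k x = ?t x" by (simp add: ores_def)
  qed
  ultimately show "\<exists>T t. zopen m T \<and> L \<in> T \<and> T \<subseteq> U \<and> t \<in> osect m (wt k + 0) T \<and> (\<forall>x\<in>\<Union>T. untwist U s k x = t x)"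
    using T L i(2) by (intro exI[of _ ?T] exI[of _ ?t]) simp
qed

lemma untwist_hom: "sheaf_hom m TQ (lines 0) untwist"
proof (rule sheaf_homI)
  note h = sheaf_homD[OF Lambda_hom]
  fix U assume U: "zopen m U"
  have ext: "untwist U s = restrict t K" if "\<And>k x. k \<in> K \<Longrightarrow> untwist U s k x = t k x" for U s t
  proof
    fix k show "untwist U s k = restrict t K k"
    proof (cases "k \<in> K")
      case True then show ?thesis using that[OF True] by (intro ext) (simp only: restrict_apply if_True)
    next
      case False then show ?thesis unfolding untwist_def by (simp only: restrict_apply if_False)
    qed
  qed
  fix s assume s: "s \<in> secs TQ U"
  show "untwist U s \<in> secs (lines 0) U"
    unfolding lines_ops
  proof (rule PiE_I)
    show "k \<in> K \<Longrightarrow> untwist U s k \<in> osect m (wt k + 0) U" for k by (rule untwist_sect[OF U s])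
    show "k \<notin> K \<Longrightarrow> untwist U s k = undefined" for k
      unfolding untwist_def by (simp only: restrict_apply if_False)
  qed
  show "untwist U (s \<oplus>\<^bsub>sect TQ U\<^esub> t) = untwist U s \<oplus>\<^bsub>sect (lines 0) U\<^esub> untwist U t"
    if t: "t \<in> secs TQ U" for t
    unfolding lines_ops
  proof (rule ext)
    fix k x assume k: "k \<in> K"
    show "untwist U (s \<oplus>\<^bsub>sect TQ U\<^esub> t) k x = untwist U s k x + untwist U t k x"
    proof (cases "x \<in> \<Union>U")
      case False then show ?thesis by (simp only: untwist_outside[OF k False] add_0)
    next
      case True
      define i where "i = (LEAST i. x i \<noteq> 0)"
      have i: "i \<le> m" using least_coord(1)[OF U True] by (simp only: i_def)
      have "\<Lambda> (U \<inter> chart m i) (s i \<oplus>\<^bsub>sect QB (U \<inter> chart m i)\<^esub> t i) k x =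
          \<Lambda> (U \<inter> chart m i) (s i) k x + \<Lambda> (U \<inter> chart m i) (t i) k x"
        unfolding h(2)[OF zop_chart[OF U i] TQ_sect[OF s i] TQ_sect[OF t i]] lines_ops
        using k by (simp only: restrict_apply if_True)
      moreover have "(s \<oplus>\<^bsub>sect TQ U\<^esub> t) i = s i \<oplus>\<^bsub>sect QB (U \<inter> chart m i)\<^esub> t i"
        using i by (simp add: sect_twist)
      ultimately show ?thesis
        unfolding untwist_least[OF k True] i_def[symmetric] by (simp only: distrib_left)
    qed
  qed
  show "untwist U (r \<odot>\<^bsub>sect TQ U\<^esub> s) = r \<odot>\<^bsub>sect (lines 0) U\<^esub> untwist U s"
    if r: "r \<in> osect m 0 U" for r
    unfolding lines_ops
  proof (rule ext)
    fix k x assume k: "k \<in> K"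
    show "untwist U (r \<odot>\<^bsub>sect TQ U\<^esub> s) k x = r x * untwist U s k x"
    proof (cases "x \<in> \<Union>U")
      case False then show ?thesis by (simp only: untwist_outside[OF k False] mult_zero_right)
    next
      case True
      define i where "i = (LEAST i. x i \<noteq> 0)"
      have i: "i \<le> m" "x \<in> \<Union>(U \<inter> chart m i)" using least_coord(1,3)[OF U True] by (simp_all only: i_def)
      have "ores (U \<inter> chart m i) r \<in> osect m 0 (U \<inter> chart m i)"
        by (rule osect_ores[OF zop_chart[OF U i(1)] _ r]) auto
      from h(3)[OF zop_chart[OF U i(1)] this TQ_sect[OF s i(1)]]
      have "\<Lambda> (U \<inter> chart m i) (ores (U \<inter> chart m i) r \<odot>\<^bsub>sect QB (U \<inter> chart m i)\<^esub> s i) k x =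
          ores (U \<inter> chart m i) r x * \<Lambda> (U \<inter> chart m i) (s i) k x"
        using k by (simp add: lines_ops)
      also have "ores (U \<inter> chart m i) r x = r x" using i(2) by (simp add: ores_def)
      finally have "\<Lambda> (U \<inter> chart m i) (ores (U \<inter> chart m i) r \<odot>\<^bsub>sect QB (U \<inter> chart m i)\<^esub> s i) k x =
          r x * \<Lambda> (U \<inter> chart m i) (s i) k x" .
      moreover have "(r \<odot>\<^bsub>sect TQ U\<^esub> s) i = ores (U \<inter> chart m i) r \<odot>\<^bsub>sect QB (U \<inter> chart m i)\<^esub> s i"
        using i by (simp add: sect_twist)
      ultimately show ?thesis
        unfolding untwist_least[OF k True] i_def[symmetric] by (simp only: mult.left_commute)
    qed
  qed
  show "res (lines 0) U T (untwist U s) = untwist T (res TQ U T s)" if T: "zopen m T" "T \<subseteq> U" for T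
    unfolding lines_ops
  proof (rule ext[symmetric])
    fix k x assume k: "k \<in> K"
    show "untwist T (res TQ U T s) k x = ores T (untwist U s k) x"
    proof (cases "x \<in> \<Union>T")
      case False then show ?thesis by (simp add: untwist_outside[OF k False] ores_def)
    next
      case True
      then have xU: "x \<in> \<Union>U" using T(2) by blast
      define i where "i = (LEAST i. x i \<noteq> 0)"
      have i: "i \<le> m" "x \<in> \<Union>(T \<inter> chart m i)" using least_coord(1,3)[OF T(1) True] by (simp_all only: i_def)
      have sub: "T \<inter> chart m i \<subseteq> U \<inter> chart m i" using T(2) by auto
      have "\<Lambda> (T \<inter> chart m i) (res QB (U \<inter> chart m i) (T \<inter> chart m i) (s i)) k x = \<Lambda> (U \<inter> chart m i) (s i) k x"
        unfolding Lambda_res[OF zop_chart[OF U i(1)] zop_chart[OF T(1) i(1)] sub TQ_sect[OF s i(1)] k]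
        using i(2) by (simp add: ores_def)
      moreover have "res TQ U T s i = res QB (U \<inter> chart m i) (T \<inter> chart m i) (s i)"
        using i by (simp add: sect_twist)
      moreover have "ores T (untwist U s k) x = untwist U s k x" using True by (simp add: ores_def)
      ultimately show ?thesis
        unfolding untwist_least[OF k True] untwist_least[OF k xU] i_def[symmetric] by (simp only:)
    qed
  qed
qed

lemma untwist_zero:
  assumes U: "zopen m U"
  shows "untwist U \<zero>\<^bsub>sect TQ U\<^esub> = \<zero>\<^bsub>sect (lines 0) U\<^esub>"
  unfolding lines_ops untwist_def
proof (intro restrict_ext HOL.ext)
  fix k x assume k: "k \<in> K"
  show "(if x \<in> \<Union>U then let i = LEAST i. x i \<noteq> 0 in
      x i powi - \<gamma> * \<Lambda> (U \<inter> chart m i) (\<zero>\<^bsub>sect TQ U\<^esub> i) k x else 0) = 0"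
  proof (cases "x \<in> \<Union>U")
    case True
    define i where "i = (LEAST i. x i \<noteq> 0)"
    have i: "i \<le> m" using least_coord(1)[OF U True] by (simp only: i_def)
    have "\<zero>\<^bsub>sect TQ U\<^esub> i = \<zero>\<^bsub>sect QB (U \<inter> chart m i)\<^esub>" using i by (simp add: sect_twist)
    then have "\<Lambda> (U \<inter> chart m i) (\<zero>\<^bsub>sect TQ U\<^esub> i) k x = 0"
      using Lambda_zero[OF zop_chart[OF U i]] k by (simp add: lines_ops)
    then show ?thesis unfolding i_def[symmetric] Let_def by simp
  qed simp
qed

lemma untwist_zeroD:
  assumes U: "zopen m U" and s: "s \<in> secs TQ U" and k: "k \<in> K" and z: "untwist U s k = (\<lambda>x. 0)"
    and i: "i \<le> m"
  shows "\<Lambda> (U \<inter> chart m i) (s i) k = (\<lambda>x. 0)"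
proof
  fix x
  show "\<Lambda> (U \<inter> chart m i) (s i) k x = 0"
  proof (cases "x \<in> \<Union>(U \<inter> chart m i)")
    case True
    then have x: "x \<in> \<Union>U" "x i \<noteq> 0" using cone_chart[OF open_subset_proj[OF U]] by blast+
    from untwist_chart[OF U s k x(1) i x(2)] x(2) z show ?thesis by simp
  next
    case False
    then show ?thesis
      using osect_outside[OF lines_sect[OF Lambda_sect[OF zop_chart[OF U i] TQ_sect[OF s i]] k]] by blast
  qed
qed

text \<open>The powers of \<open>x i\<close> have no zeros on the chart, so \<open>\<Lambda>\<close>
  vanishes on every member of the family, and its injectivity applies chart by chart.\<close>

lemma untwist_ker:
  assumes U: "zopen m U" and s: "s \<in> secs TQ U" and z: "untwist U s = \<zero>\<^bsub>sect (lines 0) U\<^esub>"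
  shows "s = \<zero>\<^bsub>sect TQ U\<^esub>"
proof -
  have "s i = \<zero>\<^bsub>sect QB (U \<inter> chart m i)\<^esub>" if i: "i \<le> m" for i
  proof (rule inj_onD[OF Lambda_inj[OF zop_chart[OF U i]]])
    note o = zop_chart[OF U i]
    show si: "s i \<in> secs QB (U \<inter> chart m i)" by (rule TQ_sect[OF s i])
    show "\<zero>\<^bsub>sect QB (U \<inter> chart m i)\<^esub> \<in> secs QB (U \<inter> chart m i)"
      by (rule mod_closed.zero_closed[OF Q.coker_closed[folded QB_eq] o])
    have "untwist U s k = (\<lambda>x. 0)" if "k \<in> K" for k
      unfolding z lines_ops using that by (simp only: restrict_apply if_True)
    then have "\<Lambda> (U \<inter> chart m i) (s i) k = (\<lambda>x. 0)" if "k \<in> K" for k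
      using untwist_zeroD[OF U s that _ i] that by blast
    then have "\<Lambda> (U \<inter> chart m i) (s i) = (\<lambda>k\<in>K. \<lambda>x. 0)"
      using Lambda_sect[OF o si] unfolding lines_ops
      by (intro extensionalityI[of _ K]) (auto simp only: PiE_iff restrict_extensional restrict_apply if_True)
    then show "\<Lambda> (U \<inter> chart m i) (s i) = \<Lambda> (U \<inter> chart m i) \<zero>\<^bsub>sect QB (U \<inter> chart m i)\<^esub>"
      unfolding Lambda_zero[OF o] lines_ops .
  qed
  then show ?thesis using s unfolding sect_twist
    by (intro extensionalityI[of s "{..m}"]) (auto simp: PiE_iff)
qed

lemma wedge_map_tw_eq:
  assumes U: "zopen m U" and s: "s \<in> secs TQ U"
  shows "wedge_map_tw n \<alpha> \<beta> \<gamma> g W U s = to_cosets U (untwist U s)"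
  unfolding wedge_map_tw_def to_cosets_def
proof (intro restrict_ext HOL.ext)
  fix k x assume k: "k \<in> K"
  show "(if x \<in> \<Union>U then let i = LEAST i. x i \<noteq> 0 in (\<lambda>u pq. x i powi - \<gamma> * u pq) `
      wedge_map n \<alpha> \<beta> \<gamma> g W (U \<inter> chart m i) (s i) k x else {}) = to_coset k U (untwist U s k) x"
  proof (cases "x \<in> \<Union>U")
    case False then show ?thesis unfolding to_coset_def by (simp only: if_False)
  next
    case True
    define i where "i = (LEAST i. x i \<noteq> 0)"
    have i: "i \<le> m" "x i \<noteq> 0" "x \<in> \<Union>(U \<inter> chart m i)" unfolding i_def by (rule least_coord[OF U True])+
    have "wedge_map n \<alpha> \<beta> \<gamma> g W (U \<inter> chart m i) (s i) k x = coset (Wk k) (scl (\<Lambda> (U \<inter> chart m i) (s i) k x) (D k))"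
      unfolding wedge_map_eq[OF zop_chart[OF U i(1)] TQ_sect[OF s i(1)]] to_cosets_def to_coset_def
      using k i(3) by (simp only: restrict_apply if_True)
    moreover have "(\<lambda>u pq. x i powi - \<gamma> * u pq) = scl (x i powi - \<gamma>)" by (intro HOL.ext) (simp add: scl_def)
    moreover have nz: "x i powi - \<gamma> \<noteq> 0" using i(2) by simp
    ultimately show ?thesis using True coset_scale[OF nz, of k]
      unfolding i_def[symmetric] Let_def to_coset_def untwist_least[OF k True]
      by (simp only: if_True scl_scl)
  qed
qed

lemma wedge_map_tw_hom: "sheaf_hom m TQ (EQ 0) (wedge_map_tw n \<alpha> \<beta> \<gamma> g W)"
  by (rule sheaf_hom_cong[OF sheaf_hom_compose[OF untwist_hom to_cosets_hom] TQ_closed wedge_map_tw_eq])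

sublocale F: coker m TQ "EQ 0" "wedge_map_tw n \<alpha> \<beta> \<gamma> g W"
  using TQ_closed EQ_sheaf wedge_map_tw_hom
  by (intro coker.intro coker_axioms.intro) (simp_all only: sheaf_mod_def)

section \<open>The sum of line bundles without the middle weight, and the correlation bundle\<close>

abbreviation Y1 where "Y1 \<equiv> Upsilon1 n \<alpha> \<beta>"

lemma Y1_eq: "Y1 = dsum (K - {m}) (\<lambda>k. line_sheaf m (wt k + 0))"
  unfolding Upsilon1_def wt_def by (simp add: mult_ac)

lemma Y1_sheaf: "sheaf_mod m Y1"
  unfolding Y1_eq by (rule sheaf_mod_dsum) (rule sheaf_mod_line)

definition extend_zero :: "pset \<Rightarrow> (nat \<Rightarrow> cvec \<Rightarrow> complex) \<Rightarrow> nat \<Rightarrow> cvec \<Rightarrow> complex" where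
  "extend_zero U h = (\<lambda>k\<in>K. if k = m then (\<lambda>x. 0) else h k)"

lemma Y1_ops:
  "secs Y1 U = (\<Pi>\<^sub>E k\<in>K - {m}. osect m (wt k + 0) U)"
  "s \<oplus>\<^bsub>sect Y1 U\<^esub> t = (\<lambda>k\<in>K - {m}. \<lambda>x. s k x + t k x)"
  "r \<odot>\<^bsub>sect Y1 U\<^esub> s = (\<lambda>k\<in>K - {m}. \<lambda>x. r x * s k x)"
  "res Y1 U T s = (\<lambda>k\<in>K - {m}. ores T (s k))"
  unfolding Y1_eq by (simp_all only: sect_dsum sect_line_sheaf)

lemma extend_zero_hom: "sheaf_hom m Y1 (lines 0) extend_zero"
proof (rule sheaf_homI)
  fix U assume U: "zopen m U"
  fix s assume s: "s \<in> secs Y1 U"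
  show "extend_zero U s \<in> secs (lines 0) U"
    unfolding lines_ops extend_zero_def
  proof (rule restrict_PiE_iff[THEN iffD2], rule ballI)
    fix k assume "k \<in> K"
    then show "(if k = m then (\<lambda>x. 0) else s k) \<in> osect m (wt k + 0) U"
      using s osect_zero[OF U] unfolding Y1_ops by (cases "k = m") (simp_all add: PiE_iff)
  qed
  show "extend_zero U (s \<oplus>\<^bsub>sect Y1 U\<^esub> t) = extend_zero U s \<oplus>\<^bsub>sect (lines 0) U\<^esub> extend_zero U t" for t
    unfolding lines_ops extend_zero_def Y1_ops by (intro restrict_ext HOL.ext) auto
  show "extend_zero U (r \<odot>\<^bsub>sect Y1 U\<^esub> s) = r \<odot>\<^bsub>sect (lines 0) U\<^esub> extend_zero U s" for r
    unfolding lines_ops extend_zero_def Y1_ops by (intro restrict_ext HOL.ext) auto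
  show "res (lines 0) U T (extend_zero U s) = extend_zero T (res Y1 U T s)" for T
    unfolding lines_ops extend_zero_def Y1_ops by (intro restrict_ext HOL.ext) (auto simp: ores_def)
qed

lemma extend_zero_inj: "inj_on (extend_zero U) (secs Y1 U)"
proof (rule inj_onI)
  fix s t assume s: "s \<in> secs Y1 U" and t: "t \<in> secs Y1 U"
    and eq: "extend_zero U s = extend_zero U t"
  show "s = t"
  proof (rule PiE_ext[OF s[unfolded Y1_ops] t[unfolded Y1_ops]])
    fix k assume "k \<in> K - {m}"
    then show "s k = t k" using fun_cong[OF eq, of k] by (simp add: extend_zero_def split: if_splits)
  qed
qed

lemma extend_zero_surj:
  assumes h: "h \<in> secs (lines 0) U" and z: "h m = (\<lambda>x. 0)"
  shows "h \<in> extend_zero U ` secs Y1 U"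
proof (rule image_eqI)
  show "restrict h (K - {m}) \<in> secs Y1 U" using h unfolding Y1_ops lines_ops by auto
  show "h = extend_zero U (restrict h (K - {m}))"
    unfolding extend_zero_def
  proof (rule extensionalityI[of h K])
    show "h \<in> extensional K" using h unfolding lines_ops by (simp add: PiE_iff)
    show "(\<lambda>k\<in>K. if k = m then \<lambda>x. 0 else restrict h (K - {m}) k) \<in> extensional K" by simp
    fix k assume "k \<in> K"
    then show "h k = (\<lambda>k\<in>K. if k = m then \<lambda>x. 0 else restrict h (K - {m}) k) k"
      using z by (cases "k = m") simp_all
  qed
qed

lemma Upsilon1_incl_eq: "Upsilon1_incl n W d U h = to_cosets U (extend_zero U h)"
  unfolding Upsilon1_incl_def to_cosets_def
proof (intro restrict_ext HOL.ext)
  fix k x assume k: "k \<in> K"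
  have "(if k = 2*n+1 then 0 else (\<lambda>pq. h k x * d k pq)) = scl (extend_zero U h k x) (D k)"
  proof (cases "k = 2*n+1")
    case True
    then have "extend_zero U h k x = 0" using k unfolding extend_zero_def by simp
    then show ?thesis using True by (simp only: scl_zero refl if_True)
  next
    case False
    then have "extend_zero U h k x = h k x" "D k = d k" using k unfolding extend_zero_def D_def by simp_all
    then show ?thesis using False by (simp only: scl_def if_False)
  qed
  then show "(if x \<in> \<Union>U then coset (Wk k) (if k = 2*n+1 then 0 else (\<lambda>pq. h k x * d k pq)) else {}) =
      to_coset k U (extend_zero U h k) x" unfolding to_coset_def by (simp only:)
qed

lemma Upsilon1_incl_hom: "sheaf_hom m Y1 (EQ 0) (Upsilon1_incl n W d)"
proof -
  interpret Y: sheaf_mod m Y1 by (rule Y1_sheaf)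
  show ?thesis
    by (rule sheaf_hom_cong[OF sheaf_hom_compose[OF extend_zero_hom to_cosets_hom] Y.mod_closed_axioms
        Upsilon1_incl_eq])
qed

lemma Upsilon1_incl_inj: "zopen m U \<Longrightarrow> inj_on (Upsilon1_incl n W d U) (secs Y1 U)"
proof (rule inj_onI)
  fix s t assume U: "zopen m U" and s: "s \<in> secs Y1 U" and t: "t \<in> secs Y1 U"
    and "Upsilon1_incl n W d U s = Upsilon1_incl n W d U t"
  then have eq: "to_cosets U (extend_zero U s) = to_cosets U (extend_zero U t)" by (simp only: Upsilon1_incl_eq)
  have "extend_zero U s = extend_zero U t"
    using eq sheaf_homD(1)[OF extend_zero_hom U s] sheaf_homD(1)[OF extend_zero_hom U t]
    by (rule inj_onD[OF to_cosets_inj])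
  then show "s = t" using s t by (rule inj_onD[OF extend_zero_inj])
qed

abbreviation NB where "NB \<equiv> twist m (- \<gamma>) (corr_bundle n \<alpha> \<beta> \<gamma> g f)"

text \<open>Both sides ask for a vanishing middle coordinate: the kernel of \<open>corr_map\<close>
  asks it of \<open>\<Lambda>\<close> on each chart, membership in \<open>Upsilon1\<close> asks it
  of \<open>untwist\<close>. These differ by powers of \<open>x i\<close> without zeros. The
  equality is the description of \<open>A'\<close> that \<open>short_exact_coker\<close>
  requires.\<close>

lemma NB_carrier:
  assumes U: "zopen m U"
  shows "secs NB U = {s \<in> secs TQ U.
    wedge_map_tw n \<alpha> \<beta> \<gamma> g W U s \<in> Upsilon1_incl n W d U ` secs Y1 U}"
proof -
  have mK: "m \<in> K" by auto
  have 1: "secs NB U = {s \<in> secs TQ U.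
      \<forall>i\<le>m. corr_map n \<alpha> \<beta> \<gamma> g f (U \<inter> chart m i) (s i) = (\<lambda>x. 0)}"
    unfolding corr_bundle_def sect_twist sect_ker ker_sect_def sect_line_sheaf
    by (auto simp: PiE_iff)
  have 2: "(\<forall>i\<le>m. corr_map n \<alpha> \<beta> \<gamma> g f (U \<inter> chart m i) (s i) = (\<lambda>x. 0)) \<longleftrightarrow>
    wedge_map_tw n \<alpha> \<beta> \<gamma> g W U s \<in> Upsilon1_incl n W d U ` secs Y1 U"
    if s: "s \<in> secs TQ U" for s
  proof -
    have us: "untwist U s \<in> secs (lines 0) U" by (rule sheaf_homD(1)[OF untwist_hom U s])
    have c: "corr_map n \<alpha> \<beta> \<gamma> g f (U \<inter> chart m i) (s i) = \<Lambda> (U \<inter> chart m i) (s i) m" if "i \<le> m" for i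
      by (rule corr_map_eq[OF zop_chart[OF U that] TQ_sect[OF s that]])
    show ?thesis
    proof
      assume z: "\<forall>i\<le>m. corr_map n \<alpha> \<beta> \<gamma> g f (U \<inter> chart m i) (s i) = (\<lambda>x. 0)"
      have "untwist U s m = (\<lambda>x. 0)"
      proof
        fix x show "untwist U s m x = 0"
        proof (cases "x \<in> \<Union>U")
          case True
          define i where "i = (LEAST i. x i \<noteq> 0)"
          have i: "i \<le> m" using least_coord[OF U True] by (simp only: i_def)
          then have "\<Lambda> (U \<inter> chart m i) (s i) m = (\<lambda>x. 0)" using z c by metis
          then show ?thesis unfolding untwist_least[OF mK True] i_def[symmetric] by simp
        next
          case False then show ?thesis by (rule untwist_outside[OF mK])
        qed
      qed
      from extend_zero_surj[OF us this] obtain h where "h \<in> secs Y1 U" "untwist U s = extend_zero U h"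
        by (rule imageE)
      then show "wedge_map_tw n \<alpha> \<beta> \<gamma> g W U s \<in> Upsilon1_incl n W d U ` secs Y1 U"
        unfolding wedge_map_tw_eq[OF U s] by (intro image_eqI[of _ _ h]) (simp only: Upsilon1_incl_eq)
    next
      assume "wedge_map_tw n \<alpha> \<beta> \<gamma> g W U s \<in> Upsilon1_incl n W d U ` secs Y1 U"
      then obtain h where h: "h \<in> secs Y1 U"
        "to_cosets U (untwist U s) = to_cosets U (extend_zero U h)"
        unfolding wedge_map_tw_eq[OF U s] Upsilon1_incl_eq by (rule imageE)
      have "untwist U s = extend_zero U h"
        using h(2) us sheaf_homD(1)[OF extend_zero_hom U h(1)] by (rule inj_onD[OF to_cosets_inj])
      then have "untwist U s m = (\<lambda>x. 0)" using mK by (simp add: extend_zero_def)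
      then show "\<forall>i\<le>m. corr_map n \<alpha> \<beta> \<gamma> g f (U \<inter> chart m i) (s i) = (\<lambda>x. 0)"
        using c untwist_zeroD[OF U s mK] by metis
    qed
  qed
  show ?thesis unfolding 1 using 2 by blast
qed

text \<open>Near \<open>L\<close> some \<open>g i0\<close> has no zero, and the middle coordinate
  \<open>h m\<close> is hit by a section of the split bundle with one nonzero component. Subtracting
  its image leaves a section with zero middle coordinate, which belongs to
  \<open>Upsilon1\<close>.\<close>

lemma decomposition:
  assumes U: "zopen m U" and b: "b \<in> secs (EQ 0) U" and L: "L \<in> U"
  shows "\<exists>T a h. zopen m T \<and> L \<in> T \<and> T \<subseteq> U \<and> a \<in> secs TQ T \<and> h \<in> secs Y1 T \<and>
    res (EQ 0) U T b = Upsilon1_incl n W d T h \<oplus>\<^bsub>sect (EQ 0) T\<^esub> wedge_map_tw n \<alpha> \<beta> \<gamma> g W T a"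
proof -
  have mK: "m \<in> K" by auto
  from b obtain h where h: "h \<in> secs (lines 0) U" "b = to_cosets U h"
    unfolding to_cosets_surj[OF U, symmetric] by (rule imageE)
  have hm: "h m \<in> osect m (wt m) U" using lines_sect[OF h(1) mK] by simp
  from L open_subset_proj[OF U] obtain i0 where i0: "i0 \<le> m" "zopen m (basic_open m (g i0))" "L \<in> basic_open m (g i0)"
    using point_nonzero[of L] by blast
  define T where "T = U \<inter> basic_open m (g i0)"
  have T: "zopen m T" "T \<subseteq> U" "L \<in> T" using U i0 L by (auto simp: T_def)
  have gnz: "g i0 x \<noteq> 0" if "x \<in> \<Union>T" for x using that unfolding T_def by (rule basic_open_nonzero)
  \<comment> \<open>The index paired with \<open>i0\<close> in the middle weight; the coefficient of
    this pair is nonzero by nondegeneracy.\<close>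
  define j0 where "j0 = m - i0"
  define q where "q = 1 / coef m i0 j0"
  have cnz: "coef m i0 j0 \<noteq> 0" unfolding j0_def by (rule coef_N_nonzero[OF i0(1)])
  \<comment> \<open>The quotient solves \<open>coef m i0 j0 * g i0 * e = h m\<close> up to the
    factor \<open>x l powi \<gamma>\<close>. This factor cancels the power in \<open>untwist\<close>
    and gives the family over the charts the transition rule of the twist. It also brings the degree
    to \<open>sw j0\<close>.\<close>
  define e where "e = (\<lambda>l x. ores (T \<inter> chart m l) (\<lambda>x. x l powi \<gamma>) x * (ores (T \<inter> chart m l) (\<lambda>x. q / g i0 x) x *
      ores (T \<inter> chart m l) (h m) x))"
  have e: "e l \<in> osect m (sw j0) (T \<inter> chart m l)" if l: "l \<le> m" for l
  proof -
    have Tl: "zopen m (T \<inter> chart m l)" by (rule zop_chart[OF T(1) l])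
    have nz: "x l \<noteq> 0" if "x \<in> \<Union>(T \<inter> chart m l)" for x
      using cone_chart[OF open_subset_proj[OF T(1)]] that by blast
    have 1: "ores (T \<inter> chart m l) (\<lambda>x. x l powi \<gamma>) \<in> osect m \<gamma> (T \<inter> chart m l)"
      by (rule osect_powi[OF Tl l]) (rule nz)
    have 2: "ores (T \<inter> chart m l) (\<lambda>x. q / g i0 x) \<in>
        osect m (- (\<gamma> + (2 * int n + 1) * \<alpha> + int i0 * (\<beta> - \<alpha>))) (T \<inter> chart m l)"
      by (rule osect_quotient[OF Tl form_const g_forms[OF i0(1)]]) (use gnz in auto)
    have 3: "ores (T \<inter> chart m l) (h m) \<in> osect m (wt m) (T \<inter> chart m l)"
      by (rule osect_ores[OF Tl _ hm]) (use T(2) in auto)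
    have j0: "int j0 = 2 * int n + 1 - int i0" using i0(1) unfolding j0_def by simp
    have deg: "\<gamma> + (- (\<gamma> + (2 * int n + 1) * \<alpha> + int i0 * (\<beta> - \<alpha>)) + wt m) = sw j0"
      unfolding wt_def sw_def j0 by (simp add: algebra_simps)
    show ?thesis unfolding e_def deg[symmetric] by (intro osect_mult 1 2 3)
  qed
  define c where "c = (\<lambda>l. \<lambda>j\<in>{..m}. if j = j0 then e l else (\<lambda>x. 0))"
  have c: "c l \<in> secs SU (T \<inter> chart m l)" if l: "l \<le> m" for l
    unfolding SU_carrier c_def
  proof (rule restrict_PiE_iff[THEN iffD2], rule ballI)
    fix j show "(if j = j0 then e l else (\<lambda>x. 0)) \<in> osect m (sw j) (T \<inter> chart m l)"
      using e[OF l] osect_zero[OF zop_chart[OF T(1) l]] by (cases "j = j0") simp_all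
  qed
  let ?p = "coker_proj m O\<gamma> SU (mult_g n g)"
  define a where "a = (\<lambda>l\<in>{..m}. ?p (T \<inter> chart m l) (c l))"
  have a: "a \<in> secs TQ T"
    unfolding sect_twist
  proof (intro CollectI conjI allI impI)
    show "a \<in> (\<Pi>\<^sub>E i\<in>{..m}. secs QB (T \<inter> chart m i))"
      unfolding a_def QB_eq
      by (rule restrict_PiE_iff[THEN iffD2]) (use Q.proj_closed zop_chart[OF T(1)] c in auto)
    fix i j assume i: "i \<le> m" and j: "j \<le> m"
    let ?S = "T \<inter> chart m i \<inter> chart m j" and ?r = "\<lambda>x. (x i / x j) powi - \<gamma>"
    have Ti: "zopen m (T \<inter> chart m i)" "zopen m (T \<inter> chart m j)" using zop_chart[OF T(1)] i j by auto
    have S: "zopen m ?S" by (rule zop_chart[OF Ti(1) j])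
    have sub: "?S \<subseteq> T \<inter> chart m i" "?S \<subseteq> T \<inter> chart m j" by auto
    have r: "ores ?S ?r \<in> osect m 0 ?S" by (rule osect_ratio_powi[OF S i j chart_coord])
    have ci: "res SU (T \<inter> chart m i) ?S (c i) \<in> secs SU ?S"
      by (rule Q.B.res_closed[OF Ti(1) S sub(1) c[OF i]])
    note p4 = sheaf_homD(4)[OF Q.coker_proj_hom]
    have "res SU (T \<inter> chart m j) ?S (c j) = ores ?S ?r \<odot>\<^bsub>sect SU ?S\<^esub> res SU (T \<inter> chart m i) ?S (c i)"
      unfolding SU_ops
    proof (intro restrict_ext HOL.ext)
      fix k x assume k: "k \<in> {..m}"
      have "ores ?S (e j) x = ores ?S ?r x * ores ?S (e i) x"
      proof (cases "x \<in> \<Union>?S")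
        case True
        then have x: "x i \<noteq> 0" "x j \<noteq> 0" using chart_coord by blast+
        have "x \<in> \<Union>(T \<inter> chart m i)" "x \<in> \<Union>(T \<inter> chart m j)" using True by blast+
        then have "e j x = x j powi \<gamma> * (q / g i0 x * h m x)" "e i x = x i powi \<gamma> * (q / g i0 x * h m x)"
          unfolding e_def ores_def by (simp_all only: if_True)
        moreover have "?r x * x i powi \<gamma> = x j powi \<gamma>"
          using x by (simp add: power_int_divide_distrib power_int_minus field_simps)
        ultimately have "e j x = ?r x * e i x" by (simp only: mult.assoc[symmetric])
        then show ?thesis using True unfolding ores_def by (simp only: if_True)
      next
        case False then show ?thesis unfolding ores_def by (simp only: if_False mult_zero_left)
      qed
      then show "ores ?S (c j k) x = ores ?S ?r x * (\<lambda>k\<in>{..m}. ores ?S (c i k)) k x"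
        using k unfolding c_def by (cases "k = j0") (simp_all add: ores_def)
    qed
    then have "?p ?S (res SU (T \<inter> chart m j) ?S (c j)) =
        ores ?S ?r \<odot>\<^bsub>sect Q.CK ?S\<^esub> ?p ?S (res SU (T \<inter> chart m i) ?S (c i))"
      by (simp only: sheaf_homD(3)[OF Q.coker_proj_hom S r ci])
    then show "res QB (T \<inter> chart m j) ?S (a j) = ores ?S ?r \<odot>\<^bsub>sect QB ?S\<^esub> res QB (T \<inter> chart m i) ?S (a i)"
      using i j unfolding QB_eq a_def
      by (simp only: restrict_apply atMost_iff if_True p4[OF Ti(1) S sub(1) c[OF i]] p4[OF Ti(2) S sub(2) c[OF j]])
  qed
  have ua: "untwist T a \<in> secs (lines 0) T" by (rule sheaf_homD(1)[OF untwist_hom T(1) a])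
  have um: "untwist T a m x = h m x" if x: "x \<in> \<Union>T" for x
  proof -
    define l where "l = (LEAST i. x i \<noteq> 0)"
    have l: "l \<le> m" "x l \<noteq> 0" "x \<in> \<Union>(T \<inter> chart m l)" unfolding l_def by (rule least_coord[OF T(1) x])+
    have "\<Lambda> (T \<inter> chart m l) (a l) = wedge_coords (T \<inter> chart m l) (c l)"
      using Lambda_proj[OF zop_chart[OF T(1) l(1)] c[OF l(1)]] l(1)
      unfolding a_def by (simp only: restrict_apply atMost_iff if_True)
    then have "\<Lambda> (T \<inter> chart m l) (a l) m x = (\<Sum>(i, j)\<in>pairs m. coef m i j * g i x * c l j x)"
      by (simp only: wedge_coords_apply[OF mK])
    \<comment> \<open>\<open>c l\<close> is supported at the index \<open>j0\<close>, and in the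
      middle weight \<open>j = j0\<close> forces \<open>i = i0\<close>, so one term
      survives.\<close>
    also have "\<dots> = (\<Sum>p\<in>pairs m. if p = (i0, j0) then coef m i0 j0 * g i0 x * e l x else 0)"
    proof (rule sum.cong[OF refl])
      fix p assume "p \<in> pairs m"
      then obtain i j where p: "p = (i, j)" "i \<le> m" "j \<le> m" "i + j = m" by auto
      show "(case p of (i, j) \<Rightarrow> coef m i j * g i x * c l j x) =
          (if p = (i0, j0) then coef m i0 j0 * g i0 x * e l x else 0)"
      proof (cases "j = j0")
        case True
        then have "i = i0" using p i0(1) unfolding j0_def by linarith
        then show ?thesis using True p(1,3) unfolding c_def by simp
      next
        case False then show ?thesis using p(1,3) unfolding c_def by simp
      qed
    qed
    also have "\<dots> = coef m i0 j0 * g i0 x * e l x"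
    proof -
      have "(i0, j0) \<in> pairs m" using i0(1) unfolding j0_def by simp
      then show ?thesis by (simp only: sum.delta[OF finite_pairs] if_True)
    qed
    also have "e l x = x l powi \<gamma> * (q / g i0 x * h m x)"
      using l(3) unfolding e_def ores_def by (simp only: if_True)
    also have "coef m i0 j0 * g i0 x * (x l powi \<gamma> * (q / g i0 x * h m x)) = x l powi \<gamma> * h m x"
      using cnz gnz[OF x] unfolding q_def by simp
    finally show ?thesis using l(2)
      unfolding untwist_least[OF mK x] l_def[symmetric] by (simp add: power_int_minus)
  qed
  \<comment> \<open>The remainder after subtracting the image of \<open>a\<close>; its middle
    coordinate is zero by \<open>um\<close>.\<close>
  define h' where "h' = (\<lambda>k\<in>K. \<lambda>x. ores T (h k) x + (-1) * untwist T a k x)"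
  have h': "h' \<in> secs (lines 0) T"
    unfolding lines_ops h'_def
  proof (rule restrict_PiE_iff[THEN iffD2], rule ballI)
    fix k assume k: "k \<in> K"
    show "(\<lambda>x. ores T (h k) x + (-1) * untwist T a k x) \<in> osect m (wt k + 0) T"
      by (rule osect_add[OF osect_ores[OF T(1,2) lines_sect[OF h(1) k]]
            osect_const_mult[OF T(1) lines_sect[OF ua k]]])
  qed
  have "h' m = (\<lambda>x. 0)"
  proof
    fix x show "h' m x = 0"
    proof (cases "x \<in> \<Union>T")
      case True then show ?thesis using um[OF True] mK unfolding h'_def by (simp add: ores_def)
    next
      case False
      then show ?thesis using untwist_outside[OF mK False] mK unfolding h'_def by (simp add: ores_def)
    qed
  qed
  from extend_zero_surj[OF h' this] obtain y where y: "h' = extend_zero T y" "y \<in> secs Y1 T" by (rule imageE)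
  have "res (lines 0) U T h = h' \<oplus>\<^bsub>sect (lines 0) T\<^esub> untwist T a"
    unfolding lines_ops h'_def by (intro restrict_ext HOL.ext) simp
  then have "to_cosets T (res (lines 0) U T h) = to_cosets T (h' \<oplus>\<^bsub>sect (lines 0) T\<^esub> untwist T a)" by (simp only:)
  then have "res (EQ 0) U T b = Upsilon1_incl n W d T y \<oplus>\<^bsub>sect (EQ 0) T\<^esub> wedge_map_tw n \<alpha> \<beta> \<gamma> g W T a"
    unfolding h(2) wedge_map_tw_eq[OF T(1) a] Upsilon1_incl_eq y(1)[symmetric]
      sheaf_homD(4)[OF to_cosets_hom U T(1,2) h(1)] sheaf_homD(2)[OF to_cosets_hom T(1) h' ua] .
  then show ?thesis using T a y(2) by blast
qed

lemma corr_tango_exact: "corr_tango_exact n \<alpha> \<beta> \<gamma> g W f d"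
proof -
  interpret Y: sheaf_mod m Y1 by (rule Y1_sheaf)
  let ?w = "wedge_map_tw n \<alpha> \<beta> \<gamma> g W" and ?i = "Upsilon1_incl n W d"
  let ?f = "\<lambda>U s. inv_into (secs Y1 U) (?i U) (?w U s)"
  have w_zero: "?w U \<zero>\<^bsub>sect TQ U\<^esub> = \<zero>\<^bsub>sect (EQ 0) U\<^esub>" if U: "zopen m U" for U
    unfolding wedge_map_tw_eq[OF U mod_closed.zero_closed[OF TQ_closed U]] untwist_zero[OF U] by (rule to_cosets_zero)
  have w_ker: "s = \<zero>\<^bsub>sect TQ U\<^esub>"
    if U: "zopen m U" and s: "s \<in> secs TQ U" and z: "?w U s = \<zero>\<^bsub>sect (EQ 0) U\<^esub>" for U s
  proof (rule untwist_ker[OF U s])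
    have "to_cosets U (untwist U s) = to_cosets U \<zero>\<^bsub>sect (lines 0) U\<^esub>"
      using z unfolding wedge_map_tw_eq[OF U s] to_cosets_zero .
    moreover have "\<zero>\<^bsub>sect (lines 0) U\<^esub> \<in> secs (lines 0) U"
      unfolding lines_ops by (rule restrict_PiE_iff[THEN iffD2]) (use osect_zero[OF U] in blast)
    ultimately show "untwist U s = \<zero>\<^bsub>sect (lines 0) U\<^esub>"
      using sheaf_homD(1)[OF untwist_hom U s] by (intro inj_onD[OF to_cosets_inj])
  qed
  \<comment> \<open>The kernel sheaf changes the carrier only, so after twisting all operations are
    still literally those of the twisted quotient bundle.\<close>
  have ops: "\<zero>\<^bsub>sect NB U\<^esub> = \<zero>\<^bsub>sect TQ U\<^esub>"
    "s \<oplus>\<^bsub>sect NB U\<^esub> t = s \<oplus>\<^bsub>sect TQ U\<^esub> t"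
    "r \<odot>\<^bsub>sect NB U\<^esub> s = r \<odot>\<^bsub>sect TQ U\<^esub> s"
    "res NB U T s = res TQ U T s" for U T r s t
    unfolding corr_bundle_def sect_twist sect_ker by (rule refl)+
  note se = F.short_exact_coker[OF Y.mod_presheaf_axioms Upsilon1_incl_hom Upsilon1_incl_inj NB_carrier ops
      w_zero w_ker decomposition]
  show ?thesis
    unfolding corr_tango_exact_def tango_bundle_tw_def tango_proj_def
    using se by (intro exI[of _ ?f]) blast
qed

end

theorem proposition3p1p4:
  fixes n \<alpha> \<gamma> :: nat and \<beta> :: int
    and W :: "bivec set" and f :: "bivec \<Rightarrow> complex" and d :: "nat \<Rightarrow> bivec"
    and g :: "nat \<Rightarrow> cvec \<Rightarrow> complex"
  assumes "n \<ge> 1" and "\<gamma> > 0" and "int \<alpha> \<ge> \<beta>" and "int \<alpha> + \<beta> \<ge> 0"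
    and "int \<gamma> > (2 * int n + 1) * \<bar>\<beta>\<bar>"
    and W_subspace: "cfun.subspace W" "W \<subseteq> ext2 n"
    and W_dim: "cfun.dim W = ((2*n+2) choose 2) - 4*n - 1"
    and W_invariant: "W = cfun.span (\<Union>k\<in>{1..4*n+1}. W \<inter> ext2_weight n k)"
    and W_indecomposable: "\<forall>u\<in>vecs (2*n+1). \<forall>v\<in>vecs (2*n+1). wedge u v \<in> W \<longrightarrow> wedge u v = 0"
    and f_linear: "linear_form_on (ext2 n) f"
    and f_nonzero: "\<exists>w\<in>ext2 n. f w \<noteq> 0"
    and f_W: "\<forall>w\<in>W. f w = 0"
    and f_weight: "\<forall>k\<in>{1..4*n+1} - {2*n+1}. \<forall>w\<in>ext2_weight n k. f w = 0"
    and d_choice: "\<forall>k\<in>{1..4*n+1} - {2*n+1}. d k \<in> ext2_weight n k - W"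
    and g_forms: "\<forall>i\<le>2*n+1.
      g i \<in> forms (2*n+1) (int \<gamma> + (2 * int n + 1) * int \<alpha> + int i * (\<beta> - int \<alpha>))"
    and g_no_common_zero: "\<forall>x\<in>vecs (2*n+1). x \<noteq> 0 \<longrightarrow> (\<exists>i\<le>2*n+1. g i x \<noteq> 0)"
  shows "corr_tango_exact n 0 0 1 (\<lambda>i x. x i) W f d \<and>
    corr_tango_exact n (int \<alpha>) \<beta> (int \<gamma>) g W f d"
proof -
  have "tango_space n W f d"
    by (intro tango_space.intro) (fact assms)+
  then interpret tango_space n W f d .
  \<comment> \<open>With weights 0, 0, 1 and the coordinate functions as \<open>g\<close>, the
    bundles become those on P(V); this instance is the sequence from which the weighted one
    starts.\<close>
  interpret P: tango_bundles n W f d 0 0 1 "\<lambda>i x. x i"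
  proof
    show "(\<lambda>x. x i) \<in> forms (2*n+1) (1 + (2 * int n + 1) * 0 + int i * (0 - 0))" if "i \<le> 2*n+1" for i
      using form_coord[OF that] by simp
    show "\<exists>i\<le>2*n+1. x i \<noteq> 0" if "x \<in> vecs (2*n+1)" "x \<noteq> 0" for x
    proof -
      from that(2) obtain i where "x i \<noteq> 0" by (auto simp: fun_eq_iff)
      moreover from this have "\<not> 2*n+1 < i" using that(1) by (auto simp: vecs_def)
      ultimately show ?thesis by (auto simp: not_less)
    qed
  qed
  interpret G: tango_bundles n W f d "int \<alpha>" \<beta> "int \<gamma>" g
    by unfold_locales (use g_forms g_no_common_zero in auto)
  show ?thesis using P.corr_tango_exact G.corr_tango_exact by (rule conjI)
qed

end
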